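(* Let $R$ be a commutative Noetherian local ring of dimension at least two. If $M$ is a nonzero finitely generated $R$-module that is maximal Cohen-Macaulay and Tor-rigid, then $\operatorname{Supp}_R(M)$ contains each prime ideal of $R$ of height two.
   Context: A nonzero finitely generated module $M$ over a Noetherian local ring $R$ is maximal Cohen-Macaulay if $\operatorname{depth}_R(M)=\dim(R)$. A finitely generated $R$-module $M$ is called Tor-rigid if, whenever $\operatorname{Tor}_n^R(M,N)=0$ for some finitely generated $R$-module $N$ and some integer $n\geq 0$, one has $\operatorname{Tor}_j^R(M,N)=0$ for all $j\geq n$. *)

theory Defs
  imports "HOL-Algebra.Module" "HOL-Algebra.Ring_Divisibility" "HOL-Library.Extended_Nat"
begin

text \<open>Rings and modules are those of HOL-Algebra: a module is a record of type
  \<open>('a, 'b) module\<close>, whose multiplicative fields \<open>mult\<close> and \<open>one\<close> are inherited from rings,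
  play no role and are left undefined below.\<close>

subsection \<open>Local rings, dimension and height\<close>

definition noetherian_local_ring :: "('a, 'r) ring_scheme \<Rightarrow> bool" where
  "noetherian_local_ring R \<longleftrightarrow> cring R \<and> noetherian_ring R \<and> (\<exists>!m. maximalideal m R)"

definition max_ideal :: "('a, 'r) ring_scheme \<Rightarrow> 'a set" where
  "max_ideal R = (THE m. maximalideal m R)"

text \<open>\<open>prime_chain R P n\<close>: the primes \<open>P 0 \<subset> P 1 \<subset> \<dots> \<subset> P n\<close> form a strict chain of length \<open>n\<close>.\<close>

definition prime_chain :: "('a, 'r) ring_scheme \<Rightarrow> (nat \<Rightarrow> 'a set) \<Rightarrow> nat \<Rightarrow> bool" where
  "prime_chain R P n \<longleftrightarrow> (\<forall>i\<le>n. primeideal (P i) R) \<and> (\<forall>i<n. P i \<subset> P (Suc i))"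

definition krull_dim :: "('a, 'r) ring_scheme \<Rightarrow> enat" where
  "krull_dim R = Sup {enat n | n. \<exists>P. prime_chain R P n}"

definition height :: "('a, 'r) ring_scheme \<Rightarrow> 'a set \<Rightarrow> enat" where
  "height R p = Sup {enat n | n. \<exists>P. prime_chain R P n \<and> P n = p}"


subsection \<open>Submodules, quotients and homomorphisms\<close>

definition zero_module :: "('a, 'b, 'm) module_scheme \<Rightarrow> bool" where
  "zero_module M \<longleftrightarrow> carrier M = {\<zero>\<^bsub>M\<^esub>}"

definition mspan :: "('a, 'r) ring_scheme \<Rightarrow> ('a, 'b, 'm) module_scheme \<Rightarrow> 'b set \<Rightarrow> 'b set" where
  "mspan R M S = \<Inter> {H. submodule H R M \<and> S \<subseteq> H}"

definition fin_gen :: "('a, 'r) ring_scheme \<Rightarrow> ('a, 'b, 'm) module_scheme \<Rightarrow> bool" where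
  "fin_gen R M \<longleftrightarrow> (\<exists>S. finite S \<and> S \<subseteq> carrier M \<and> mspan R M S = carrier M)"

text \<open>The quotient by a submodule \<open>H\<close>; the union in \<open>smult\<close> is over equal cosets.\<close>

definition quot_mod :: "('a, 'b, 'm) module_scheme \<Rightarrow> 'b set \<Rightarrow> ('a, 'b set) module" where
  "quot_mod M H =
    \<lparr>carrier = a_rcosets\<^bsub>M\<^esub> H, monoid.mult = undefined, one = undefined,
     ring.zero = H, ring.add = (<+>\<^bsub>M\<^esub>),
     smult = (\<lambda>a C. \<Union>x\<in>C. H +>\<^bsub>M\<^esub> (a \<odot>\<^bsub>M\<^esub> x))\<rparr>"

definition mod_hom ::
  "('a, 'r) ring_scheme \<Rightarrow> ('a, 'b, 'm) module_scheme \<Rightarrow> ('a, 'c, 'n) module_scheme \<Rightarrow> ('b \<Rightarrow> 'c) set"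
  where
  "mod_hom R M N = {h \<in> carrier M \<rightarrow> carrier N.
     (\<forall>x\<in>carrier M. \<forall>y\<in>carrier M. h (x \<oplus>\<^bsub>M\<^esub> y) = h x \<oplus>\<^bsub>N\<^esub> h y) \<and>
     (\<forall>a\<in>carrier R. \<forall>x\<in>carrier M. h (a \<odot>\<^bsub>M\<^esub> x) = a \<odot>\<^bsub>N\<^esub> h x)}"


subsection \<open>Regular sequences, depth, maximal Cohen-Macaulay modules\<close>

text \<open>The submodule \<open>(x\<^sub>1, \<dots>, x\<^sub>k)M\<close>.\<close>

definition seq_mult :: "('a, 'r) ring_scheme \<Rightarrow> ('a, 'b, 'm) module_scheme \<Rightarrow> 'a list \<Rightarrow> 'b set" where
  "seq_mult R M xs = mspan R M {x \<odot>\<^bsub>M\<^esub> m | x m. x \<in> set xs \<and> m \<in> carrier M}"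

definition nonzerodivisor_on :: "('a, 'b, 'm) module_scheme \<Rightarrow> 'a \<Rightarrow> bool" where
  "nonzerodivisor_on M x \<longleftrightarrow> (\<forall>m\<in>carrier M. x \<odot>\<^bsub>M\<^esub> m = \<zero>\<^bsub>M\<^esub> \<longrightarrow> m = \<zero>\<^bsub>M\<^esub>)"

definition regular_seq :: "('a, 'r) ring_scheme \<Rightarrow> ('a, 'b, 'm) module_scheme \<Rightarrow> 'a list \<Rightarrow> bool" where
  "regular_seq R M xs \<longleftrightarrow> set xs \<subseteq> carrier R \<and>
     (\<forall>i<length xs. nonzerodivisor_on (quot_mod M (seq_mult R M (take i xs))) (xs ! i)) \<and>
     \<not> zero_module (quot_mod M (seq_mult R M xs))"

definition depth :: "('a, 'r) ring_scheme \<Rightarrow> ('a, 'b, 'm) module_scheme \<Rightarrow> enat" where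
  "depth R M = Sup {enat (length xs) | xs. set xs \<subseteq> max_ideal R \<and> regular_seq R M xs}"

definition maximal_cohen_macaulay ::
  "('a, 'r) ring_scheme \<Rightarrow> ('a, 'b, 'm) module_scheme \<Rightarrow> bool" where
  "maximal_cohen_macaulay R M \<longleftrightarrow>
     module R M \<and> fin_gen R M \<and> \<not> zero_module M \<and> depth R M = krull_dim R"


subsection \<open>Localization and support\<close>

text \<open>\<open>frac_class R M p (m, s)\<close> is the fraction \<open>m/s\<close> of \<open>M\<^sub>p\<close>, as an equivalence class of pairs.\<close>

definition frac_class ::
  "('a, 'r) ring_scheme \<Rightarrow> ('a, 'b, 'm) module_scheme \<Rightarrow> 'a set \<Rightarrow> 'b \<times> 'a \<Rightarrow> ('b \<times> 'a) set" where
  "frac_class R M p = (\<lambda>(m, s). {(m', s'). m' \<in> carrier M \<and> s' \<in> carrier R - p \<and>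
     (\<exists>u\<in>carrier R - p. u \<odot>\<^bsub>M\<^esub> (s' \<odot>\<^bsub>M\<^esub> m) = u \<odot>\<^bsub>M\<^esub> (s \<odot>\<^bsub>M\<^esub> m'))})"

text \<open>The localization \<open>M\<^sub>p\<close> with its \<open>R\<close>-module structure; the unions are over equal classes.\<close>

definition localize ::
  "('a, 'r) ring_scheme \<Rightarrow> ('a, 'b, 'm) module_scheme \<Rightarrow> 'a set \<Rightarrow> ('a, ('b \<times> 'a) set) module" where
  "localize R M p =
    \<lparr>carrier = frac_class R M p ` (carrier M \<times> (carrier R - p)),
     monoid.mult = undefined, one = undefined,
     ring.zero = frac_class R M p (\<zero>\<^bsub>M\<^esub>, \<one>\<^bsub>R\<^esub>),
     ring.add = (\<lambda>A B. \<Union>(m, s)\<in>A. \<Union>(m', s')\<in>B.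
       frac_class R M p (s' \<odot>\<^bsub>M\<^esub> m \<oplus>\<^bsub>M\<^esub> s \<odot>\<^bsub>M\<^esub> m', s \<otimes>\<^bsub>R\<^esub> s')),
     smult = (\<lambda>a A. \<Union>(m, s)\<in>A. frac_class R M p (a \<odot>\<^bsub>M\<^esub> m, s))\<rparr>"

definition Supp :: "('a, 'r) ring_scheme \<Rightarrow> ('a, 'b, 'm) module_scheme \<Rightarrow> 'a set set" where
  "Supp R M = {p. primeideal p R \<and> \<not> zero_module (localize R M p)}"


subsection \<open>Free modules and tensor products\<close>

text \<open>The free module on a set \<open>B\<close>: finitely supported families of ring elements, with
  value zero outside \<open>B\<close>.\<close>

definition free_mod :: "('a, 'r) ring_scheme \<Rightarrow> 'x set \<Rightarrow> ('a, 'x \<Rightarrow> 'a) module" where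
  "free_mod R B =
    \<lparr>carrier = {f. (\<forall>x. f x \<in> carrier R) \<and> finite {x. f x \<noteq> \<zero>\<^bsub>R\<^esub>} \<and> {x. f x \<noteq> \<zero>\<^bsub>R\<^esub>} \<subseteq> B},
     monoid.mult = undefined, one = undefined,
     ring.zero = (\<lambda>_. \<zero>\<^bsub>R\<^esub>), ring.add = (\<lambda>f g x. f x \<oplus>\<^bsub>R\<^esub> g x),
     smult = (\<lambda>a f x. a \<otimes>\<^bsub>R\<^esub> f x)\<rparr>"

definition basis_elem :: "('a, 'r) ring_scheme \<Rightarrow> 'x \<Rightarrow> 'x \<Rightarrow> 'a" where
  "basis_elem R x = (\<lambda>y. if y = x then \<one>\<^bsub>R\<^esub> else \<zero>\<^bsub>R\<^esub>)"

text \<open>The linear map from a free module to \<open>M\<close> sending each basis element \<open>x\<close> to \<open>g x\<close>.\<close>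

definition lin_ext ::
  "('a, 'r) ring_scheme \<Rightarrow> ('a, 'b, 'm) module_scheme \<Rightarrow> ('x \<Rightarrow> 'b) \<Rightarrow> ('x \<Rightarrow> 'a) \<Rightarrow> 'b" where
  "lin_ext R M g f = (\<Oplus>\<^bsub>M\<^esub>x\<in>{x. f x \<noteq> \<zero>\<^bsub>R\<^esub>}. f x \<odot>\<^bsub>M\<^esub> g x)"

definition tensor_rels ::
  "('a, 'r) ring_scheme \<Rightarrow> ('a, 'b, 'm) module_scheme \<Rightarrow> ('a, 'c, 'n) module_scheme
    \<Rightarrow> ('b \<times> 'c \<Rightarrow> 'a) set" where
  "tensor_rels R M N =
    (let F = free_mod R (carrier M \<times> carrier N); e = basis_elem R in
     mspan R F
      ({e (m \<oplus>\<^bsub>M\<^esub> m', n) \<ominus>\<^bsub>F\<^esub> (e (m, n) \<oplus>\<^bsub>F\<^esub> e (m', n)) | m m' n.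
          m \<in> carrier M \<and> m' \<in> carrier M \<and> n \<in> carrier N} \<union>
       {e (m, n \<oplus>\<^bsub>N\<^esub> n') \<ominus>\<^bsub>F\<^esub> (e (m, n) \<oplus>\<^bsub>F\<^esub> e (m, n')) | m n n'.
          m \<in> carrier M \<and> n \<in> carrier N \<and> n' \<in> carrier N} \<union>
       {e (a \<odot>\<^bsub>M\<^esub> m, n) \<ominus>\<^bsub>F\<^esub> a \<odot>\<^bsub>F\<^esub> e (m, n) | a m n.
          a \<in> carrier R \<and> m \<in> carrier M \<and> n \<in> carrier N} \<union>
       {e (m, a \<odot>\<^bsub>N\<^esub> n) \<ominus>\<^bsub>F\<^esub> a \<odot>\<^bsub>F\<^esub> e (m, n) | a m n.
          a \<in> carrier R \<and> m \<in> carrier M \<and> n \<in> carrier N}))"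

definition tensor ::
  "('a, 'r) ring_scheme \<Rightarrow> ('a, 'b, 'm) module_scheme \<Rightarrow> ('a, 'c, 'n) module_scheme
    \<Rightarrow> ('a, ('b \<times> 'c \<Rightarrow> 'a) set) module" where
  "tensor R M N = quot_mod (free_mod R (carrier M \<times> carrier N)) (tensor_rels R M N)"

definition pure_tensor ::
  "('a, 'r) ring_scheme \<Rightarrow> ('a, 'b, 'm) module_scheme \<Rightarrow> ('a, 'c, 'n) module_scheme
    \<Rightarrow> 'b \<Rightarrow> 'c \<Rightarrow> ('b \<times> 'c \<Rightarrow> 'a) set" where
  "pure_tensor R M N m n =
     tensor_rels R M N +>\<^bsub>free_mod R (carrier M \<times> carrier N)\<^esub> basis_elem R (m, n)"

text \<open>The map \<open>f \<otimes> id\<^sub>N\<close> from \<open>M \<otimes> N\<close> to \<open>M' \<otimes> N\<close> induced by a homomorphism \<open>f\<close> from \<open>M\<close> to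
  \<open>M'\<close>: the linear map \<open>e(m, n) \<mapsto> f m \<otimes> n\<close> on the free module is constant on each coset, so the
  image of a coset is a singleton.\<close>

definition tensor_map ::
  "('a, 'r) ring_scheme \<Rightarrow> ('a, 'b', 'm) module_scheme \<Rightarrow> ('a, 'c, 'n) module_scheme
    \<Rightarrow> ('b \<Rightarrow> 'b') \<Rightarrow> ('b \<times> 'c \<Rightarrow> 'a) set \<Rightarrow> ('b' \<times> 'c \<Rightarrow> 'a) set" where
  "tensor_map R M' N f C = the_elem
     (lin_ext R (tensor R M' N) (\<lambda>(m, n). pure_tensor R M' N (f m) n) ` C)"


subsection \<open>Tor and Tor-rigidity\<close>

text \<open>A resolution \<open>\<dots> \<rightarrow> F 1 \<rightarrow> F 0 \<rightarrow> M \<rightarrow> 0\<close> by free modules \<open>F n\<close> of finite rank \<open>b n\<close>, with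
  differentials \<open>d n\<close> from \<open>F (n + 1)\<close> to \<open>F n\<close> and augmentation \<open>\<epsilon>\<close>. Every finitely generated module
  over a Noetherian ring has one, and Tor is used only for such modules in the first argument.\<close>

definition free_resolution ::
  "('a, 'r) ring_scheme \<Rightarrow> ('a, 'b, 'm) module_scheme \<Rightarrow> (nat \<Rightarrow> nat)
    \<Rightarrow> (nat \<Rightarrow> (nat \<Rightarrow> 'a) \<Rightarrow> (nat \<Rightarrow> 'a)) \<Rightarrow> ((nat \<Rightarrow> 'a) \<Rightarrow> 'b) \<Rightarrow> bool" where
  "free_resolution R M b d \<epsilon> \<longleftrightarrow>
    (let F = (\<lambda>n. free_mod R {..<b n}) in
     (\<forall>n. d n \<in> mod_hom R (F (Suc n)) (F n)) \<and>
     \<epsilon> \<in> mod_hom R (F 0) M \<and>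
     \<epsilon> ` carrier (F 0) = carrier M \<and>
     d 0 ` carrier (F 1) = a_kernel (F 0) M \<epsilon> \<and>
     (\<forall>n. d (Suc n) ` carrier (F (Suc (Suc n))) = a_kernel (F (Suc n)) (F n) (d n)))"

text \<open>The homology at \<open>F n \<otimes> N\<close> of the complex \<open>F \<otimes> N\<close>, where the differential out of \<open>F 0 \<otimes> N\<close>
  is zero.\<close>

definition tensor_homology ::
  "('a, 'r) ring_scheme \<Rightarrow> (nat \<Rightarrow> nat) \<Rightarrow> (nat \<Rightarrow> (nat \<Rightarrow> 'a) \<Rightarrow> (nat \<Rightarrow> 'a)) \<Rightarrow> nat
    \<Rightarrow> ('a, 'c, 'n) module_scheme \<Rightarrow> ('a, ((nat \<Rightarrow> 'a) \<times> 'c \<Rightarrow> 'a) set set) module" where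
  "tensor_homology R b d n N =
    (let F = (\<lambda>k. free_mod R {..<b k});
         C = (\<lambda>k. tensor R (F k) N);
         D = (\<lambda>k. tensor_map R (F k) N (d k));
         Z = (case n of 0 \<Rightarrow> carrier (C 0) | Suc k \<Rightarrow> a_kernel (C (Suc k)) (C k) (D k))
     in quot_mod ((C n)\<lparr>carrier := Z\<rparr>) (D n ` carrier (C (Suc n))))"

text \<open>Up to isomorphism the result does not depend on the chosen resolution of \<open>M\<close>.\<close>

definition Tor ::
  "('a, 'r) ring_scheme \<Rightarrow> nat \<Rightarrow> ('a, 'b, 'm) module_scheme \<Rightarrow> ('a, 'c, 'n) module_scheme
    \<Rightarrow> ('a, ((nat \<Rightarrow> 'a) \<times> 'c \<Rightarrow> 'a) set set) module" where
  "Tor R n M N =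
    (let (b, d) = (SOME (b, d). \<exists>\<epsilon>. free_resolution R M b d \<epsilon>) in tensor_homology R b d n N)"

text \<open>HOL does not allow quantification over the type of \<open>N\<close>. The type \<open>(nat \<Rightarrow> 'a) set\<close> contains the
  carriers of all quotients of the modules \<open>free_mod R {..<k}\<close>, hence an isomorphic copy of every
  finitely generated \<open>R\<close>-module.\<close>

definition tor_rigid :: "('a, 'r) ring_scheme \<Rightarrow> ('a, 'b, 'm) module_scheme \<Rightarrow> bool" where
  "tor_rigid R M \<longleftrightarrow> module R M \<and> fin_gen R M \<and>
    (\<forall>(N :: ('a, (nat \<Rightarrow> 'a) set) module) n. module R N \<and> fin_gen R N \<longrightarrow>
       zero_module (Tor R n M N) \<longrightarrow> (\<forall>j\<ge>n. zero_module (Tor R j M N)))"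

end

theory Submission
  imports Defs
begin

text \<open>Every prime lies in the support. Let \<open>q\<close> be a minimal prime below a prime \<open>p\<close> outside
  \<open>Supp M\<close>. If \<open>q\<close> consists of zero divisors on \<open>M\<close>, it is contained, by prime avoidance, in an
  associated prime \<open>P\<close> of \<open>M\<close>, and strictly so because \<open>M\<^sub>p = 0\<close>. Each \<open>M\<close>-regular sequence of length
  \<open>n\<close> in the maximal ideal yields a chain of primes of length \<open>n\<close> starting at \<open>P\<close>, which \<open>q\<close>
  prolongs; as the depth is finite by Rees' exchange argument, \<open>depth M < dim R\<close>, a contradiction.
  Otherwise \<open>q\<close> contains an \<open>M\<close>-regular element \<open>x\<close>. Then \<open>Tor\<^sub>1(M, R/xR) = 0\<close>, so by rigidity
  \<open>Tor\<^sub>2(M, R/xR) = 0\<close>. For \<open>K = (0 : x)\<close> the latter makes \<open>M \<otimes> K \<rightarrow> M\<close> injective, but \<open>K M = 0\<close>, so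
  \<open>M \<otimes> K = 0\<close> and \<open>K = 0\<close>: the element \<open>x\<close> is a nonzerodivisor of \<open>R\<close>, which is impossible in a
  minimal prime.\<close>

subsection \<open>Modules and quotients\<close>

text \<open>Passing from M/A to M/(A + xM) is iterated along regular sequences, and nested quotient
  records would change type at each stage. Hence M stays fixed, its submodules A vary, and
  statements on M/A become congruences modulo A in M. Finiteness of the depth matters because depth
  and dimension live in \<open>enat\<close>: the strict inequality comes from a regular sequence
  that attains the supremum. For K = (0 : x), the sequences 0 -> K -> R -> xR -> 0 and 0 -> xR -> R
  -> R/xR -> 0 give Tor_1(M, R/xR) = (0 :_M x)/KM and Tor_2(M, R/xR) = Tor_1(M, xR) = ker (M
  \<otimes> K -> M). That M \<otimes> K = 0 forces K = 0 rests on the local ring: otherwise both M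
  and K would have the residue field as a quotient. In the proof M \<otimes> K is never formed.
  Tensoring with R/xR reduces a free resolution modulo x, and the two maps onto the residue field
  turn the vanishing of Tor_2 directly into a contradiction.\<close>

context module
begin

lemma smult_comm:
  assumes "a \<in> carrier R" "b \<in> carrier R" "u \<in> carrier M"
  shows "a \<odot>\<^bsub>M\<^esub> (b \<odot>\<^bsub>M\<^esub> u) = b \<odot>\<^bsub>M\<^esub> (a \<odot>\<^bsub>M\<^esub> u)"
  using assms by (metis R.m_comm smult_assoc1)

lemma smult_minus_distr:
  assumes "a \<in> carrier R" "u \<in> carrier M" "v \<in> carrier M"
  shows "a \<odot>\<^bsub>M\<^esub> (u \<ominus>\<^bsub>M\<^esub> v) = a \<odot>\<^bsub>M\<^esub> u \<ominus>\<^bsub>M\<^esub> a \<odot>\<^bsub>M\<^esub> v"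
  using assms by (simp add: M.minus_eq smult_r_distr smult_r_minus)

lemma minus_eq_zero_iff:
  assumes "u \<in> carrier M" "v \<in> carrier M"
  shows "u \<ominus>\<^bsub>M\<^esub> v = \<zero>\<^bsub>M\<^esub> \<longleftrightarrow> u = v"
  using assms by (metis M.minus_eq M.a_inv_closed M.minus_equality M.minus_minus M.r_neg)

lemma submodule_zero: "submodule H R M \<Longrightarrow> \<zero>\<^bsub>M\<^esub> \<in> H"
  by (metis submodule.axioms(1) subgroup.one_closed monoid.simps(2))

lemma submodule_subset: "submodule H R M \<Longrightarrow> u \<in> H \<Longrightarrow> u \<in> carrier M"
  using submoduleE(1) by blast

lemma submodule_diff: "submodule H R M \<Longrightarrow> u \<in> H \<Longrightarrow> v \<in> H \<Longrightarrow> u \<ominus>\<^bsub>M\<^esub> v \<in> H"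
  by (simp add: M.minus_eq submoduleE(3,5))

lemma submodule_abelian_subgroup: "submodule H R M \<Longrightarrow> abelian_subgroup H M"
  by (intro abelian_subgroupI3 additive_subgroup.intro submodule.axioms(1) M.abelian_group_axioms)

lemma zero_submodule: "submodule {\<zero>\<^bsub>M\<^esub>} R M"
  by (rule submoduleI) auto

lemma submodule_Inter:
  assumes "\<And>H. H \<in> \<H> \<Longrightarrow> submodule H R M" "\<H> \<noteq> {}"
  shows "submodule (\<Inter>\<H>) R M"
  using assms
  by (intro submoduleI) (auto simp: submoduleE submodule_zero dest: submodule_subset)

lemma submodule_mspan: "S \<subseteq> carrier M \<Longrightarrow> submodule (mspan R M S) R M"
  unfolding mspan_def using carrier_is_submodule by (intro submodule_Inter) auto

lemma mspan_superset: "S \<subseteq> mspan R M S"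
  by (auto simp: mspan_def)

lemma mspan_least: "submodule H R M \<Longrightarrow> S \<subseteq> H \<Longrightarrow> mspan R M S \<subseteq> H"
  by (auto simp: mspan_def)

lemma submodule_cyclic:
  assumes "u \<in> carrier M"
  shows "submodule {a \<odot>\<^bsub>M\<^esub> u | a. a \<in> carrier R} R M"
  by (rule submoduleI)
    (use assms in \<open>fastforce simp: smult_l_minus[symmetric] smult_l_distr[symmetric]
      smult_assoc1[symmetric] intro: exI[of _ \<zero>]\<close>)+

lemma a_coset_mem_iff:
  assumes "submodule H R M" "u \<in> carrier M"
  shows "v \<in> H +>\<^bsub>M\<^esub> u \<longleftrightarrow> v \<in> carrier M \<and> v \<ominus>\<^bsub>M\<^esub> u \<in> H"
  using abelian_subgroup.a_rcos_module[OF submodule_abelian_subgroup[OF assms(1)] assms(2)]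
    abelian_subgroup.a_elemrcos_carrier[OF submodule_abelian_subgroup[OF assms(1)] assms(2)]
  by (auto simp: M.minus_eq)

lemma a_coset_eq_iff:
  assumes "submodule H R M" "u \<in> carrier M" "v \<in> carrier M"
  shows "H +>\<^bsub>M\<^esub> u = H +>\<^bsub>M\<^esub> v \<longleftrightarrow> u \<ominus>\<^bsub>M\<^esub> v \<in> H"
  using abelian_subgroup.a_repr_independence'[OF submodule_abelian_subgroup[OF assms(1)] _ assms(3)]
    abelian_subgroup.a_repr_independenceD[OF submodule_abelian_subgroup[OF assms(1)] assms(2)]
    a_coset_mem_iff[OF assms(1,3)] assms(2)
  by metis

lemma minus_zero_right: "u \<in> carrier M \<Longrightarrow> u \<ominus>\<^bsub>M\<^esub> \<zero>\<^bsub>M\<^esub> = u"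
  by (simp add: M.minus_eq M.add.inv_one)

lemma a_coset_eq_self_iff:
  assumes "submodule H R M" "u \<in> carrier M"
  shows "H +>\<^bsub>M\<^esub> u = H \<longleftrightarrow> u \<in> H"
  using a_coset_eq_iff[OF assms M.zero_closed] M.a_coset_add_zero[OF submoduleE(1)[OF assms(1)]]
    minus_zero_right[OF assms(2)] by simp

lemma quot_mod_carrier: "carrier (quot_mod M H) = (\<lambda>u. H +>\<^bsub>M\<^esub> u) ` carrier M"
  by (auto simp: quot_mod_def A_RCOSETS_def')

lemma quot_mod_zero: "\<zero>\<^bsub>quot_mod M H\<^esub> = H"
  by (simp add: quot_mod_def)

lemma quot_mod_add:
  assumes "submodule H R M" "u \<in> carrier M" "v \<in> carrier M"
  shows "(H +>\<^bsub>M\<^esub> u) \<oplus>\<^bsub>quot_mod M H\<^esub> (H +>\<^bsub>M\<^esub> v) = H +>\<^bsub>M\<^esub> (u \<oplus>\<^bsub>M\<^esub> v)"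
  using abelian_subgroup.a_rcos_sum[OF submodule_abelian_subgroup] assms by (simp add: quot_mod_def)

lemma quot_mod_smult:
  assumes H: "submodule H R M" and a: "a \<in> carrier R" and u: "u \<in> carrier M"
  shows "a \<odot>\<^bsub>quot_mod M H\<^esub> (H +>\<^bsub>M\<^esub> u) = H +>\<^bsub>M\<^esub> (a \<odot>\<^bsub>M\<^esub> u)"
proof -
  have "H +>\<^bsub>M\<^esub> (a \<odot>\<^bsub>M\<^esub> v) = H +>\<^bsub>M\<^esub> (a \<odot>\<^bsub>M\<^esub> u)" if "v \<in> H +>\<^bsub>M\<^esub> u" for v
    using that a u submoduleE(4)[OF H a]
    by (simp add: a_coset_mem_iff[OF H] a_coset_eq_iff[OF H] smult_minus_distr[symmetric])
  then have "(\<Union>v\<in>H +>\<^bsub>M\<^esub> u. H +>\<^bsub>M\<^esub> (a \<odot>\<^bsub>M\<^esub> v)) = H +>\<^bsub>M\<^esub> (a \<odot>\<^bsub>M\<^esub> u)"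
    using abelian_subgroup.a_rcos_self[OF submodule_abelian_subgroup[OF H] u]
    by (intro SUP_eq_const) blast+
  then show ?thesis
    by (simp add: quot_mod_def)
qed

lemma quot_mod_module:
  assumes H: "submodule H R M"
  shows "module R (quot_mod M H)"
proof (rule moduleI)
  have zero: "\<zero>\<^bsub>quot_mod M H\<^esub> = H +>\<^bsub>M\<^esub> \<zero>\<^bsub>M\<^esub>"
    by (simp add: quot_mod_zero M.a_coset_add_zero submoduleE(1)[OF H])
  show "abelian_group (quot_mod M H)"
  proof (rule abelian_groupI, goal_cases)
    case (6 C)
    then obtain u where u: "u \<in> carrier M" "C = H +>\<^bsub>M\<^esub> u" by (auto simp: quot_mod_carrier)
    then have "(H +>\<^bsub>M\<^esub> (\<ominus>\<^bsub>M\<^esub> u)) \<oplus>\<^bsub>quot_mod M H\<^esub> C = \<zero>\<^bsub>quot_mod M H\<^esub>"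
      by (simp add: quot_mod_add[OF H] M.l_neg zero)
    then show ?case using u by (auto simp: quot_mod_carrier)
  qed (auto simp: quot_mod_carrier quot_mod_add[OF H] zero M.a_ac)
qed (use H in \<open>auto simp: quot_mod_carrier quot_mod_add quot_mod_smult smult_l_distr
      smult_r_distr smult_assoc1 R.cring_axioms\<close>)

lemma zero_module_quot_mod_iff:
  assumes H: "submodule H R M"
  shows "zero_module (quot_mod M H) \<longleftrightarrow> H = carrier M"
proof -
  have "zero_module (quot_mod M H) \<longleftrightarrow> (\<forall>u\<in>carrier M. H +>\<^bsub>M\<^esub> u = H)"
    unfolding zero_module_def quot_mod_carrier quot_mod_zero
    using M.zero_closed by (simp add: set_eq_iff image_iff) blast
  also have "\<dots> \<longleftrightarrow> H = carrier M"
    using submoduleE(1)[OF H] by (auto simp: a_coset_eq_self_iff[OF H])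
  finally show ?thesis .
qed

lemma nonzerodivisor_on_quot_mod_iff:
  assumes H: "submodule H R M" and x: "x \<in> carrier R"
  shows "nonzerodivisor_on (quot_mod M H) x \<longleftrightarrow>
    (\<forall>u\<in>carrier M. x \<odot>\<^bsub>M\<^esub> u \<in> H \<longrightarrow> u \<in> H)"
  using x by (simp add: nonzerodivisor_on_def quot_mod_carrier quot_mod_zero quot_mod_smult[OF H]
      a_coset_eq_self_iff[OF H])

end

subsection \<open>Homomorphisms\<close>

lemma mod_homI:
  assumes "\<And>u. u \<in> carrier M \<Longrightarrow> h u \<in> carrier N"
    and "\<And>u v. u \<in> carrier M \<Longrightarrow> v \<in> carrier M \<Longrightarrow> h (u \<oplus>\<^bsub>M\<^esub> v) = h u \<oplus>\<^bsub>N\<^esub> h v"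
    and "\<And>a u. a \<in> carrier R \<Longrightarrow> u \<in> carrier M \<Longrightarrow> h (a \<odot>\<^bsub>M\<^esub> u) = a \<odot>\<^bsub>N\<^esub> h u"
  shows "h \<in> mod_hom R M N"
  using assms by (auto simp: mod_hom_def)

locale module_hom = M?: module R M + N: module R N
  for R :: "('a, 'r) ring_scheme" (structure)
    and M :: "('a, 'b, 'm) module_scheme" and N :: "('a, 'c, 'n) module_scheme" +
  fixes h
  assumes mod_hom: "h \<in> mod_hom R M N"
begin

lemma hom_closed [simp, intro]: "u \<in> carrier M \<Longrightarrow> h u \<in> carrier N"
  using mod_hom by (auto simp: mod_hom_def)

lemma hom_add: "u \<in> carrier M \<Longrightarrow> v \<in> carrier M \<Longrightarrow> h (u \<oplus>\<^bsub>M\<^esub> v) = h u \<oplus>\<^bsub>N\<^esub> h v"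
  using mod_hom by (auto simp: mod_hom_def)

lemma hom_smult: "a \<in> carrier R \<Longrightarrow> u \<in> carrier M \<Longrightarrow> h (a \<odot>\<^bsub>M\<^esub> u) = a \<odot>\<^bsub>N\<^esub> h u"
  using mod_hom by (auto simp: mod_hom_def)

lemma hom_zero: "h \<zero>\<^bsub>M\<^esub> = \<zero>\<^bsub>N\<^esub>"
  using hom_smult[of \<zero> "\<zero>\<^bsub>M\<^esub>"] by simp

lemma hom_uminus: "u \<in> carrier M \<Longrightarrow> h (\<ominus>\<^bsub>M\<^esub> u) = \<ominus>\<^bsub>N\<^esub> h u"
  using hom_smult[of "\<ominus> \<one>" u] by (simp add: smult_l_minus N.smult_l_minus)

lemma hom_minus: "u \<in> carrier M \<Longrightarrow> v \<in> carrier M \<Longrightarrow> h (u \<ominus>\<^bsub>M\<^esub> v) = h u \<ominus>\<^bsub>N\<^esub> h v"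
  by (simp add: a_minus_def hom_add hom_uminus)

lemma submodule_image:
  assumes "submodule H R M"
  shows "submodule (h ` H) R N"
proof (rule N.submoduleI)
  show "\<zero>\<^bsub>N\<^esub> \<in> h ` H" using hom_zero submodule_zero[OF assms] by (metis imageI)
qed (use submoduleE[OF assms] in \<open>auto simp: hom_add[symmetric] hom_smult[symmetric]
      hom_uminus[symmetric] submodule_subset[OF assms]\<close>)

lemma submodule_vimage:
  assumes "submodule H R N"
  shows "submodule {u \<in> carrier M. h u \<in> H} R M"
  using N.submoduleE[OF assms] N.submodule_zero[OF assms]
  by (intro submoduleI) (auto simp: hom_add hom_smult hom_uminus hom_zero)

lemma a_kernel_eq: "a_kernel M N h = {u \<in> carrier M. h u = \<zero>\<^bsub>N\<^esub>}"
  by (simp add: a_kernel_def')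

lemma submodule_a_kernel: "submodule (a_kernel M N h) R M"
  using submodule_vimage[OF N.zero_submodule] by (simp add: a_kernel_eq)

end

subsection \<open>Free modules\<close>

context cring
begin

lemma free_mod_carrier_iff:
  "f \<in> carrier (free_mod R B) \<longleftrightarrow>
    (\<forall>x. f x \<in> carrier R) \<and> finite {x. f x \<noteq> \<zero>} \<and> (\<forall>x. x \<notin> B \<longrightarrow> f x = \<zero>)"
  by (auto simp: free_mod_def)

lemma free_mod_simps:
  "\<zero>\<^bsub>free_mod R B\<^esub> = (\<lambda>_. \<zero>)"
  "f \<oplus>\<^bsub>free_mod R B\<^esub> g = (\<lambda>x. f x \<oplus> g x)"
  "a \<odot>\<^bsub>free_mod R B\<^esub> f = (\<lambda>x. a \<otimes> f x)"
  by (simp_all add: free_mod_def)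

lemma free_mod_module: "module R (free_mod R B)"
proof (rule moduleI)
  show "abelian_group (free_mod R B)"
  proof (rule abelian_groupI, goal_cases)
    case (1 f g)
    moreover have "{x. f x \<oplus> g x \<noteq> \<zero>} \<subseteq> {x. f x \<noteq> \<zero>} \<union> {x. g x \<noteq> \<zero>}" by auto
    ultimately show ?case
      by (auto simp: free_mod_carrier_iff free_mod_simps intro: finite_subset[OF _ finite_UnI])
  next
    case (6 f)
    have "{x. \<ominus> f x \<noteq> \<zero>} \<subseteq> {x. f x \<noteq> \<zero>}" by auto
    then show ?case
      using 6 by (intro bexI[of _ "\<lambda>x. \<ominus> f x"])
        (auto simp: free_mod_carrier_iff free_mod_simps l_neg intro: finite_subset)
  qed (auto simp: free_mod_carrier_iff free_mod_simps a_ac)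
next
  fix a f assume "a \<in> carrier R" "f \<in> carrier (free_mod R B)"
  moreover have "{x. a \<otimes> f x \<noteq> \<zero>} \<subseteq> {x. f x \<noteq> \<zero>}" using \<open>a \<in> carrier R\<close> by auto
  ultimately show "a \<odot>\<^bsub>free_mod R B\<^esub> f \<in> carrier (free_mod R B)"
    by (auto simp: free_mod_carrier_iff free_mod_simps intro: finite_subset)
qed (auto simp: free_mod_carrier_iff free_mod_simps l_distr r_distr m_assoc cring_axioms)

lemma free_mod_uminus:
  assumes "g \<in> carrier (free_mod R B)"
  shows "\<ominus>\<^bsub>free_mod R B\<^esub> g = (\<lambda>x. \<ominus> g x)"
  using module.smult_l_minus[OF free_mod_module one_closed assms] assms
  by (simp add: free_mod_simps free_mod_carrier_iff l_minus)

lemma free_mod_minus: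
  assumes "f \<in> carrier (free_mod R B)" "g \<in> carrier (free_mod R B)"
  shows "f \<ominus>\<^bsub>free_mod R B\<^esub> g = (\<lambda>x. f x \<ominus> g x)"
  using assms by (simp add: a_minus_def free_mod_uminus free_mod_simps)

lemma basis_elem_closed: "x \<in> B \<Longrightarrow> basis_elem R x \<in> carrier (free_mod R B)"
  by (auto simp: basis_elem_def free_mod_carrier_iff)

end

context module
begin

text \<open>Allows families with different supports to be summed over one common finite index set,
  which is what additivity of \<open>lin_ext\<close> requires.\<close>

lemma lin_ext_eq:
  assumes "finite S" "{x. f x \<noteq> \<zero>} \<subseteq> S" "\<And>x. f x \<in> carrier R" "\<And>x. x \<in> S \<Longrightarrow> g x \<in> carrier M"
  shows "lin_ext R M g f = (\<Oplus>\<^bsub>M\<^esub>x\<in>S. f x \<odot>\<^bsub>M\<^esub> g x)"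
  unfolding lin_ext_def
  by (rule M.add.finprod_mono_neutral_cong_left[OF assms(1,2)]) (use assms in auto)

lemma lin_ext_hom:
  assumes g: "\<And>x. x \<in> B \<Longrightarrow> g x \<in> carrier M"
  shows "lin_ext R M g \<in> mod_hom R (free_mod R B) M"
proof (rule mod_homI)
  fix f assume f: "f \<in> carrier (free_mod R B)"
  show "lin_ext R M g f \<in> carrier M"
    unfolding lin_ext_def using f g by (intro M.finsum_closed) (auto simp: R.free_mod_carrier_iff)
next
  fix f f' assume f: "f \<in> carrier (free_mod R B)" "f' \<in> carrier (free_mod R B)"
  let ?S = "{x. f x \<noteq> \<zero>} \<union> {x. f' x \<noteq> \<zero>}"
  have S: "finite ?S" "?S \<subseteq> B" using f by (auto simp: R.free_mod_carrier_iff)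
  have fR: "\<And>x. f x \<in> carrier R" "\<And>x. f' x \<in> carrier R" using f by (auto simp: R.free_mod_carrier_iff)
  have gS: "\<And>x. x \<in> ?S \<Longrightarrow> g x \<in> carrier M" using g S by auto
  have eq: "lin_ext R M g f'' = (\<Oplus>\<^bsub>M\<^esub>x\<in>?S. f'' x \<odot>\<^bsub>M\<^esub> g x)"
    if "\<And>x. f'' x \<in> carrier R" "{x. f'' x \<noteq> \<zero>} \<subseteq> ?S" for f''
    using that gS S(1) by (intro lin_ext_eq) auto
  have "lin_ext R M g (f \<oplus>\<^bsub>free_mod R B\<^esub> f') = (\<Oplus>\<^bsub>M\<^esub>x\<in>?S. (f x \<oplus> f' x) \<odot>\<^bsub>M\<^esub> g x)"
    by (subst eq) (auto simp: fR R.free_mod_simps)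
  also have "\<dots> = (\<Oplus>\<^bsub>M\<^esub>x\<in>?S. f x \<odot>\<^bsub>M\<^esub> g x \<oplus>\<^bsub>M\<^esub> f' x \<odot>\<^bsub>M\<^esub> g x)"
    using gS by (intro M.finsum_cong') (auto simp: fR smult_l_distr)
  also have "\<dots> = (\<Oplus>\<^bsub>M\<^esub>x\<in>?S. f x \<odot>\<^bsub>M\<^esub> g x) \<oplus>\<^bsub>M\<^esub> (\<Oplus>\<^bsub>M\<^esub>x\<in>?S. f' x \<odot>\<^bsub>M\<^esub> g x)"
    using gS by (intro M.finsum_addf) (auto simp: fR)
  also have "\<dots> = lin_ext R M g f \<oplus>\<^bsub>M\<^esub> lin_ext R M g f'"
    using eq[of f] eq[of f'] fR by auto
  finally show "lin_ext R M g (f \<oplus>\<^bsub>free_mod R B\<^esub> f') = lin_ext R M g f \<oplus>\<^bsub>M\<^esub> lin_ext R M g f'" .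
next
  fix a f assume a: "a \<in> carrier R" and f: "f \<in> carrier (free_mod R B)"
  let ?S = "{x. f x \<noteq> \<zero>}"
  have S: "finite ?S" "?S \<subseteq> B" and fR: "\<And>x. f x \<in> carrier R"
    using f by (auto simp: R.free_mod_carrier_iff)
  have gS: "\<And>x. x \<in> ?S \<Longrightarrow> g x \<in> carrier M" using g S by auto
  have "lin_ext R M g (a \<odot>\<^bsub>free_mod R B\<^esub> f) = (\<Oplus>\<^bsub>M\<^esub>x\<in>?S. (a \<otimes> f x) \<odot>\<^bsub>M\<^esub> g x)"
    using a gS S(1) fR by (subst lin_ext_eq[where S = ?S]) (auto simp: R.free_mod_simps)
  also have "\<dots> = (\<Oplus>\<^bsub>M\<^esub>x\<in>?S. a \<odot>\<^bsub>M\<^esub> (f x \<odot>\<^bsub>M\<^esub> g x))"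
    using gS a by (intro M.finsum_cong') (auto simp: fR smult_assoc1)
  also have "\<dots> = a \<odot>\<^bsub>M\<^esub> lin_ext R M g f"
    unfolding lin_ext_def using gS a S(1) fR by (subst finsum_smult_ldistr) auto
  finally show "lin_ext R M g (a \<odot>\<^bsub>free_mod R B\<^esub> f) = a \<odot>\<^bsub>M\<^esub> lin_ext R M g f" .
qed

lemma lin_ext_basis_elem:
  assumes "g x \<in> carrier M"
  shows "lin_ext R M g (basis_elem R x) = g x"
  using assms by (subst lin_ext_eq[where S = "{x}"]) (auto simp: basis_elem_def)

end

context cring
begin

text \<open>Induction on the support, removing one coordinate at a time. The set \<open>S\<close>
  carries along a property shared by all nonzero coefficients; it is used with the annihilator of
  x.\<close>

lemma free_mod_induct_coeffs [consumes 2, case_names zero add]: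
  assumes "f \<in> carrier (free_mod R B)" and "\<And>x. f x \<noteq> \<zero> \<Longrightarrow> f x \<in> S"
    and "P (\<lambda>_. \<zero>)"
    and "\<And>f a x. \<lbrakk>f \<in> carrier (free_mod R B); P f; a \<in> carrier R; a \<in> S; x \<in> B\<rbrakk>
      \<Longrightarrow> P (f \<oplus>\<^bsub>free_mod R B\<^esub> a \<odot>\<^bsub>free_mod R B\<^esub> basis_elem R x)"
  shows "P f"
proof -
  have "finite {x. f x \<noteq> \<zero>}" using assms(1) by (simp add: free_mod_carrier_iff)
  then show ?thesis using assms(1,2)
  proof (induction "{x. f x \<noteq> \<zero>}" arbitrary: f rule: finite_induct)
    case empty
    then have "f = (\<lambda>_. \<zero>)" by auto
    then show ?case using assms(3) by simp
  next
    case (insert x X)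
    let ?f = "f(x := \<zero>)"
    have X: "{y. ?f y \<noteq> \<zero>} = X" using insert.hyps(2,4) by auto
    have f': "?f \<in> carrier (free_mod R B)"
      using insert.prems(1) insert.hyps(1) X by (auto simp: free_mod_carrier_iff)
    have "f x \<noteq> \<zero>" using insert.hyps(4) by blast
    then have x: "x \<in> B" "f x \<in> carrier R" "f x \<in> S"
      using insert.prems by (auto simp: free_mod_carrier_iff)
    have "f = ?f \<oplus>\<^bsub>free_mod R B\<^esub> f x \<odot>\<^bsub>free_mod R B\<^esub> basis_elem R x"
      using insert.prems(1) by (auto simp: free_mod_simps free_mod_carrier_iff basis_elem_def fun_eq_iff)
    moreover have "P ?f"
      using insert.prems(2) by (intro insert.hyps(3)[OF X[symmetric] f']) (auto split: if_splits)
    ultimately show ?case using assms(4)[OF f' _ x(2,3,1)] by simp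
  qed
qed

lemma free_mod_induct [consumes 1, case_names zero add]:
  assumes "f \<in> carrier (free_mod R B)"
    and "P (\<lambda>_. \<zero>)"
    and "\<And>f a x. \<lbrakk>f \<in> carrier (free_mod R B); P f; a \<in> carrier R; x \<in> B\<rbrakk>
      \<Longrightarrow> P (f \<oplus>\<^bsub>free_mod R B\<^esub> a \<odot>\<^bsub>free_mod R B\<^esub> basis_elem R x)"
  shows "P f"
  using assms by (rule free_mod_induct_coeffs[where S = UNIV, OF _ UNIV_I])

end

subsection \<open>Noetherian modules and free resolutions\<close>

text \<open>Finite generation rather than a chain condition: generators are what free covers
  consume, and maximal submodules are derived from them.\<close>

definition noetherian_module :: "('a, 'r) ring_scheme \<Rightarrow> ('a, 'b, 'm) module_scheme \<Rightarrow> bool" where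
  "noetherian_module R M \<longleftrightarrow>
    (\<forall>H. submodule H R M \<longrightarrow> (\<exists>S. finite S \<and> S \<subseteq> H \<and> mspan R M S = H))"

lemma noetherian_moduleE:
  assumes "noetherian_module R M" "submodule H R M"
  obtains S where "finite S" "S \<subseteq> H" "mspan R M S = H"
  using assms by (auto simp: noetherian_module_def)

text \<open>The union of a chain has finitely many generators, which already lie in one member, so
  the chain attains its union and Zorn's lemma applies.\<close>

lemma (in module) noetherian_module_maximal:
  assumes noeth: "noetherian_module R M"
    and sub: "\<And>H. H \<in> \<H> \<Longrightarrow> submodule H R M" and ne: "\<H> \<noteq> {}"
  shows "\<exists>H\<in>\<H>. \<forall>K\<in>\<H>. H \<subseteq> K \<longrightarrow> K = H"
proof -
  have "\<Union>\<C> \<in> \<H>" if \<C>: "\<C> \<noteq> {}" "subset.chain \<H> \<C>" for \<C>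
  proof -
    have subC: "\<And>H. H \<in> \<C> \<Longrightarrow> submodule H R M"
      and chain: "\<And>H K. H \<in> \<C> \<Longrightarrow> K \<in> \<C> \<Longrightarrow> H \<subseteq> K \<or> K \<subseteq> H"
      using \<C>(2) sub by (auto simp: pred_on.chain_def) blast
    have "submodule (\<Union>\<C>) R M"
    proof (rule submoduleI)
      show "\<Union>\<C> \<subseteq> carrier M" using subC submoduleE(1) by blast
      show "\<zero>\<^bsub>M\<^esub> \<in> \<Union>\<C>" using subC submodule_zero \<C>(1) by blast
      fix u v assume "u \<in> \<Union>\<C>" "v \<in> \<Union>\<C>"
      then obtain H where "H \<in> \<C>" "u \<in> H" "v \<in> H" using chain by blast
      then show "u \<oplus>\<^bsub>M\<^esub> v \<in> \<Union>\<C>" using submoduleE(5)[OF subC] by blast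
    qed (use subC submoduleE(3,4) in blast)+
    then obtain S where S: "finite S" "S \<subseteq> \<Union>\<C>" "mspan R M S = \<Union>\<C>"
      by (rule noetherian_moduleE[OF noeth])
    obtain H where H: "H \<in> \<C>" "S \<subseteq> H"
      using finite_subset_Union_chain[OF S(1,2) \<C>(1,2)] by blast
    then have "\<Union>\<C> = H" using mspan_least[OF subC[OF H(1)] H(2)] S(3) by blast
    then show ?thesis using H(1) \<C>(2) by (auto simp: pred_on.chain_def)
  qed
  from subset_Zorn_nonempty[OF ne this] show ?thesis .
qed

lemma (in cring) noetherian_maximal_ideal:
  assumes "noetherian_ring R"
    and sub: "\<And>I. I \<in> \<I> \<Longrightarrow> ideal I R" and ne: "\<I> \<noteq> {}"
  shows "\<exists>I\<in>\<I>. \<forall>J\<in>\<I>. I \<subseteq> J \<longrightarrow> J = I"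
proof -
  have "\<Union>\<C> \<in> \<I>" if \<C>: "\<C> \<noteq> {}" "subset.chain \<I> \<C>" for \<C>
  proof -
    have "subset.chain {I. ideal I R} \<C>" using \<C>(2) sub by (auto simp: pred_on.chain_def)
    from noetherian_ring.ideal_chain_is_trivial[OF assms(1) \<C>(1) this]
    show ?thesis using \<C>(2) by (auto simp: pred_on.chain_def)
  qed
  from subset_Zorn_nonempty[OF ne this] show ?thesis .
qed

context module_hom
begin

lemma image_mspan_subset:
  assumes "S \<subseteq> carrier M"
  shows "h ` mspan R M S \<subseteq> mspan R N (h ` S)"
proof -
  have "submodule (mspan R N (h ` S)) R N" using assms by (intro N.submodule_mspan) auto
  from mspan_least[OF submodule_vimage[OF this], of S] show ?thesis
    using assms N.mspan_superset by blast
qed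

lemma noetherian_image:
  assumes "noetherian_module R M" "h ` carrier M = carrier N"
  shows "noetherian_module R N"
  unfolding noetherian_module_def
proof (intro allI impI)
  fix H assume H: "submodule H R N"
  let ?V = "{u \<in> carrier M. h u \<in> H}"
  obtain S where S: "finite S" "S \<subseteq> ?V" "mspan R M S = ?V"
    by (rule noetherian_moduleE[OF assms(1) submodule_vimage[OF H]])
  have "mspan R N (h ` S) \<subseteq> H" using S(2) by (intro N.mspan_least[OF H]) auto
  moreover have "H \<subseteq> mspan R N (h ` S)"
  proof
    fix v assume "v \<in> H"
    moreover then have "v \<in> h ` carrier M" using assms(2) N.submodule_subset[OF H] by blast
    ultimately have "v \<in> h ` mspan R M S" using S(3) by blast
    then show "v \<in> mspan R N (h ` S)" using image_mspan_subset[of S] S(2) by blast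
  qed
  ultimately have "mspan R N (h ` S) = H" ..
  moreover have "h ` S \<subseteq> H" using S(2) by blast
  ultimately show "\<exists>S. finite S \<and> S \<subseteq> H \<and> mspan R N S = H"
    using S(1) by blast
qed

end

context cring
begin

lemma module_hom_free_mod:
  assumes "module R M" "h \<in> mod_hom R (free_mod R B) M"
  shows "module_hom R (free_mod R B) M h"
  using assms free_mod_module by (simp add: module_hom_def module_hom_axioms_def)

text \<open>Descent on coordinates: the values at the last coordinate form a finitely generated
  ideal, and the elements vanishing there have one coordinate fewer.\<close>

lemma noetherian_free_mod:
  assumes noeth: "noetherian_ring R"
  shows "noetherian_module R (free_mod R {..<N::nat})"
proof -
  let ?F = "free_mod R {..<N}"
  interpret F: module R ?F by (rule free_mod_module)
  \<comment> \<open>The induction runs over a bound \<open>k\<close> on the nonzero coordinates of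
    \<open>H\<close>, with the rank \<open>N\<close> fixed, so that all submodules live in one free
    module.\<close>
  have "\<exists>S. finite S \<and> S \<subseteq> H \<and> mspan R ?F S = H"
    if "submodule H R ?F" "\<And>f i. f \<in> H \<Longrightarrow> k \<le> i \<Longrightarrow> f i = \<zero>" for H k
    using that
  proof (induction k arbitrary: H)
    case 0
    have "H = {\<zero>\<^bsub>?F\<^esub>}"
      using 0(2) F.submodule_zero[OF 0(1)] by (fastforce simp: free_mod_simps)
    then show ?case using F.mspan_superset[of "{\<zero>\<^bsub>?F\<^esub>}"] F.mspan_least[OF F.zero_submodule]
      by (intro exI[of _ H]) auto
  next
    case (Suc k)
    note E = F.submoduleE[OF Suc.prems(1)] and sub = F.submodule_subset[OF Suc.prems(1)]
    \<comment> \<open>Stated for every submodule \<open>K\<close>, because it serves both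
      \<open>H\<close> and the span of the candidate generators.\<close>
    have coord_ideal: "ideal {f k | f. f \<in> K} R" if K: "submodule K R ?F" for K
    proof (rule idealI[OF ring_axioms])
      have Kc: "\<And>f. f \<in> K \<Longrightarrow> f k \<in> carrier R"
        using F.submodule_subset[OF K] by (auto simp: free_mod_carrier_iff)
      show "subgroup {f k |f. f \<in> K} (add_monoid R)"
      proof (rule add.subgroupI)
        show "{f k |f. f \<in> K} \<noteq> {}" using F.submodule_zero[OF K] by auto
        fix a assume "a \<in> {f k |f. f \<in> K}"
        then obtain f where f: "f \<in> K" "a = f k" by auto
        then have "\<ominus>\<^bsub>?F\<^esub> f \<in> K" "(\<ominus>\<^bsub>?F\<^esub> f) k = \<ominus> a"
          using F.submoduleE(3)[OF K] F.submodule_subset[OF K] by (auto simp: free_mod_uminus)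
        then show "\<ominus> a \<in> {f k |f. f \<in> K}" by (metis (mono_tags, lifting) mem_Collect_eq)
      next
        fix a b assume "a \<in> {f k |f. f \<in> K}" "b \<in> {f k |f. f \<in> K}"
        then show "a \<oplus> b \<in> {f k |f. f \<in> K}"
          using F.submoduleE(5)[OF K] by (force simp: free_mod_simps)
      qed (use Kc in auto)
      fix a x assume "a \<in> {f k |f. f \<in> K}" and x: "x \<in> carrier R"
      then obtain f where f: "f \<in> K" "a = f k" by auto
      have "x \<odot>\<^bsub>?F\<^esub> f \<in> K" using F.submoduleE(4)[OF K x f(1)] .
      then show "x \<otimes> a \<in> {f k |f. f \<in> K}" using f by (force simp: free_mod_simps)
      then show "a \<otimes> x \<in> {f k |f. f \<in> K}" using x Kc[OF f(1)] f(2) by (simp add: m_comm)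
    qed
    obtain T where T: "finite T" "T \<subseteq> carrier R" "{f k | f. f \<in> H} = Idl T"
      using noetherian_ring.finetely_gen[OF noeth coord_ideal[OF Suc.prems(1)]] by blast
    have "\<forall>t\<in>T. \<exists>f\<in>H. f k = t"
    proof
      fix t assume "t \<in> T"
      then have "t \<in> {f k | f. f \<in> H}" using genideal_self[OF T(2)] unfolding T(3) by (rule rev_subsetD)
      then show "\<exists>f\<in>H. f k = t" by auto
    qed
    then obtain g where g: "\<And>t. t \<in> T \<Longrightarrow> g t \<in> H \<and> g t k = t" by metis
    define H' where "H' = {f \<in> H. f k = \<zero>}"
    have H': "submodule H' R ?F"
    proof (rule F.submoduleI)
      fix f assume "f \<in> H'"
      moreover have "\<ominus>\<^bsub>?F\<^esub> f \<in> H" "(\<ominus>\<^bsub>?F\<^esub> f) k = \<ominus> f k"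
        using \<open>f \<in> H'\<close> E(3) sub by (auto simp: H'_def free_mod_uminus)
      ultimately show "\<ominus>\<^bsub>?F\<^esub> f \<in> H'" by (simp add: H'_def)
    qed (use E F.submodule_zero[OF Suc.prems(1)] in \<open>auto simp: H'_def free_mod_simps\<close>)
    have "\<exists>S. finite S \<and> S \<subseteq> H' \<and> mspan R ?F S = H'"
    proof (rule Suc.IH[OF H'])
      fix f i assume "f \<in> H'" "k \<le> i"
      then show "f i = \<zero>" using Suc.prems(2)[of f i] by (cases "i = k") (auto simp: H'_def)
    qed
    then obtain S where S: "finite S" "S \<subseteq> H'" "mspan R ?F S = H'" by blast
    let ?S = "S \<union> g ` T"
    have S_sub: "?S \<subseteq> H" using S(2) g by (auto simp: H'_def)
    then have span: "submodule (mspan R ?F ?S) R ?F" using E(1) by (intro F.submodule_mspan) auto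
    have span_H: "mspan R ?F ?S \<subseteq> H" by (rule F.mspan_least[OF Suc.prems(1) S_sub])
    have "H' \<subseteq> mspan R ?F ?S"
      using F.mspan_least[OF span, of S] F.mspan_superset[of ?S] S(3) by blast
    moreover have "Idl T \<subseteq> {f k | f. f \<in> mspan R ?F ?S}"
    proof (rule genideal_minimal[OF coord_ideal[OF span]], rule)
      fix t assume "t \<in> T"
      then have "g t \<in> mspan R ?F ?S" "t = g t k" using F.mspan_superset[of ?S] g by auto
      then show "t \<in> {f k | f. f \<in> mspan R ?F ?S}" by blast
    qed
    \<comment> \<open>An element of the span with the same coordinate at \<open>k\<close> is
      subtracted; the difference lies in \<open>H'\<close>, which the span contains.\<close>
    ultimately have "H \<subseteq> mspan R ?F ?S"
    proof (intro subsetI)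
      fix f assume f: "f \<in> H"
      assume H'_sub: "H' \<subseteq> mspan R ?F ?S" and "Idl T \<subseteq> {f k | f. f \<in> mspan R ?F ?S}"
      then obtain f' where f': "f' \<in> mspan R ?F ?S" "f' k = f k" using f T(3) by force
      then have f'H: "f' \<in> H" using span_H by blast
      have "f \<ominus>\<^bsub>?F\<^esub> f' \<in> H" using F.submodule_diff[OF Suc.prems(1) f f'H] .
      moreover have "(f \<ominus>\<^bsub>?F\<^esub> f') k = \<zero>"
        using free_mod_minus[OF sub[OF f] sub[OF f'H]] f'(2) sub[OF f] by (simp add: free_mod_carrier_iff)
      ultimately have "f \<ominus>\<^bsub>?F\<^esub> f' \<in> mspan R ?F ?S" using H'_sub by (auto simp: H'_def)
      from F.submoduleE(5)[OF span this f'(1)] show "f \<in> mspan R ?F ?S"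
        using sub[OF f] sub[OF f'H] by (simp add: F.minus_eq F.a_assoc F.l_neg)
    qed
    then have "mspan R ?F ?S = H" using span_H by blast
    moreover have "finite ?S" using S(1) T(1) by blast
    ultimately show ?case using S_sub by blast
  qed
  then show ?thesis
    unfolding noetherian_module_def
    using F.submodule_subset by (metis free_mod_carrier_iff lessThan_iff linorder_not_less)
qed

end

context module
begin

text \<open>Enumerating the finite set \<open>S\<close> by an initial segment of the naturals gives
  a cover of the shape that \<open>free_resolution\<close> demands.\<close>

lemma mspan_eq_free_image:
  assumes "finite S" "S \<subseteq> carrier M"
  obtains b :: nat and h where "h \<in> mod_hom R (free_mod R {..<b}) M"
    "h ` carrier (free_mod R {..<b}) = mspan R M S"
proof -
  obtain g and b :: nat where g: "g ` {..<b} = S"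
    using finite_imp_nat_seg_image_inj_on[OF assms(1)] by (auto simp: lessThan_def)
  let ?F = "free_mod R {..<b}" and ?h = "lin_ext R M g"
  have gM: "\<And>i. i \<in> {..<b} \<Longrightarrow> g i \<in> carrier M" using g assms(2) by blast
  have h: "?h \<in> mod_hom R ?F M" by (rule lin_ext_hom[OF gM])
  interpret h: module_hom R ?F M ?h using R.module_hom_free_mod[OF module_axioms h] .
  have "mspan R M S \<subseteq> ?h ` carrier ?F"
  proof (rule mspan_least[OF h.submodule_image[OF h.M.carrier_is_submodule]], rule)
    fix s assume "s \<in> S"
    then obtain i where i: "i \<in> {..<b}" "s = g i" using g by blast
    then have "s = ?h (basis_elem R i)" using lin_ext_basis_elem[of g i] gM[OF i(1)] by simp
    then show "s \<in> ?h ` carrier ?F" using R.basis_elem_closed[OF i(1)] by (rule image_eqI)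
  qed
  moreover have "?h f \<in> mspan R M S" if "f \<in> carrier ?F" for f
    using that
  proof (induction rule: R.free_mod_induct)
    case zero
    then show ?case using h.hom_zero submodule_zero[OF submodule_mspan[OF assms(2)]]
      by (simp add: R.free_mod_simps)
  next
    case (add f a x)
    have "g x \<in> S" using add(3) g by blast
    then have "g x \<in> mspan R M S" using mspan_superset[of S] by (rule rev_subsetD)
    then show ?case
      using add submoduleE(4,5)[OF submodule_mspan[OF assms(2)]] R.basis_elem_closed[OF add(3)]
      by (simp add: h.hom_add h.hom_smult lin_ext_basis_elem gM)
  qed
  ultimately show ?thesis using that[OF h] by blast
qed

lemma fin_gen_noetherian:
  assumes "noetherian_ring R" "fin_gen R M"
  shows "noetherian_module R M"
proof -
  obtain S where "finite S" "S \<subseteq> carrier M" "mspan R M S = carrier M"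
    using assms(2) by (auto simp: fin_gen_def)
  then obtain b h where h: "h \<in> mod_hom R (free_mod R {..<b::nat}) M"
    "h ` carrier (free_mod R {..<b}) = carrier M"
    by (metis mspan_eq_free_image)
  interpret h: module_hom R "free_mod R {..<b}" M h
    using R.module_hom_free_mod[OF module_axioms h(1)] .
  show ?thesis using h.noetherian_image[OF R.noetherian_free_mod[OF assms(1)] h(2)] .
qed

text \<open>\<open>Tor\<close> selects a resolution with \<open>SOME\<close>, so it says nothing
  until one is known to exist. Every kernel is a submodule of a finite free module, hence covered by
  another one.\<close>

lemma free_resolution_exists:
  assumes noeth: "noetherian_ring R" and fg: "fin_gen R M"
  shows "\<exists>b d \<epsilon>. free_resolution R M b d \<epsilon>"
proof -
  let ?F = "\<lambda>b::nat. free_mod R {..<b}"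
  obtain S where "finite S" "S \<subseteq> carrier M" "mspan R M S = carrier M"
    using fg by (auto simp: fin_gen_def)
  then obtain b0 \<epsilon> where \<epsilon>: "\<epsilon> \<in> mod_hom R (?F b0) M" "\<epsilon> ` carrier (?F b0) = carrier M"
    by (metis mspan_eq_free_image)
  interpret \<epsilon>: module_hom R "?F b0" M \<epsilon> using R.module_hom_free_mod[OF module_axioms \<epsilon>(1)] .
  have cover: "\<exists>b' d. d \<in> mod_hom R (?F b') (?F b) \<and> d ` carrier (?F b') = H"
    if sub: "submodule H R (?F b)" for H b
  proof -
    interpret F: module R "?F b" by (rule R.free_mod_module)
    obtain S where S: "finite S" "S \<subseteq> H" "mspan R (?F b) S = H"
      by (rule noetherian_moduleE[OF R.noetherian_free_mod[OF noeth] sub])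
    then have "S \<subseteq> carrier (?F b)" using F.submoduleE(1)[OF sub] by blast
    from F.mspan_eq_free_image[OF S(1) this] S(3) show ?thesis by metis
  qed
  \<comment> \<open>A state consists of target rank, source rank and differential. \<open>P\<close>
    asks for linearity and, at the start, for a cover of the kernel of \<open>\<epsilon>\<close>;
    \<open>Q\<close> says that the next differential covers the kernel of the present one.\<close>
  define P where "P n s = (case s of (b, b', d) \<Rightarrow> d \<in> mod_hom R (?F b') (?F b) \<and>
    (n = (0::nat) \<longrightarrow> b = b0 \<and> d ` carrier (?F b') = a_kernel (?F b0) M \<epsilon>))" for n s
  define Q where "Q (n::nat) s t = (case s of (b, b', d) \<Rightarrow> case t of (c, c', e) \<Rightarrow>
    c = b' \<and> e ` carrier (?F c') = a_kernel (?F b') (?F b) d)" for n and s t :: "nat \<times> nat \<times> ((nat \<Rightarrow> 'a) \<Rightarrow> nat \<Rightarrow> 'a)"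
  have "\<exists>f. \<forall>n. P n (f n) \<and> Q n (f n) (f (Suc n))"
  proof (rule dependent_nat_choice)
    show "\<exists>s. P 0 s" using cover[OF \<epsilon>.submodule_a_kernel] by (auto simp: P_def)
  next
    fix s n assume "P n s"
    obtain b b' d where s: "s = (b, b', d)" by (cases s)
    have "d \<in> mod_hom R (?F b') (?F b)" using \<open>P n s\<close> by (simp add: P_def s)
    then interpret d: module_hom R "?F b'" "?F b" d
      by (rule R.module_hom_free_mod[OF R.free_mod_module])
    show "\<exists>t. P (Suc n) t \<and> Q n s t"
      using cover[OF d.submodule_a_kernel] by (auto simp: P_def Q_def s)
  qed
  then obtain f where f: "\<And>n. P n (f n)" "\<And>n. Q n (f n) (f (Suc n))" by blast
  define b where "b n = fst (f n)" for n
  define d where "d n = snd (snd (f n))" for n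
  have b': "fst (snd (f n)) = b (Suc n)" for n
    using f(2)[of n] by (auto simp: Q_def b_def split: prod.splits)
  have f_eq: "f n = (b n, b (Suc n), d n)" for n
    by (simp add: b_def[symmetric] d_def b'[symmetric] prod_eq_iff)
  have "b 0 = b0" using f(1)[of 0] by (simp add: P_def f_eq)
  then have "free_resolution R M b d \<epsilon>"
    using f \<epsilon> by (simp add: free_resolution_def Let_def f_eq P_def Q_def)
  then show ?thesis by blast
qed

end

subsection \<open>Tensor products\<close>

definition multiples :: "('a, 'b, 'm) module_scheme \<Rightarrow> 'a \<Rightarrow> 'b set" where
  "multiples M x = (\<lambda>u. x \<odot>\<^bsub>M\<^esub> u) ` carrier M"

lemma (in module) submodule_multiples:
  assumes "x \<in> carrier R"
  shows "submodule (multiples M x) R M"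
proof -
  have "(\<lambda>u. x \<odot>\<^bsub>M\<^esub> u) \<in> mod_hom R M M"
    using assms by (intro mod_homI) (auto simp: smult_r_distr smult_comm)
  then interpret h: module_hom R M M "\<lambda>u. x \<odot>\<^bsub>M\<^esub> u"
    using module_axioms by (simp add: module_hom_def module_hom_axioms_def)
  show ?thesis unfolding multiples_def by (rule h.submodule_image[OF carrier_is_submodule])
qed

lemma (in module) smult_in_multiples: "u \<in> carrier M \<Longrightarrow> x \<odot>\<^bsub>M\<^esub> u \<in> multiples M x"
  by (simp add: multiples_def)

locale tensor_product = M?: module R M + N: module R N
  for R :: "('a, 'r) ring_scheme" (structure)
    and M :: "('a, 'b, 'm) module_scheme" and N :: "('a, 'c, 'n) module_scheme"
begin

abbreviation "F \<equiv> free_mod R (carrier M \<times> carrier N)"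

abbreviation "T \<equiv> tensor_rels R M N"

abbreviation "e \<equiv> basis_elem R"

abbreviation "pt \<equiv> pure_tensor R M N"

sublocale F: module R F
  by (rule R.free_mod_module)

lemma basis_closed: "m \<in> carrier M \<Longrightarrow> n \<in> carrier N \<Longrightarrow> e (m, n) \<in> carrier F"
  by (rule R.basis_elem_closed) simp

lemmas rel_closed = basis_closed M.add.m_closed N.add.m_closed F.add.m_closed M.smult_closed
  N.smult_closed F.smult_closed F.M.minus_closed

lemma tensor_rels_submodule: "submodule T R F"
  unfolding tensor_rels_def Let_def
  by (intro F.submodule_mspan Un_least subsetI) (elim CollectE exE conjE, simp add: rel_closed)+

lemma tensor_rels_mem:
  assumes "m \<in> carrier M" "n \<in> carrier N"
  shows "m' \<in> carrier M \<Longrightarrow> e (m \<oplus>\<^bsub>M\<^esub> m', n) \<ominus>\<^bsub>F\<^esub> (e (m, n) \<oplus>\<^bsub>F\<^esub> e (m', n)) \<in> T"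
    and "n' \<in> carrier N \<Longrightarrow> e (m, n \<oplus>\<^bsub>N\<^esub> n') \<ominus>\<^bsub>F\<^esub> (e (m, n) \<oplus>\<^bsub>F\<^esub> e (m, n')) \<in> T"
    and "a \<in> carrier R \<Longrightarrow> e (a \<odot>\<^bsub>M\<^esub> m, n) \<ominus>\<^bsub>F\<^esub> a \<odot>\<^bsub>F\<^esub> e (m, n) \<in> T"
    and "a \<in> carrier R \<Longrightarrow> e (m, a \<odot>\<^bsub>N\<^esub> n) \<ominus>\<^bsub>F\<^esub> a \<odot>\<^bsub>F\<^esub> e (m, n) \<in> T"
  unfolding tensor_rels_def Let_def using assms
  by (intro subsetD[OF F.mspan_superset]; blast)+

text \<open>The relations are checked only modulo a submodule \<open>H\<close> of the target. This
  admits maps that become bilinear only after reduction modulo xM.\<close>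

lemma tensor_rels_least:
  assumes Q: "module R Q" and h: "h \<in> mod_hom R F Q" and H: "submodule H R Q"
    and "\<And>m m' n. \<lbrakk>m \<in> carrier M; m' \<in> carrier M; n \<in> carrier N\<rbrakk> \<Longrightarrow>
      h (e (m \<oplus>\<^bsub>M\<^esub> m', n)) \<ominus>\<^bsub>Q\<^esub> (h (e (m, n)) \<oplus>\<^bsub>Q\<^esub> h (e (m', n))) \<in> H"
    and "\<And>m n n'. \<lbrakk>m \<in> carrier M; n \<in> carrier N; n' \<in> carrier N\<rbrakk> \<Longrightarrow>
      h (e (m, n \<oplus>\<^bsub>N\<^esub> n')) \<ominus>\<^bsub>Q\<^esub> (h (e (m, n)) \<oplus>\<^bsub>Q\<^esub> h (e (m, n'))) \<in> H"
    and "\<And>a m n. \<lbrakk>a \<in> carrier R; m \<in> carrier M; n \<in> carrier N\<rbrakk> \<Longrightarrow>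
      h (e (a \<odot>\<^bsub>M\<^esub> m, n)) \<ominus>\<^bsub>Q\<^esub> a \<odot>\<^bsub>Q\<^esub> h (e (m, n)) \<in> H"
    and "\<And>a m n. \<lbrakk>a \<in> carrier R; m \<in> carrier M; n \<in> carrier N\<rbrakk> \<Longrightarrow>
      h (e (m, a \<odot>\<^bsub>N\<^esub> n)) \<ominus>\<^bsub>Q\<^esub> a \<odot>\<^bsub>Q\<^esub> h (e (m, n)) \<in> H"
    and t: "t \<in> T"
  shows "h t \<in> H"
proof -
  interpret h: module_hom R F Q h by (rule R.module_hom_free_mod[OF Q h])
  have "T \<subseteq> {f \<in> carrier F. h f \<in> H}"
    unfolding tensor_rels_def Let_def
    by (intro F.mspan_least h.submodule_vimage[OF H] Un_least subsetI;
        elim CollectE exE conjE; simp add: rel_closed h.hom_minus h.hom_add h.hom_smult assms(4-7))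
  then show ?thesis using t by auto
qed

lemma tensor_module: "module R (tensor R M N)"
  unfolding tensor_def by (rule F.quot_mod_module[OF tensor_rels_submodule])

sublocale T: module R "tensor R M N"
  by (rule tensor_module)

lemma tensor_zero: "\<zero>\<^bsub>tensor R M N\<^esub> = T"
  by (simp add: tensor_def F.quot_mod_zero)

lemma pure_tensor_closed [simp]:
  "m \<in> carrier M \<Longrightarrow> n \<in> carrier N \<Longrightarrow> pt m n \<in> carrier (tensor R M N)"
  by (simp add: pure_tensor_def tensor_def F.quot_mod_carrier basis_closed)

lemma pure_tensor_add_left:
  assumes "m \<in> carrier M" "m' \<in> carrier M" "n \<in> carrier N"
  shows "pt (m \<oplus>\<^bsub>M\<^esub> m') n = pt m n \<oplus>\<^bsub>tensor R M N\<^esub> pt m' n"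
  using assms tensor_rels_mem(1)[of m n m']
  by (simp add: pure_tensor_def tensor_def F.quot_mod_add tensor_rels_submodule rel_closed
      F.a_coset_eq_iff)

lemma pure_tensor_add_right:
  assumes "m \<in> carrier M" "n \<in> carrier N" "n' \<in> carrier N"
  shows "pt m (n \<oplus>\<^bsub>N\<^esub> n') = pt m n \<oplus>\<^bsub>tensor R M N\<^esub> pt m n'"
  using assms tensor_rels_mem(2)[of m n n']
  by (simp add: pure_tensor_def tensor_def F.quot_mod_add tensor_rels_submodule rel_closed
      F.a_coset_eq_iff)

lemma pure_tensor_smult_left:
  assumes "a \<in> carrier R" "m \<in> carrier M" "n \<in> carrier N"
  shows "pt (a \<odot>\<^bsub>M\<^esub> m) n = a \<odot>\<^bsub>tensor R M N\<^esub> pt m n"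
  using assms tensor_rels_mem(3)[of m n a]
  by (simp add: pure_tensor_def tensor_def F.quot_mod_smult tensor_rels_submodule rel_closed
      F.a_coset_eq_iff)

lemma pure_tensor_smult_right:
  assumes "a \<in> carrier R" "m \<in> carrier M" "n \<in> carrier N"
  shows "pt m (a \<odot>\<^bsub>N\<^esub> n) = a \<odot>\<^bsub>tensor R M N\<^esub> pt m n"
  using assms tensor_rels_mem(4)[of m n a]
  by (simp add: pure_tensor_def tensor_def F.quot_mod_smult tensor_rels_submodule rel_closed
      F.a_coset_eq_iff)

lemma pure_tensor_hom: "n \<in> carrier N \<Longrightarrow> (\<lambda>m. pt m n) \<in> mod_hom R M (tensor R M N)"
  by (intro mod_homI) (simp_all add: pure_tensor_add_left pure_tensor_smult_left)

end

text \<open>\<open>tensor_map\<close> is defined with \<open>the_elem\<close>, so the work is to see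
  that the linear extension kills every relation and is thus constant on a coset.\<close>

lemma tensor_map_pure_tensor:
  assumes M: "module R M" and M': "module R M'" and N: "module R N"
    and f: "f \<in> mod_hom R M M'" and mn: "m \<in> carrier M" "n \<in> carrier N"
  shows "tensor_map R M' N f (pure_tensor R M N m n) = pure_tensor R M' N (f m) n"
proof -
  interpret A: tensor_product R M N using M N by (simp add: tensor_product_def)
  interpret B: tensor_product R M' N using M' N by (simp add: tensor_product_def)
  interpret f: module_hom R M M' f using M M' f by (simp add: module_hom_def module_hom_axioms_def)
  define g where "g = (\<lambda>(m, n). pure_tensor R M' N (f m) n)"
  define L where "L = lin_ext R (tensor R M' N) g"
  have g_closed: "\<And>x. x \<in> carrier M \<times> carrier N \<Longrightarrow> g x \<in> carrier (tensor R M' N)"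
    by (auto simp: g_def)
  have L_hom: "L \<in> mod_hom R A.F (tensor R M' N)"
    unfolding L_def by (rule B.T.lin_ext_hom[OF g_closed])
  interpret L: module_hom R A.F "tensor R M' N" L
    by (rule A.R.module_hom_free_mod[OF B.tensor_module L_hom])
  have L_e: "L (A.e (m, n)) = pure_tensor R M' N (f m) n" if "m \<in> carrier M" "n \<in> carrier N" for m n
    using B.T.lin_ext_basis_elem[of g "(m, n)"] that by (simp add: L_def g_def)
  have L_T: "L t = \<zero>\<^bsub>tensor R M' N\<^esub>" if "t \<in> A.T" for t
    using A.tensor_rels_least[OF B.tensor_module L_hom B.T.zero_submodule _ _ _ _ that]
    by (simp add: L_e f.hom_add f.hom_smult B.pure_tensor_add_left B.pure_tensor_add_right
        B.pure_tensor_smult_left B.pure_tensor_smult_right B.T.minus_eq_zero_iff)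
  have "L \<phi> = pure_tensor R M' N (f m) n" if "\<phi> \<in> pure_tensor R M N m n" for \<phi>
  proof -
    have \<phi>: "\<phi> \<in> carrier A.F" "\<phi> \<ominus>\<^bsub>A.F\<^esub> A.e (m, n) \<in> A.T"
      using that A.F.a_coset_mem_iff[OF A.tensor_rels_submodule A.basis_closed[OF mn]]
      by (auto simp: pure_tensor_def)
    then have "L \<phi> \<ominus>\<^bsub>tensor R M' N\<^esub> L (A.e (m, n)) = \<zero>\<^bsub>tensor R M' N\<^esub>"
      using L_T L.hom_minus[OF \<phi>(1) A.basis_closed[OF mn]] by simp
    then show ?thesis using L_e[OF mn] \<phi>(1) mn A.basis_closed[OF mn]
      by (metis B.T.minus_eq_zero_iff L.hom_closed)
  qed
  \<comment> \<open>The coset is nonempty, so its image is a singleton and not the empty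
    set.\<close>
  moreover have "A.e (m, n) \<in> pure_tensor R M N m n"
    using A.F.a_coset_mem_iff[OF A.tensor_rels_submodule A.basis_closed[OF mn]] A.basis_closed[OF mn]
      A.F.submodule_zero[OF A.tensor_rels_submodule]
    by (simp add: pure_tensor_def A.F.minus_eq_zero_iff[THEN iffD2])
  ultimately have "L ` pure_tensor R M N m n = {pure_tensor R M' N (f m) n}" by blast
  then show ?thesis by (simp add: tensor_map_def L_def g_def)
qed

text \<open>\<open>N\<close> is a copy of the cyclic module \<open>R / xR\<close>.\<close>

locale cyclic_quotient = N: module R N
  for R :: "('a, 'r) ring_scheme" (structure) and N :: "('a, 'c, 'n) module_scheme" and x n1 +
  assumes x_closed: "x \<in> carrier R" and n1_closed: "n1 \<in> carrier N"
    and generates: "n \<in> carrier N \<Longrightarrow> \<exists>a\<in>carrier R. n = a \<odot>\<^bsub>N\<^esub> n1"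
    and annihilator: "a \<in> carrier R \<Longrightarrow> a \<odot>\<^bsub>N\<^esub> n1 = \<zero>\<^bsub>N\<^esub> \<longleftrightarrow> (\<exists>s\<in>carrier R. a = x \<otimes> s)"

locale tensor_cyclic = tensor_product R M N + cyclic_quotient R N x n1
  for R :: "('a, 'r) ring_scheme" (structure) and M :: "('a, 'b, 'm) module_scheme"
    and N :: "('a, 'c, 'n) module_scheme" and x n1
begin

text \<open>Since n = c n1, the scalar moves across: m \<otimes> n = (c m) \<otimes> n1. Hence sums
  of pure tensors collapse to one with second factor \<open>n1\<close>.\<close>

lemma pure_tensor_surj:
  assumes "C \<in> carrier (tensor R M N)"
  shows "\<exists>u\<in>carrier M. C = pt u n1"
proof -
  interpret p: module_hom R M "tensor R M N" "\<lambda>m. pt m n1"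
    using pure_tensor_hom[OF n1_closed] M.module_axioms tensor_module
    by (simp add: module_hom_def module_hom_axioms_def)
  obtain \<phi> where \<phi>: "\<phi> \<in> carrier F" "C = T +>\<^bsub>F\<^esub> \<phi>"
    using assms by (auto simp: tensor_def F.quot_mod_carrier)
  have "\<exists>u\<in>carrier M. T +>\<^bsub>F\<^esub> \<phi> = pt u n1"
    using \<phi>(1)
  proof (induction rule: R.free_mod_induct)
    case zero
    have "T +>\<^bsub>F\<^esub> \<zero>\<^bsub>F\<^esub> = T"
      using F.a_coset_eq_self_iff[OF tensor_rels_submodule F.M.zero_closed]
        F.submodule_zero[OF tensor_rels_submodule] by simp
    also have "T = pt \<zero>\<^bsub>M\<^esub> n1" using p.hom_zero tensor_zero by simp
    finally show ?case unfolding R.free_mod_simps using M.M.zero_closed by blast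
  next
    case (add f a y)
    then obtain u where u: "u \<in> carrier M" "T +>\<^bsub>F\<^esub> f = pt u n1" by blast
    obtain m n where y: "y = (m, n)" "m \<in> carrier M" "n \<in> carrier N" using add(3) by (cases y) auto
    obtain c where c: "c \<in> carrier R" "n = c \<odot>\<^bsub>N\<^esub> n1" using generates[OF y(3)] by blast
    have "T +>\<^bsub>F\<^esub> (f \<oplus>\<^bsub>F\<^esub> a \<odot>\<^bsub>F\<^esub> e y) =
        pt u n1 \<oplus>\<^bsub>tensor R M N\<^esub> a \<odot>\<^bsub>tensor R M N\<^esub> pt m n"
      using add y u F.quot_mod_add[OF tensor_rels_submodule, of f "a \<odot>\<^bsub>F\<^esub> e y"]
        F.quot_mod_smult[OF tensor_rels_submodule, of a "e y"]
      by (simp add: rel_closed tensor_def pure_tensor_def)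
    also have "\<dots> = pt (u \<oplus>\<^bsub>M\<^esub> a \<odot>\<^bsub>M\<^esub> (c \<odot>\<^bsub>M\<^esub> m)) n1"
      using u y c add(2) n1_closed
      by (simp add: pure_tensor_add_left pure_tensor_smult_left pure_tensor_smult_right)
    finally show ?case
      using u y c add(2) by (intro bexI[of _ "u \<oplus>\<^bsub>M\<^esub> a \<odot>\<^bsub>M\<^esub> (c \<odot>\<^bsub>M\<^esub> m)"]) simp_all
  qed
  then show ?thesis using \<phi>(2) by simp
qed

text \<open>\<open>n1\<close> has annihilator xR, so the scalar of a multiple of \<open>n1\<close>
  is determined modulo x and its action on M/xM is well defined.\<close>

lemma smult_diff_in_multiples:
  assumes "a \<in> carrier R" "b \<in> carrier R" "a \<odot>\<^bsub>N\<^esub> n1 = b \<odot>\<^bsub>N\<^esub> n1" "u \<in> carrier M"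
  shows "a \<odot>\<^bsub>M\<^esub> u \<ominus>\<^bsub>M\<^esub> b \<odot>\<^bsub>M\<^esub> u \<in> multiples M x"
proof -
  have "(a \<ominus> b) \<odot>\<^bsub>N\<^esub> n1 = \<zero>\<^bsub>N\<^esub>"
    using assms n1_closed
    by (simp add: R.minus_eq N.smult_l_distr N.smult_l_minus N.M.r_neg)
  then obtain s where s: "s \<in> carrier R" "a \<ominus> b = x \<otimes> s"
    using annihilator assms by auto
  have "a \<odot>\<^bsub>M\<^esub> u \<ominus>\<^bsub>M\<^esub> b \<odot>\<^bsub>M\<^esub> u = (a \<ominus> b) \<odot>\<^bsub>M\<^esub> u"
    using assms by (simp add: R.minus_eq M.minus_eq smult_l_distr smult_l_minus)
  also have "\<dots> = x \<odot>\<^bsub>M\<^esub> (s \<odot>\<^bsub>M\<^esub> u)" using s x_closed assms(4) by (simp add: smult_assoc1)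
  finally show ?thesis using s assms(4) by (simp add: smult_in_multiples)
qed

text \<open>Together with \<open>pure_tensor_surj\<close> this is the isomorphism of M \<otimes>
  R/xR with M/xM. The harder direction uses the inverse map, which sends m \<otimes> n to c(n)
  m.\<close>

lemma pure_tensor_eq_zero_iff:
  assumes u: "u \<in> carrier M"
  shows "pt u n1 = \<zero>\<^bsub>tensor R M N\<^esub> \<longleftrightarrow> u \<in> multiples M x"
proof
  assume "u \<in> multiples M x"
  then obtain w where w: "w \<in> carrier M" "u = x \<odot>\<^bsub>M\<^esub> w" by (auto simp: multiples_def)
  have "x \<odot>\<^bsub>N\<^esub> n1 = \<zero>\<^bsub>N\<^esub>" using annihilator[OF x_closed] x_closed by (metis R.one_closed R.r_one)
  moreover have "pt w \<zero>\<^bsub>N\<^esub> = \<zero>\<^bsub>tensor R M N\<^esub>"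
    using pure_tensor_smult_right[of \<zero> w "\<zero>\<^bsub>N\<^esub>"] w by simp
  ultimately show "pt u n1 = \<zero>\<^bsub>tensor R M N\<^esub>"
    using pure_tensor_smult_left[OF x_closed w(1) n1_closed] pure_tensor_smult_right[OF x_closed w(1) n1_closed] w(2)
    by simp
next
  assume "pt u n1 = \<zero>\<^bsub>tensor R M N\<^esub>"
  then have e_T: "e (u, n1) \<in> T"
    using F.a_coset_eq_self_iff[OF tensor_rels_submodule basis_closed[OF u n1_closed]]
    by (simp add: pure_tensor_def tensor_zero)
  \<comment> \<open>An arbitrary choice of scalars, in general not additive; the resulting map
    respects the tensor relations only modulo xM.\<close>
  define c where "c n = (SOME a. a \<in> carrier R \<and> n = a \<odot>\<^bsub>N\<^esub> n1)" for n
  have c: "c n \<in> carrier R" "c n \<odot>\<^bsub>N\<^esub> n1 = n" if "n \<in> carrier N" for n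
    using someI_ex[of "\<lambda>a. a \<in> carrier R \<and> n = a \<odot>\<^bsub>N\<^esub> n1"] generates[OF that]
    unfolding c_def by metis+
  define L where "L = lin_ext R M (\<lambda>(m, n). c n \<odot>\<^bsub>M\<^esub> m)"
  have L_hom: "L \<in> mod_hom R F M"
    unfolding L_def by (rule lin_ext_hom) (auto simp: c)
  have L_e: "L (e (m, n)) = c n \<odot>\<^bsub>M\<^esub> m" if "m \<in> carrier M" "n \<in> carrier N" for m n
    using lin_ext_basis_elem[of "\<lambda>(m, n). c n \<odot>\<^bsub>M\<^esub> m" "(m, n)"] that c by (simp add: L_def)
  note mult = submodule_multiples[OF x_closed]
  have "L (e (u, n1)) \<in> multiples M x"
  proof (rule tensor_rels_least[OF M.module_axioms L_hom mult _ _ _ _ e_T])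
    fix m m' n assume "m \<in> carrier M" "m' \<in> carrier M" "n \<in> carrier N"
    then show "L (e (m \<oplus>\<^bsub>M\<^esub> m', n)) \<ominus>\<^bsub>M\<^esub> (L (e (m, n)) \<oplus>\<^bsub>M\<^esub> L (e (m', n))) \<in> multiples M x"
      using c submodule_zero[OF mult] by (simp add: L_e smult_r_distr M.minus_eq_zero_iff[THEN iffD2])
  next
    fix m n n' assume "m \<in> carrier M" "n \<in> carrier N" "n' \<in> carrier N"
    then show "L (e (m, n \<oplus>\<^bsub>N\<^esub> n')) \<ominus>\<^bsub>M\<^esub> (L (e (m, n)) \<oplus>\<^bsub>M\<^esub> L (e (m, n'))) \<in> multiples M x"
      using smult_diff_in_multiples[of "c (n \<oplus>\<^bsub>N\<^esub> n')" "c n \<oplus> c n'" m] n1_closed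
      by (simp add: L_e c N.smult_l_distr smult_l_distr)
  next
    fix a m n assume "a \<in> carrier R" "m \<in> carrier M" "n \<in> carrier N"
    then show "L (e (a \<odot>\<^bsub>M\<^esub> m, n)) \<ominus>\<^bsub>M\<^esub> a \<odot>\<^bsub>M\<^esub> L (e (m, n)) \<in> multiples M x"
      using c submodule_zero[OF mult]
      by (simp add: L_e smult_comm[of a] M.minus_eq_zero_iff[THEN iffD2])
  next
    fix a m n assume "a \<in> carrier R" "m \<in> carrier M" "n \<in> carrier N"
    then show "L (e (m, a \<odot>\<^bsub>N\<^esub> n)) \<ominus>\<^bsub>M\<^esub> a \<odot>\<^bsub>M\<^esub> L (e (m, n)) \<in> multiples M x"
      using smult_diff_in_multiples[of "c (a \<odot>\<^bsub>N\<^esub> n)" "a \<otimes> c n" m] n1_closed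
      by (simp add: L_e c N.smult_assoc1 smult_assoc1)
  qed
  then have "c n1 \<odot>\<^bsub>M\<^esub> u \<in> multiples M x" using L_e u n1_closed by simp
  \<comment> \<open>The scalar chosen for \<open>n1\<close> may differ from 1, but it agrees with 1
    modulo x.\<close>
  moreover have "c n1 \<odot>\<^bsub>M\<^esub> u \<ominus>\<^bsub>M\<^esub> \<one> \<odot>\<^bsub>M\<^esub> u \<in> multiples M x"
    using smult_diff_in_multiples[of "c n1" \<one> u] c n1_closed u by simp
  ultimately have "c n1 \<odot>\<^bsub>M\<^esub> u \<ominus>\<^bsub>M\<^esub> (c n1 \<odot>\<^bsub>M\<^esub> u \<ominus>\<^bsub>M\<^esub> \<one> \<odot>\<^bsub>M\<^esub> u) \<in> multiples M x"
    by (rule submodule_diff[OF mult])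
  then show "u \<in> multiples M x"
    using u c(1)[OF n1_closed]
    by (simp add: M.minus_eq M.minus_add M.M.a_assoc[symmetric] M.M.r_neg)
qed

end

subsection \<open>Tor against a cyclic module\<close>

context cyclic_quotient
begin

text \<open>The complex F \<otimes> N is F/xF. A cycle in positive degree is the class of an f whose
  differential is divisible by x, and it is a boundary when f itself is a differential up to a
  multiple of x.\<close>

lemma zero_tensor_homology_iff:
  assumes res: "free_resolution R M b d \<epsilon>"
  shows "zero_module (tensor_homology R b d (Suc n) N) \<longleftrightarrow>
    (\<forall>f\<in>carrier (free_mod R {..<b (Suc n)}).
      d n f \<in> multiples (free_mod R {..<b n}) x \<longrightarrow>
      (\<exists>k\<in>carrier (free_mod R {..<b (Suc (Suc n))}).
        f \<ominus>\<^bsub>free_mod R {..<b (Suc n)}\<^esub> d (Suc n) k \<in> multiples (free_mod R {..<b (Suc n)}) x))"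
    (is "_ \<longleftrightarrow> (\<forall>f\<in>_. _ \<longrightarrow> ?boundary f)")
proof -
  let ?F = "\<lambda>k. free_mod R {..<b k}"
  let ?C = "\<lambda>k. tensor R (?F k) N"
  let ?D = "\<lambda>k. tensor_map R (?F k) N (d k)"
  let ?pt = "\<lambda>k u. pure_tensor R (?F k) N u n1"
  have cyc: "tensor_cyclic R (?F k) N x n1" for k
    using N.R.free_mod_module cyclic_quotient_axioms N.module_axioms
    by (simp add: tensor_cyclic_def tensor_product_def)
  have d: "d k \<in> mod_hom R (?F (Suc k)) (?F k)" for k
    using res by (simp add: free_resolution_def Let_def)
  have d_closed: "d k f \<in> carrier (?F k)" if "f \<in> carrier (?F (Suc k))" for k f
    using d[of k] that by (auto simp: mod_hom_def)
  have D_pt: "?D k (?pt (Suc k) f) = ?pt k (d k f)" if "f \<in> carrier (?F (Suc k))" for k f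
    by (rule tensor_map_pure_tensor[OF N.R.free_mod_module N.R.free_mod_module N.module_axioms d that n1_closed])
  have pt_zero: "?pt k f = \<zero>\<^bsub>?C k\<^esub> \<longleftrightarrow> f \<in> multiples (?F k) x" if "f \<in> carrier (?F k)" for k f
    by (rule tensor_cyclic.pure_tensor_eq_zero_iff[OF cyc that])
  have carrier_C: "carrier (?C k) = ?pt k ` carrier (?F k)" for k
    using tensor_cyclic.pure_tensor_surj[OF cyc]
      tensor_product.pure_tensor_closed[OF tensor_cyclic.axioms(1)[OF cyc] _ n1_closed] by blast
  have F_C: "module R (?C k)" for k
    by (rule tensor_product.tensor_module[OF tensor_cyclic.axioms(1)[OF cyc]])
  have p_hom: "module_hom R (?F k) (?C k) (?pt k)" for k
    by (rule N.R.module_hom_free_mod[OF F_C tensor_product.pure_tensor_hom[OF tensor_cyclic.axioms(1)[OF cyc] n1_closed]])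
  interpret C: module R "?C (Suc n)" by (rule F_C)
  interpret p: module_hom R "?F (Suc n)" "?C (Suc n)" "?pt (Suc n)" by (rule p_hom)
  interpret d: module_hom R "?F (Suc (Suc n))" "?F (Suc n)" "d (Suc n)"
    by (rule N.R.module_hom_free_mod[OF N.R.free_mod_module d])
  define Z where "Z = a_kernel (?C (Suc n)) (?C n) (?D n)"
  define B where "B = ?D (Suc n) ` carrier (?C (Suc (Suc n)))"
  have B_eq: "B = ?pt (Suc n) ` d (Suc n) ` carrier (?F (Suc (Suc n)))"
    unfolding B_def carrier_C image_image by (rule image_cong[OF refl D_pt])
  have B_sub: "submodule B R (?C (Suc n))"
    unfolding B_eq by (rule p.submodule_image[OF d.submodule_image[OF d.M.carrier_is_submodule]])
  have Z_iff: "C \<in> Z \<longleftrightarrow> C \<in> carrier (?C (Suc n)) \<and> ?D n C = \<zero>\<^bsub>?C n\<^esub>" for C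
    by (simp add: Z_def a_kernel_def')
  have "tensor_homology R b d (Suc n) N = quot_mod ((?C (Suc n))\<lparr>carrier := Z\<rparr>) B"
    by (simp add: tensor_homology_def Let_def Z_def B_def)
  \<comment> \<open>Restricting the carrier to \<open>Z\<close> leaves addition unchanged, so the
    cosets of \<open>B\<close> are those formed in the whole tensor product.\<close>
  then have "zero_module (tensor_homology R b d (Suc n) N) \<longleftrightarrow>
      (\<Union>z\<in>Z. {B +>\<^bsub>?C (Suc n)\<^esub> z}) = {B}"
    by (simp add: zero_module_def quot_mod_def A_RCOSETS_def' a_r_coset_def')
  also have "\<dots> \<longleftrightarrow> (\<forall>z\<in>Z. B +>\<^bsub>?C (Suc n)\<^esub> z = B)"
  proof -
    \<comment> \<open>\<open>Z\<close> must be inhabited: over an empty \<open>Z\<close> the set of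
      cosets would be empty instead of \<open>{B}\<close>.\<close>
    have zero: "\<zero>\<^bsub>?F k\<^esub> \<in> carrier (?F k)" for k
      by (rule module.carrier_is_submodule[OF N.R.free_mod_module, THEN module.submodule_zero[OF N.R.free_mod_module]])
    have "d n \<zero>\<^bsub>?F (Suc n)\<^esub> = \<zero>\<^bsub>?F n\<^esub>"
      by (rule module_hom.hom_zero[OF N.R.module_hom_free_mod[OF N.R.free_mod_module d]])
    then have "?D n (?pt (Suc n) \<zero>\<^bsub>?F (Suc n)\<^esub>) = \<zero>\<^bsub>?C n\<^esub>"
      using D_pt[OF zero] module_hom.hom_zero[OF p_hom] by simp
    then have "Z \<noteq> {}" using zero carrier_C Z_iff by blast
    then show ?thesis by blast
  qed
  also have "\<dots> \<longleftrightarrow> Z \<subseteq> B"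
    unfolding subset_eq by (rule ball_cong[OF refl C.a_coset_eq_self_iff[OF B_sub]]) (simp add: Z_iff)
  also have "\<dots> \<longleftrightarrow> (\<forall>f\<in>carrier (?F (Suc n)). ?D n (?pt (Suc n) f) = \<zero>\<^bsub>?C n\<^esub> \<longrightarrow> ?pt (Suc n) f \<in> B)"
    unfolding subset_eq Ball_def Z_iff carrier_C by (auto simp only: image_iff)
  also have "\<dots> \<longleftrightarrow> (\<forall>f\<in>carrier (?F (Suc n)). d n f \<in> multiples (?F n) x \<longrightarrow> ?boundary f)"
  proof (rule ball_cong[OF refl])
    fix f assume f: "f \<in> carrier (?F (Suc n))"
    have "?D n (?pt (Suc n) f) = \<zero>\<^bsub>?C n\<^esub> \<longleftrightarrow> d n f \<in> multiples (?F n) x"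
      using D_pt[OF f] pt_zero[OF d_closed[OF f]] by simp
    moreover have "?pt (Suc n) f = ?pt (Suc n) (d (Suc n) k) \<longleftrightarrow>
        f \<ominus>\<^bsub>?F (Suc n)\<^esub> d (Suc n) k \<in> multiples (?F (Suc n)) x"
      if "k \<in> carrier (?F (Suc (Suc n)))" for k
      using p.hom_minus[OF f d_closed[OF that]] pt_zero[of "f \<ominus>\<^bsub>?F (Suc n)\<^esub> d (Suc n) k" "Suc n"]
        C.minus_eq_zero_iff[OF p.hom_closed[OF f] p.hom_closed[OF d_closed[OF that]]]
        p.M.M.minus_closed[OF f d_closed[OF that]] by simp
    then have "?pt (Suc n) f \<in> B \<longleftrightarrow> ?boundary f"
      unfolding B_eq image_image image_iff by (rule bex_cong[OF refl])
    ultimately show "(?D n (?pt (Suc n) f) = \<zero>\<^bsub>?C n\<^esub> \<longrightarrow> ?pt (Suc n) f \<in> B) \<longleftrightarrow>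
        (d n f \<in> multiples (?F n) x \<longrightarrow> ?boundary f)" by simp
  qed
  finally show ?thesis .
qed

end

text \<open>The representative \<open>R / xR\<close> in the type over which Tor-rigidity quantifies.\<close>

lemma (in cring) cyclic_quotient_exists:
  assumes x: "x \<in> carrier R"
  shows "\<exists>(N :: ('a, (nat \<Rightarrow> 'a) set) module) n1. cyclic_quotient R N x n1 \<and> fin_gen R N"
proof -
  \<comment> \<open>Free of rank one: families supported at 0, hence a copy of R inside the type
    \<open>nat \<Rightarrow> 'a\<close>.\<close>
  let ?F = "free_mod R {..<Suc 0}"
  interpret F: module R ?F by (rule free_mod_module)
  let ?H = "multiples ?F x" and ?e = "basis_elem R (0::nat)"
  let ?N = "quot_mod ?F ?H" and ?n1 = "?H +>\<^bsub>?F\<^esub> ?e"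
  have H: "submodule ?H R ?F" by (rule F.submodule_multiples[OF x])
  have e: "?e \<in> carrier ?F" by (rule basis_elem_closed) simp
  interpret N: module R ?N by (rule F.quot_mod_module[OF H])
  have F_eq: "f = f 0 \<odot>\<^bsub>?F\<^esub> ?e" "f 0 \<in> carrier R" if "f \<in> carrier ?F" for f
    using that by (auto simp: free_mod_carrier_iff free_mod_simps basis_elem_def fun_eq_iff)
  have n1: "?n1 \<in> carrier ?N" unfolding F.quot_mod_carrier using e by (rule imageI)
  have gen: "\<exists>a\<in>carrier R. C = a \<odot>\<^bsub>?N\<^esub> ?n1" if "C \<in> carrier ?N" for C
  proof -
    from that have "C \<in> (\<lambda>u. ?H +>\<^bsub>?F\<^esub> u) ` carrier ?F" by (simp only: F.quot_mod_carrier)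
    then obtain f where f: "f \<in> carrier ?F" "C = ?H +>\<^bsub>?F\<^esub> f" by (rule imageE)
    have "C = f 0 \<odot>\<^bsub>?N\<^esub> ?n1"
      unfolding F.quot_mod_smult[OF H F_eq(2)[OF f(1)] e] F_eq(1)[OF f(1), symmetric] by (rule f(2))
    then show ?thesis using F_eq(2)[OF f(1)] by (rule bexI)
  qed
  have ann: "a \<odot>\<^bsub>?N\<^esub> ?n1 = \<zero>\<^bsub>?N\<^esub> \<longleftrightarrow> (\<exists>s\<in>carrier R. a = x \<otimes> s)" if a: "a \<in> carrier R" for a
  proof -
    have "a \<odot>\<^bsub>?N\<^esub> ?n1 = \<zero>\<^bsub>?N\<^esub> \<longleftrightarrow> a \<odot>\<^bsub>?F\<^esub> ?e \<in> ?H"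
      using a e by (simp add: F.quot_mod_smult[OF H] F.quot_mod_zero F.a_coset_eq_self_iff[OF H])
    also have "\<dots> \<longleftrightarrow> (\<exists>s\<in>carrier R. a = x \<otimes> s)"
    proof
      assume "a \<odot>\<^bsub>?F\<^esub> ?e \<in> ?H"
      then obtain f where f: "f \<in> carrier ?F" "a \<odot>\<^bsub>?F\<^esub> ?e = x \<odot>\<^bsub>?F\<^esub> f" by (auto simp: multiples_def)
      then have "a \<otimes> ?e 0 = x \<otimes> f 0" by (simp add: free_mod_simps fun_eq_iff)
      then show "\<exists>s\<in>carrier R. a = x \<otimes> s" using a F_eq(2)[OF f(1)] by (auto simp: basis_elem_def)
    next
      assume "\<exists>s\<in>carrier R. a = x \<otimes> s"
      then show "a \<odot>\<^bsub>?F\<^esub> ?e \<in> ?H"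
        using x e F.smult_assoc1 F.smult_in_multiples by auto
    qed
    finally show ?thesis .
  qed
  have cyc: "cyclic_quotient R ?N x ?n1"
    by (intro cyclic_quotient.intro cyclic_quotient_axioms.intro N.module_axioms x n1 gen ann)
  have "mspan R ?N {?n1} = carrier ?N"
  proof
    show "mspan R ?N {?n1} \<subseteq> carrier ?N" using n1 by (intro N.mspan_least N.carrier_is_submodule) simp
    have sub: "submodule (mspan R ?N {?n1}) R ?N" using n1 by (intro N.submodule_mspan) simp
    then show "carrier ?N \<subseteq> mspan R ?N {?n1}"
      using gen N.submoduleE(4)[OF sub] N.mspan_superset[of "{?n1}"] by blast
  qed
  then have "fin_gen R ?N" using n1 unfolding fin_gen_def by (intro exI[of _ "{?n1}"]) simp
  with cyc show ?thesis by blast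
qed

subsection \<open>Associated primes\<close>

context module
begin

text \<open>Equality of the classes of u and v in M/A. Membership in the carrier is built in so that
  a congruence alone yields both closure facts.\<close>

definition cong_mod :: "'c set \<Rightarrow> 'c \<Rightarrow> 'c \<Rightarrow> bool" where
  "cong_mod A u v \<longleftrightarrow> u \<in> carrier M \<and> v \<in> carrier M \<and> u \<ominus>\<^bsub>M\<^esub> v \<in> A"

lemma cong_modD: "cong_mod A u v \<Longrightarrow> u \<in> carrier M" "cong_mod A u v \<Longrightarrow> v \<in> carrier M"
  by (simp_all add: cong_mod_def)

lemma cong_mod_refl: "submodule A R M \<Longrightarrow> u \<in> carrier M \<Longrightarrow> cong_mod A u u"
  by (simp add: cong_mod_def minus_eq_zero_iff[THEN iffD2] submodule_zero)

lemma cong_mod_sym: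
  assumes A: "submodule A R M" and "cong_mod A u v"
  shows "cong_mod A v u"
proof -
  have "\<ominus>\<^bsub>M\<^esub> (u \<ominus>\<^bsub>M\<^esub> v) = v \<ominus>\<^bsub>M\<^esub> u"
    using assms(2) by (simp add: cong_mod_def M.minus_eq M.minus_add M.a_comm)
  then show ?thesis using assms(2) submoduleE(3)[OF A, of "u \<ominus>\<^bsub>M\<^esub> v"] by (simp add: cong_mod_def)
qed

lemma cong_mod_add:
  assumes A: "submodule A R M" and "cong_mod A u v" "cong_mod A u' v'"
  shows "cong_mod A (u \<oplus>\<^bsub>M\<^esub> u') (v \<oplus>\<^bsub>M\<^esub> v')"
proof -
  have "(u \<ominus>\<^bsub>M\<^esub> v) \<oplus>\<^bsub>M\<^esub> (u' \<ominus>\<^bsub>M\<^esub> v') = (u \<oplus>\<^bsub>M\<^esub> u') \<ominus>\<^bsub>M\<^esub> (v \<oplus>\<^bsub>M\<^esub> v')"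
    using assms(2,3) by (simp add: cong_mod_def M.minus_eq M.minus_add M.a_ac)
  then show ?thesis
    using assms(2,3) submoduleE(5)[OF A, of "u \<ominus>\<^bsub>M\<^esub> v" "u' \<ominus>\<^bsub>M\<^esub> v'"] by (simp add: cong_mod_def)
qed

lemma cong_mod_smult:
  assumes A: "submodule A R M" and "cong_mod A u v" "a \<in> carrier R"
  shows "cong_mod A (a \<odot>\<^bsub>M\<^esub> u) (a \<odot>\<^bsub>M\<^esub> v)"
  using assms(2,3) submoduleE(4)[OF A, of a "u \<ominus>\<^bsub>M\<^esub> v"]
  by (simp add: cong_mod_def smult_minus_distr)

lemma cong_mod_trans:
  assumes A: "submodule A R M" and "cong_mod A u v" "cong_mod A v w"
  shows "cong_mod A u w"
proof -
  have "(u \<ominus>\<^bsub>M\<^esub> v) \<oplus>\<^bsub>M\<^esub> (v \<ominus>\<^bsub>M\<^esub> w) = u \<oplus>\<^bsub>M\<^esub> ((\<ominus>\<^bsub>M\<^esub> v \<oplus>\<^bsub>M\<^esub> v) \<oplus>\<^bsub>M\<^esub> \<ominus>\<^bsub>M\<^esub> w)"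
    using assms(2,3) by (simp add: cong_mod_def M.minus_eq M.a_assoc del: M.l_neg)
  also have "\<dots> = u \<ominus>\<^bsub>M\<^esub> w"
    using assms(2,3) by (simp add: cong_mod_def M.minus_eq M.l_neg)
  finally show ?thesis
    using assms(2,3) submoduleE(5)[OF A, of "u \<ominus>\<^bsub>M\<^esub> v" "v \<ominus>\<^bsub>M\<^esub> w"] by (simp add: cong_mod_def)
qed

lemma cong_mod_zero_iff: "u \<in> carrier M \<Longrightarrow> cong_mod A u \<zero>\<^bsub>M\<^esub> \<longleftrightarrow> u \<in> A"
  by (simp add: cong_mod_def minus_zero_right)

lemma cong_mod_mem_iff:
  assumes A: "submodule A R M" and "cong_mod A u v"
  shows "u \<in> A \<longleftrightarrow> v \<in> A"
  using assms cong_mod_trans[OF A] cong_mod_sym[OF A] cong_mod_zero_iff cong_modD by metis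

lemma cong_mod_mono: "cong_mod A u v \<Longrightarrow> A \<subseteq> B \<Longrightarrow> cong_mod B u v"
  by (auto simp: cong_mod_def)

text \<open>A + B, described as the preimage of the image of B in M/A.\<close>

definition sum_mod :: "'c set \<Rightarrow> 'c set \<Rightarrow> 'c set" where
  "sum_mod A B = {u. \<exists>w\<in>B. cong_mod A u w}"

lemma submodule_sum_mod:
  assumes A: "submodule A R M" and B: "submodule B R M"
  shows "submodule (sum_mod A B) R M"
proof (rule submoduleI)
  show "sum_mod A B \<subseteq> carrier M" by (auto simp: sum_mod_def cong_mod_def)
  show "\<zero>\<^bsub>M\<^esub> \<in> sum_mod A B"
    using cong_mod_refl[OF A M.zero_closed] submodule_zero[OF B] by (auto simp: sum_mod_def)
  have smult: "a \<odot>\<^bsub>M\<^esub> u \<in> sum_mod A B" if "a \<in> carrier R" "u \<in> sum_mod A B" for a u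
    using that submoduleE(4)[OF B] cong_mod_smult[OF A] unfolding sum_mod_def by blast
  show "\<ominus>\<^bsub>M\<^esub> u \<in> sum_mod A B" if "u \<in> sum_mod A B" for u
  proof -
    have "u \<in> carrier M" using that by (auto simp: sum_mod_def cong_mod_def)
    then have "(\<ominus> \<one>) \<odot>\<^bsub>M\<^esub> u = \<ominus>\<^bsub>M\<^esub> u" using smult_l_minus[of \<one> u] by simp
    then show ?thesis using smult[OF _ that, of "\<ominus> \<one>"] by simp
  qed
  show "u \<oplus>\<^bsub>M\<^esub> v \<in> sum_mod A B" if "u \<in> sum_mod A B" "v \<in> sum_mod A B" for u v
    using that submoduleE(5)[OF B] cong_mod_add[OF A] unfolding sum_mod_def by blast
qed (auto simp: sum_mod_def intro: submoduleE(4)[OF B] cong_mod_smult[OF A])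

lemma sum_mod_superset1:
  assumes A: "submodule A R M" and B: "submodule B R M"
  shows "A \<subseteq> sum_mod A B"
proof
  fix u assume "u \<in> A"
  then have "cong_mod A u \<zero>\<^bsub>M\<^esub>" using submodule_subset[OF A] cong_mod_zero_iff by simp
  then show "u \<in> sum_mod A B" using submodule_zero[OF B] by (auto simp: sum_mod_def)
qed

lemma sum_mod_superset2:
  assumes A: "submodule A R M" and B: "submodule B R M"
  shows "B \<subseteq> sum_mod A B"
  using cong_mod_refl[OF A submodule_subset[OF B]] by (auto simp: sum_mod_def)

lemma sum_mod_least:
  assumes H: "submodule H R M" and "A \<subseteq> H" "B \<subseteq> H"
  shows "sum_mod A B \<subseteq> H"
  using cong_mod_mem_iff[OF H cong_mod_mono[OF _ assms(2)]] assms(3)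
  unfolding sum_mod_def by blast

text \<open>The annihilator of the class of u in M/A.\<close>

definition colon :: "'c set \<Rightarrow> 'c \<Rightarrow> 'a set" where
  "colon A u = {a \<in> carrier R. a \<odot>\<^bsub>M\<^esub> u \<in> A}"

lemma colon_ideal:
  assumes A: "submodule A R M" and u: "u \<in> carrier M"
  shows "ideal (colon A u) R"
proof (rule idealI[OF R.ring_axioms])
  show "subgroup (colon A u) (add_monoid R)"
    by (rule R.add.subgroupI)
      (use u submoduleE(3,5)[OF A] submodule_zero[OF A] in
        \<open>auto simp: colon_def smult_l_minus smult_l_distr intro: exI[of _ \<zero>]\<close>)
  fix a x assume ax: "a \<in> colon A u" "x \<in> carrier R"
  then have "x \<odot>\<^bsub>M\<^esub> (a \<odot>\<^bsub>M\<^esub> u) \<in> A" using submoduleE(4)[OF A] by (simp add: colon_def)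
  then show "x \<otimes> a \<in> colon A u" using ax u by (simp add: colon_def smult_assoc1)
  then show "a \<otimes> x \<in> colon A u" using ax by (simp add: colon_def R.m_comm)
qed

text \<open>The associated primes of M/A.\<close>

definition ass :: "'c set \<Rightarrow> 'a set set" where
  "ass A = {colon A u | u. u \<in> carrier M - A \<and> primeideal (colon A u) R}"

text \<open>A nonzerodivisor on M/A. The quotient may be zero, and then every element of R
  qualifies.\<close>

definition regular_mod :: "'c set \<Rightarrow> 'a \<Rightarrow> bool" where
  "regular_mod A x \<longleftrightarrow> x \<in> carrier R \<and> (\<forall>u\<in>carrier M. x \<odot>\<^bsub>M\<^esub> u \<in> A \<longrightarrow> u \<in> A)"

lemma regular_mod_cong:
  assumes A: "submodule A R M" and x: "regular_mod A x"
    and "u \<in> carrier M" "v \<in> carrier M" "cong_mod A (x \<odot>\<^bsub>M\<^esub> u) (x \<odot>\<^bsub>M\<^esub> v)"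
  shows "cong_mod A u v"
  using assms(2-) by (auto simp: cong_mod_def regular_mod_def smult_minus_distr[symmetric])

text \<open>If b u is nonzero in M/A, its annihilator contains that of u and so equals it; when a b
  kills u, this shows that a already does.\<close>

lemma maximal_colon_prime:
  assumes A: "submodule A R M" and u: "u \<in> carrier M - A"
    and max: "\<And>v. v \<in> carrier M - A \<Longrightarrow> colon A u \<subseteq> colon A v \<Longrightarrow> colon A v = colon A u"
  shows "primeideal (colon A u) R"
proof (rule primeidealI)
  show "ideal (colon A u) R" using colon_ideal[OF A] u by simp
  show "carrier R \<noteq> colon A u"
  proof
    assume "carrier R = colon A u"
    then have "\<one> \<in> colon A u" by blast
    then show False using u by (simp add: colon_def)
  qed
  fix a b assume ab: "a \<in> carrier R" "b \<in> carrier R" "a \<otimes> b \<in> colon A u"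
  show "a \<in> colon A u \<or> b \<in> colon A u"
  proof (rule disjCI)
    assume "b \<notin> colon A u"
    then have bu: "b \<odot>\<^bsub>M\<^esub> u \<in> carrier M - A" using ab u by (auto simp: colon_def)
    have "colon A u \<subseteq> colon A (b \<odot>\<^bsub>M\<^esub> u)"
      using ab u submoduleE(4)[OF A] by (auto simp: colon_def smult_comm[of _ b])
    from max[OF bu this] show "a \<in> colon A u"
      using ab u by (auto simp: colon_def smult_assoc1)
  qed
qed (rule R.cring_axioms)

end

section \<open>Prime avoidance\<close>

context cring
begin

text \<open>Choose for each ideal an element outside \<open>P\<close> and multiply; primeness keeps
  the product outside.\<close>

lemma avoid_ideals:
  assumes P: "primeideal P R" and "finite T" "\<And>t. t \<in> T \<Longrightarrow> ideal (I t) R"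
    "\<And>t. t \<in> T \<Longrightarrow> \<not> I t \<subseteq> P"
  shows "\<exists>a\<in>carrier R - P. \<forall>t\<in>T. a \<in> I t"
  using assms(2-)
proof (induction T rule: finite_induct)
  case empty
  interpret P: primeideal P R by (rule P)
  have "\<one> \<notin> P" using P.one_imp_carrier P.I_notcarr by blast
  then show ?case by auto
next
  case (insert t T)
  interpret P: primeideal P R by (rule P)
  obtain a where a: "a \<in> carrier R - P" "\<forall>t\<in>T. a \<in> I t" using insert by blast
  obtain b where b: "b \<in> I t" "b \<notin> P" using insert.prems(2) by blast
  have bR: "b \<in> carrier R" using ideal.Icarr[OF insert.prems(1) b(1)] by simp
  have "a \<otimes> b \<in> carrier R - P" using P.I_prime[of a b] a b bR by blast
  moreover have "a \<otimes> b \<in> I s" if "s \<in> insert t T" for s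
    using that a b bR ideal.I_l_closed[OF insert.prems(1)] ideal.I_r_closed[OF insert.prems(1)]
    by blast
  ultimately show ?case by blast
qed

text \<open>If one prime contains another, the smaller may be dropped. Otherwise an element missing
  all primes but P is corrected by a term that lies in all of them but P.\<close>

lemma prime_avoidance:
  assumes "finite \<P>" and I: "ideal I R"
    and "\<And>P. P \<in> \<P> \<Longrightarrow> primeideal P R" "\<And>P. P \<in> \<P> \<Longrightarrow> \<not> I \<subseteq> P"
  shows "\<exists>a\<in>I. \<forall>P\<in>\<P>. a \<notin> P"
  using assms(1,3,4)
proof (induction \<P> rule: finite_psubset_induct)
  case (psubset \<P>)
  interpret I: ideal I R by (rule I)
  consider "\<P> = {}" | P Q where "P \<in> \<P>" "Q \<in> \<P>" "P \<noteq> Q" "Q \<subseteq> P"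
    | P where "P \<in> \<P>" "\<And>Q. Q \<in> \<P> \<Longrightarrow> Q \<noteq> P \<Longrightarrow> \<not> Q \<subseteq> P" by blast
  then show ?case
  proof cases
    case 1
    then show ?thesis using I.zero_closed by blast
  next
    case 2
    then have "\<exists>a\<in>I. \<forall>P\<in>\<P> - {Q}. a \<notin> P" using psubset.prems by (intro psubset.IH) auto
    then show ?thesis using 2 by blast
  next
    case 3
    interpret P: primeideal P R using psubset.prems(1)[OF 3(1)] .
    have "\<exists>a\<in>I. \<forall>Q\<in>\<P> - {P}. a \<notin> Q" using psubset.prems 3 by (intro psubset.IH) auto
    then obtain x where x: "x \<in> I" "\<And>Q. Q \<in> \<P> - {P} \<Longrightarrow> x \<notin> Q" by blast
    show ?thesis
    proof (cases "x \<in> P")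
      case False
      then show ?thesis using x by blast
    next
      case True
      \<comment> \<open>\<open>P\<close> contains neither \<open>I\<close> nor any of the other
        primes, so it misses an element z of their intersection; then x + z avoids every
        prime.\<close>
      have "\<exists>a\<in>carrier R - P. \<forall>J\<in>insert I (\<P> - {P}). a \<in> J"
        using psubset.prems 3 I psubset.hyps
        by (intro avoid_ideals P.primeideal) (auto intro: primeideal.axioms(1))
      then obtain z where z: "z \<in> carrier R - P" "z \<in> I" "\<And>Q. Q \<in> \<P> - {P} \<Longrightarrow> z \<in> Q" by blast
      have xR: "x \<in> carrier R" using I.Icarr[OF x(1)] .
      have "x \<oplus> z \<notin> Q" if "Q \<in> \<P>" for Q
      proof
        assume xz: "x \<oplus> z \<in> Q"
        interpret Q: primeideal Q R using psubset.prems(1)[OF that] .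
        show False
        proof (cases "Q = P")
          case True
          have "\<ominus> x \<oplus> (x \<oplus> z) \<in> P" using xz True \<open>x \<in> P\<close> by simp
          then show False using z xR by (simp add: a_assoc[symmetric] l_neg)
        next
          case False
          then have "(x \<oplus> z) \<oplus> \<ominus> z \<in> Q" using xz z(3) that by simp
          then have "x \<in> Q" using z(1) xR by (simp add: a_assoc r_neg)
          then show False using x(2) that False by blast
        qed
      qed
      then show ?thesis using x z by blast
    qed
  qed
qed

end

section \<open>Noetherian local rings\<close>

locale noetherian_local = cring R for R (structure) +
  assumes noetherian: "noetherian_ring R" and local_ring: "\<exists>!m. maximalideal m R"
begin

abbreviation "\<mm> \<equiv> max_ideal R"

lemma maximalideal_max_ideal: "maximalideal \<mm> R"
  unfolding max_ideal_def by (rule theI'[OF local_ring])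

lemma ideal_subset_max_ideal:
  assumes I: "ideal I R" "I \<noteq> carrier R"
  shows "I \<subseteq> \<mm>"
proof -
  let ?\<I> = "{J. ideal J R \<and> J \<noteq> carrier R \<and> I \<subseteq> J}"
  obtain J where J: "J \<in> ?\<I>" "\<forall>K\<in>?\<I>. J \<subseteq> K \<longrightarrow> K = J"
    using noetherian_maximal_ideal[OF noetherian, of ?\<I>] I by blast
  have "maximalideal J R"
    using J by (intro maximalidealI) blast+
  then have "J = \<mm>" using maximalideal_max_ideal local_ring by blast
  then show ?thesis using J(1) by blast
qed

lemma max_ideal_ideal: "ideal \<mm> R"
  using maximalideal_max_ideal by (rule maximalideal.axioms(1))

lemma max_ideal_closed: "a \<in> \<mm> \<Longrightarrow> a \<in> carrier R"
  using ideal.Icarr[OF max_ideal_ideal] .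

lemma one_notin_max_ideal: "\<one> \<notin> \<mm>"
  using ideal.one_imp_carrier[OF max_ideal_ideal] maximalideal.I_notcarr[OF maximalideal_max_ideal]
  by blast

lemma unit_outside_max_ideal:
  assumes "a \<in> carrier R" "a \<notin> \<mm>"
  obtains b where "b \<in> carrier R" "b \<otimes> a = \<one>"
proof -
  have "PIdl a = carrier R"
    using ideal_subset_max_ideal[OF cgenideal_ideal[OF assms(1)]] cgenideal_self[OF assms(1)] assms(2)
    by blast
  then have "\<one> \<in> PIdl a" by simp
  then show ?thesis using that by (auto simp: cgenideal_def)
qed

lemma unit_one_minus:
  assumes "a \<in> \<mm>"
  obtains b where "b \<in> carrier R" "b \<otimes> (\<one> \<ominus> a) = \<one>"
proof -
  have a: "a \<in> carrier R" using assms by (rule max_ideal_closed)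
  have "\<one> \<ominus> a \<notin> \<mm>"
  proof
    assume "\<one> \<ominus> a \<in> \<mm>"
    then have "(\<one> \<ominus> a) \<oplus> a \<in> \<mm>"
      using assms additive_subgroup.a_closed[OF ideal.axioms(1)[OF max_ideal_ideal]] by blast
    then show False using a one_notin_max_ideal by (simp add: minus_eq a_assoc l_neg)
  qed
  then show ?thesis using unit_outside_max_ideal that a by blast
qed

end

section \<open>Zero divisors and Nakayama's lemma over a local ring\<close>

locale noetherian_local_module = module R M + noetherian_local R
  for R (structure) and M (structure) +
  assumes noetherian_M: "noetherian_module R M"
begin

text \<open>The chain condition on ideals gives a maximal annihilator above the given one. Whatever
  lies above it again lies above \<open>colon A u0\<close>, so it is maximal among all annihilators
  of nonzero classes.\<close>

lemma ass_above_colon: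
  assumes A: "submodule A R M" and u0: "u0 \<in> carrier M - A"
  shows "\<exists>u\<in>carrier M - A. colon A u0 \<subseteq> colon A u \<and>
    (\<forall>v\<in>carrier M - A. colon A u \<subseteq> colon A v \<longrightarrow> colon A v = colon A u)"
proof -
  let ?\<I> = "{colon A u | u. u \<in> carrier M - A \<and> colon A u0 \<subseteq> colon A u}"
  have "?\<I> \<noteq> {}" using u0 by blast
  moreover have "ideal I R" if "I \<in> ?\<I>" for I using that colon_ideal[OF A] by blast
  ultimately obtain I where I: "I \<in> ?\<I>" "\<forall>J\<in>?\<I>. I \<subseteq> J \<longrightarrow> J = I"
    using noetherian_maximal_ideal[OF noetherian, of ?\<I>] by blast
  then obtain u where u: "u \<in> carrier M - A" "colon A u0 \<subseteq> colon A u" "I = colon A u" by blast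
  have "colon A v = colon A u" if "v \<in> carrier M - A" "colon A u \<subseteq> colon A v" for v
    using I(2)[rule_format, of "colon A v"] u that by blast
  then show ?thesis using u(1,2) by blast
qed

lemma ass_exists:
  assumes A: "submodule A R M" and u0: "u0 \<in> carrier M - A"
  shows "\<exists>P\<in>ass A. colon A u0 \<subseteq> P"
proof -
  obtain u where u: "u \<in> carrier M - A" "colon A u0 \<subseteq> colon A u"
    "\<And>v. v \<in> carrier M - A \<Longrightarrow> colon A u \<subseteq> colon A v \<Longrightarrow> colon A v = colon A u"
    using ass_above_colon[OF A u0] by blast
  then show ?thesis using maximal_colon_prime[OF A u(1,3)] unfolding ass_def by blast
qed

text \<open>The maximal annihilators suffice, and they are finite in number: the elements having one
  lie in the span of finitely many of them, and each maximal annihilator occurs among those of the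
  spanning elements.\<close>

lemma zerodivisors_finite_ass:
  assumes A: "submodule A R M"
  shows "\<exists>\<P>. finite \<P> \<and> \<P> \<subseteq> ass A \<and>
    (\<forall>x\<in>carrier R. \<not> regular_mod A x \<longrightarrow> (\<exists>P\<in>\<P>. x \<in> P))"
proof -
  define U where "U = {u \<in> carrier M - A.
    \<forall>v. v \<in> carrier M - A \<longrightarrow> colon A u \<subseteq> colon A v \<longrightarrow> colon A v = colon A u}"
  have U_prime: "primeideal (colon A u) R" if "u \<in> U" for u
    using maximal_colon_prime[OF A, of u] that by (auto simp: U_def)
  have U_carrier: "U \<subseteq> carrier M" by (auto simp: U_def)
  \<comment> \<open>A maximal span of a finite subset of \<open>U\<close> contains all of
    \<open>U\<close>, while its generators still come from \<open>U\<close>.\<close>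
  let ?\<H> = "{mspan R M T | T. finite T \<and> T \<subseteq> U}"
  have "submodule H R M" if "H \<in> ?\<H>" for H
    using that U_carrier submodule_mspan by blast
  moreover have "?\<H> \<noteq> {}" by blast
  ultimately obtain H where H: "H \<in> ?\<H>" "\<forall>K\<in>?\<H>. H \<subseteq> K \<longrightarrow> K = H"
    using noetherian_module_maximal[OF noetherian_M, of ?\<H>] by blast
  then obtain T where T: "finite T" "T \<subseteq> U" "H = mspan R M T" by blast
  have U_span: "u \<in> mspan R M T" if "u \<in> U" for u
  proof -
    have T': "insert u T \<subseteq> U" using that T(2) by simp
    then have "mspan R M T \<subseteq> mspan R M (insert u T)"
      using mspan_superset[of "insert u T"] U_carrier
      by (intro mspan_least submodule_mspan) auto
    moreover have "mspan R M (insert u T) \<in> ?\<H>" using T' T(1) by blast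
    ultimately have "mspan R M (insert u T) = mspan R M T" using H(2)[rule_format, of "mspan R M (insert u T)"] T(3) by blast
    then show ?thesis using mspan_superset[of "insert u T"] by blast
  qed
  have "\<exists>P\<in>colon A ` T. x \<in> P" if x: "x \<in> carrier R" "\<not> regular_mod A x" for x
  proof -
    obtain u0 where u0: "u0 \<in> carrier M - A" "x \<in> colon A u0"
      using x by (auto simp: regular_mod_def colon_def)
    obtain u where u: "u \<in> carrier M - A" "colon A u0 \<subseteq> colon A u"
      "\<And>v. v \<in> carrier M - A \<Longrightarrow> colon A u \<subseteq> colon A v \<Longrightarrow> colon A v = colon A u"
      using ass_above_colon[OF A u0(1)] by blast
    have "u \<in> U" unfolding U_def using u(1,3) by blast
    \<comment> \<open>Otherwise some a outside the prime \<open>colon A u\<close> would kill every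
      member of \<open>T\<close> modulo A, hence their span, hence u.\<close>
    have "\<exists>t\<in>T. colon A t \<subseteq> colon A u"
    proof (rule ccontr)
      assume "\<not> ?thesis"
      moreover have "ideal (colon A t) R" if "t \<in> T" for t
        using colon_ideal[OF A] that T(2) U_carrier by blast
      ultimately obtain a where a: "a \<in> carrier R - colon A u" "\<forall>t\<in>T. a \<in> colon A t"
        using R.avoid_ideals[OF U_prime[OF \<open>u \<in> U\<close>] T(1), of "colon A"] by blast
      have "(\<lambda>v. a \<odot>\<^bsub>M\<^esub> v) \<in> mod_hom R M M"
        using a(1) by (intro mod_homI) (auto simp: smult_r_distr smult_comm)
      then interpret h: module_hom R M M "\<lambda>v. a \<odot>\<^bsub>M\<^esub> v"
        using module_axioms by (simp add: module_hom_def module_hom_axioms_def)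
      have "T \<subseteq> {v \<in> carrier M. a \<odot>\<^bsub>M\<^esub> v \<in> A}" using a(2) T(2) U_carrier by (auto simp: colon_def)
      from mspan_least[OF h.submodule_vimage[OF A] this] U_span[OF \<open>u \<in> U\<close>]
      have "a \<in> colon A u" using a(1) by (auto simp: colon_def)
      then show False using a(1) by simp
    qed
    then obtain t where t: "t \<in> T" "colon A t \<subseteq> colon A u" by blast
    have "t \<in> U" using t(1) T(2) by blast
    then have "colon A u = colon A t" using t(2) u(1) unfolding U_def by blast
    then show ?thesis using u0 u(2) t(1) by blast
  qed
  moreover have "colon A ` T \<subseteq> ass A"
  proof (rule image_subsetI)
    fix t assume "t \<in> T"
    then have "t \<in> U" using T(2) by blast
    then show "colon A t \<in> ass A" using U_prime[of t] unfolding ass_def U_def by blast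
  qed
  ultimately show ?thesis using T(1) by (intro exI[of _ "colon A ` T"]) blast
qed

text \<open>A maximal proper submodule \<open>H\<close> of \<open>K\<close> above \<open>A \<inter> K\<close> has \<open>K / H\<close> isomorphic to the residue
  field. This takes the place of Nakayama's lemma.\<close>

lemma residue_field_quotient:
  assumes A: "submodule A R M" and K: "submodule K R M" and "\<not> K \<subseteq> A"
  shows "\<exists>H v. submodule H R M \<and> A \<inter> K \<subseteq> H \<and> H \<subseteq> K \<and> v \<in> K - H \<and>
    (\<forall>k\<in>K. \<exists>c\<in>carrier R. cong_mod H k (c \<odot>\<^bsub>M\<^esub> v)) \<and>
    (\<forall>c\<in>carrier R. c \<odot>\<^bsub>M\<^esub> v \<in> H \<longleftrightarrow> c \<in> \<mm>)"
proof -
  let ?\<H> = "{H. submodule H R M \<and> A \<inter> K \<subseteq> H \<and> H \<subseteq> K \<and> H \<noteq> K}"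
  have "submodule (A \<inter> K) R M"
    using submodule_Inter[of "{A, K}"] A K by auto
  then have ne: "?\<H> \<noteq> {}" using assms(3) by blast
  have "submodule H R M" if "H \<in> ?\<H>" for H using that by simp
  from noetherian_module_maximal[OF noetherian_M this ne]
  obtain H where H: "H \<in> ?\<H>" and max: "\<forall>L\<in>?\<H>. H \<subseteq> L \<longrightarrow> L = H"
    by (rule bexE)
  then obtain v where v: "v \<in> K" "v \<notin> H" by blast
  have Hs: "submodule H R M" "A \<inter> K \<subseteq> H" "H \<subseteq> K" using H by auto
  \<comment> \<open>Stated for any w in K outside H, because it is applied to v and also to a
    multiple c v.\<close>
  have gen: "\<exists>c\<in>carrier R. cong_mod H k (c \<odot>\<^bsub>M\<^esub> w)" if w: "w \<in> K" "w \<notin> H" and k: "k \<in> K" for w k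
  proof -
    have wM: "w \<in> carrier M" using submodule_subset[OF K] w by simp
    let ?L = "sum_mod H {c \<odot>\<^bsub>M\<^esub> w | c. c \<in> carrier R}"
    note cyc = submodule_cyclic[OF wM]
    have L: "submodule ?L R M" by (rule submodule_sum_mod[OF Hs(1) cyc])
    have "H \<subseteq> ?L" by (rule sum_mod_superset1[OF Hs(1) cyc])
    moreover have "?L \<subseteq> K" using Hs(3) submoduleE(4)[OF K] w by (intro sum_mod_least[OF K]) auto
    moreover have "w \<in> {c \<odot>\<^bsub>M\<^esub> w | c. c \<in> carrier R}" using wM smult_one R.one_closed by force
    then have "w \<in> ?L" using sum_mod_superset2[OF Hs(1) cyc] by blast
    ultimately have "?L = K" using max[rule_format, of ?L] L Hs(2) w(2) by blast
    then have "k \<in> ?L" using k by simp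
    then show ?thesis by (auto simp: sum_mod_def)
  qed
  have vM: "v \<in> carrier M" using submodule_subset[OF K] v by simp
  have iff: "c \<odot>\<^bsub>M\<^esub> v \<in> H \<longleftrightarrow> c \<in> \<mm>" if c: "c \<in> carrier R" for c
  proof
    assume "c \<odot>\<^bsub>M\<^esub> v \<in> H"
    show "c \<in> \<mm>"
    proof (rule ccontr)
      assume "c \<notin> \<mm>"
      then obtain b where b: "b \<in> carrier R" "b \<otimes> c = \<one>" using unit_outside_max_ideal c by blast
      have "b \<odot>\<^bsub>M\<^esub> (c \<odot>\<^bsub>M\<^esub> v) \<in> H" using submoduleE(4)[OF Hs(1) b(1)] \<open>c \<odot>\<^bsub>M\<^esub> v \<in> H\<close> by blast
      then show False using b c vM v(2) by (simp add: smult_assoc1[symmetric])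
    qed
  next
    assume c\<mm>: "c \<in> \<mm>"
    show "c \<odot>\<^bsub>M\<^esub> v \<in> H"
    proof (rule ccontr)
      assume "c \<odot>\<^bsub>M\<^esub> v \<notin> H"
      moreover have "c \<odot>\<^bsub>M\<^esub> v \<in> K" using submoduleE(4)[OF K c v(1)] .
      \<comment> \<open>Here v and r c v agree modulo H, so (1 - r c) v lies in H, and 1 - r c is a
        unit.\<close>
      ultimately obtain r where r: "r \<in> carrier R" "cong_mod H v (r \<odot>\<^bsub>M\<^esub> (c \<odot>\<^bsub>M\<^esub> v))"
        using gen v(1) by blast
      have "r \<otimes> c \<in> \<mm>" using ideal.I_l_closed[OF max_ideal_ideal c\<mm> r(1)] .
      then obtain b where b: "b \<in> carrier R" "b \<otimes> (\<one> \<ominus> r \<otimes> c) = \<one>" by (rule unit_one_minus)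
      have "(\<one> \<ominus> r \<otimes> c) \<odot>\<^bsub>M\<^esub> v = v \<ominus>\<^bsub>M\<^esub> r \<odot>\<^bsub>M\<^esub> (c \<odot>\<^bsub>M\<^esub> v)"
        using r c vM by (simp add: R.minus_eq M.minus_eq smult_l_distr smult_l_minus smult_assoc1)
      then have "(\<one> \<ominus> r \<otimes> c) \<odot>\<^bsub>M\<^esub> v \<in> H" using r(2) by (simp add: cong_mod_def)
      then have "b \<odot>\<^bsub>M\<^esub> ((\<one> \<ominus> r \<otimes> c) \<odot>\<^bsub>M\<^esub> v) \<in> H" using submoduleE(4)[OF Hs(1) b(1)] by blast
      then show False using b r c vM v(2) by (simp add: smult_assoc1[symmetric])
    qed
  qed
  show ?thesis
    by (rule exI[of _ H], rule exI[of _ v]) (use Hs v gen[OF v] iff in blast)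
qed

text \<open>The hypothesis puts K inside A + xK. On a quotient K/H that is the residue field x acts
  as zero, so such an equation would put the generator v into H.\<close>

lemma nakayama:
  assumes A: "submodule A R M" and K: "submodule K R M" and x: "x \<in> \<mm>"
    and eq: "\<And>k. k \<in> K \<Longrightarrow> \<exists>k'\<in>K. cong_mod A k (x \<odot>\<^bsub>M\<^esub> k')"
  shows "K \<subseteq> A"
proof (rule ccontr)
  assume "\<not> K \<subseteq> A"
  then obtain H v where H: "submodule H R M" "A \<inter> K \<subseteq> H" "H \<subseteq> K" "v \<in> K - H"
    "\<And>k. k \<in> K \<Longrightarrow> \<exists>c\<in>carrier R. cong_mod H k (c \<odot>\<^bsub>M\<^esub> v)"
    "\<And>c. c \<in> carrier R \<Longrightarrow> c \<odot>\<^bsub>M\<^esub> v \<in> H \<longleftrightarrow> c \<in> \<mm>"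
    using residue_field_quotient[OF A K] by blast
  note xR = max_ideal_closed[OF x]
  obtain k where k: "k \<in> K" "cong_mod A v (x \<odot>\<^bsub>M\<^esub> k)" using eq H(4) by blast
  have "v \<ominus>\<^bsub>M\<^esub> x \<odot>\<^bsub>M\<^esub> k \<in> K" using submodule_diff[OF K _ submoduleE(4)[OF K xR k(1)]] H(4) by blast
  \<comment> \<open>The difference lies in both A and K, and A \<inter> K is contained in H.\<close>
  then have vk: "cong_mod H v (x \<odot>\<^bsub>M\<^esub> k)" using k(2) H(2) by (auto simp: cong_mod_def)
  obtain c where c: "c \<in> carrier R" "cong_mod H k (c \<odot>\<^bsub>M\<^esub> v)" using H(5) k(1) by blast
  have vM: "v \<in> carrier M" using cong_modD(1)[OF vk] .
  have "x \<otimes> c \<in> \<mm>" using ideal.I_r_closed[OF max_ideal_ideal x c(1)] .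
  then have "x \<odot>\<^bsub>M\<^esub> (c \<odot>\<^bsub>M\<^esub> v) \<in> H" using H(6) xR c(1) vM by (simp add: smult_assoc1[symmetric])
  then have "x \<odot>\<^bsub>M\<^esub> k \<in> H"
    using cong_mod_mem_iff[OF H(1) cong_mod_smult[OF H(1) c(2) xR]] by simp
  then show False using cong_mod_mem_iff[OF H(1) vk] H(4) by simp
qed

end

subsection \<open>Regular sequences\<close>

context module
begin

text \<open>The submodule A + xM: replacing A by it divides M/A by x.\<close>

definition adjoin :: "'c set \<Rightarrow> 'a \<Rightarrow> 'c set" where
  "adjoin A x = sum_mod A (multiples M x)"

lemma adjoin_iff: "u \<in> adjoin A x \<longleftrightarrow> (\<exists>w\<in>carrier M. cong_mod A u (x \<odot>\<^bsub>M\<^esub> w))"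
  by (auto simp: adjoin_def sum_mod_def multiples_def)

lemma submodule_adjoin: "submodule A R M \<Longrightarrow> x \<in> carrier R \<Longrightarrow> submodule (adjoin A x) R M"
  unfolding adjoin_def by (intro submodule_sum_mod submodule_multiples)

lemma adjoin_superset: "submodule A R M \<Longrightarrow> x \<in> carrier R \<Longrightarrow> A \<subseteq> adjoin A x"
  unfolding adjoin_def by (intro sum_mod_superset1 submodule_multiples)

lemma smult_in_adjoin:
  "submodule A R M \<Longrightarrow> x \<in> carrier R \<Longrightarrow> w \<in> carrier M \<Longrightarrow> x \<odot>\<^bsub>M\<^esub> w \<in> adjoin A x"
  using adjoin_iff cong_mod_refl smult_closed by blast

lemma adjoin_commute:
  assumes A: "submodule A R M" and x: "x \<in> carrier R" and y: "y \<in> carrier R"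
  shows "adjoin (adjoin A x) y = adjoin (adjoin A y) x"
proof -
  have "adjoin (adjoin A x) y \<subseteq> adjoin (adjoin A y) x"
    if x: "x \<in> carrier R" and y: "y \<in> carrier R" for x y
  proof -
    note Ay = submodule_adjoin[OF A y]
    have Ax_sub: "adjoin A x \<subseteq> adjoin (adjoin A y) x"
      using adjoin_superset[OF A y] adjoin_superset[OF Ay x] smult_in_adjoin[OF Ay x]
      unfolding adjoin_def[of A x]
      by (intro sum_mod_least submodule_adjoin[OF Ay x]) (auto simp: multiples_def)
    have "multiples M y \<subseteq> adjoin (adjoin A y) x"
      using smult_in_adjoin[OF A y] adjoin_superset[OF Ay x] by (auto simp: multiples_def)
    then show ?thesis
      unfolding adjoin_def[of "adjoin A x" y]
      by (rule sum_mod_least[OF submodule_adjoin[OF Ay x] Ax_sub])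
  qed
  from this[OF x y] this[OF y x] show ?thesis ..
qed

text \<open>Consumes the sequence from its head while enlarging A, where \<open>regular_seq\<close>
  speaks of all prefixes at once. It records the nonzerodivisor conditions.\<close>

primrec regular_seq_mod :: "'c set \<Rightarrow> 'a list \<Rightarrow> bool" where
  "regular_seq_mod A [] \<longleftrightarrow> True"
| "regular_seq_mod A (x # xs) \<longleftrightarrow> regular_mod A x \<and> regular_seq_mod (adjoin A x) xs"

lemma seq_mult_submodule: "set xs \<subseteq> carrier R \<Longrightarrow> submodule (seq_mult R M xs) R M"
  unfolding seq_mult_def by (intro submodule_mspan) auto

lemma seq_mult_Nil: "seq_mult R M [] = {\<zero>\<^bsub>M\<^esub>}"
  using mspan_least[OF zero_submodule, of "{}"] submodule_zero[OF submodule_mspan[of "{}"]]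
  by (auto simp: seq_mult_def)

lemma seq_mult_snoc:
  assumes xs: "set xs \<subseteq> carrier R" and x: "x \<in> carrier R"
  shows "seq_mult R M (xs @ [x]) = adjoin (seq_mult R M xs) x"
proof
  have xs': "set (xs @ [x]) \<subseteq> carrier R" using xs x by simp
  note S = seq_mult_submodule[OF xs] and S' = seq_mult_submodule[OF xs']
  have mem: "y \<odot>\<^bsub>M\<^esub> m \<in> seq_mult R M ys" if "y \<in> set ys" "m \<in> carrier M" for y m ys
    using mspan_superset[of "{y \<odot>\<^bsub>M\<^esub> m | y m. y \<in> set ys \<and> m \<in> carrier M}"] that
    unfolding seq_mult_def by blast
  have "{y \<odot>\<^bsub>M\<^esub> m | y m. y \<in> set (xs @ [x]) \<and> m \<in> carrier M} \<subseteq> adjoin (seq_mult R M xs) x"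
  proof clarify
    fix y m assume ym: "y \<in> set (xs @ [x])" "m \<in> carrier M"
    then consider "y \<in> set xs" | "y = x" by auto
    then show "y \<odot>\<^bsub>M\<^esub> m \<in> adjoin (seq_mult R M xs) x"
      using mem[of y xs m] adjoin_superset[OF S x] smult_in_adjoin[OF S x] ym(2) by cases blast+
  qed
  from mspan_least[OF submodule_adjoin[OF S x] this]
  show "seq_mult R M (xs @ [x]) \<subseteq> adjoin (seq_mult R M xs) x" by (simp add: seq_mult_def)
  have "seq_mult R M xs \<subseteq> seq_mult R M (xs @ [x])"
    unfolding seq_mult_def[of R M xs] using mem[of _ "xs @ [x]"]
    by (intro mspan_least[OF S']) auto
  moreover have "multiples M x \<subseteq> seq_mult R M (xs @ [x])"
    using mem[of x "xs @ [x]"] by (auto simp: multiples_def)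
  ultimately show "adjoin (seq_mult R M xs) x \<subseteq> seq_mult R M (xs @ [x])"
    unfolding adjoin_def by (rule sum_mod_least[OF S'])
qed

text \<open>The prefix \<open>ys\<close> already divided out is generalised, since the recursion
  moves the head of \<open>xs\<close> to its end.\<close>

lemma regular_seq_mod_if_nonzerodivisors:
  assumes "set (ys @ xs) \<subseteq> carrier R"
    and "\<And>i. i < length xs \<Longrightarrow>
      nonzerodivisor_on (quot_mod M (seq_mult R M (ys @ take i xs))) (xs ! i)"
  shows "regular_seq_mod (seq_mult R M ys) xs"
  using assms
proof (induction xs arbitrary: ys)
  case (Cons x xs)
  have ys: "set ys \<subseteq> carrier R" and x: "x \<in> carrier R" using Cons.prems(1) by auto
  have "regular_mod (seq_mult R M ys) x"
    using Cons.prems(2)[of 0] x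
    by (simp add: nonzerodivisor_on_quot_mod_iff[OF seq_mult_submodule[OF ys] x] regular_mod_def)
  moreover have "regular_seq_mod (seq_mult R M (ys @ [x])) xs"
  proof (rule Cons.IH)
    fix i assume "i < length xs"
    then show "nonzerodivisor_on (quot_mod M (seq_mult R M ((ys @ [x]) @ take i xs))) (xs ! i)"
      using Cons.prems(2)[of "Suc i"] by simp
  qed (use Cons.prems(1) in simp)
  ultimately show ?case by (simp add: seq_mult_snoc[OF ys x])
qed simp

lemma regular_seq_imp_regular_seq_mod:
  assumes "regular_seq R M xs"
  shows "regular_seq_mod {\<zero>\<^bsub>M\<^esub>} xs"
  using regular_seq_mod_if_nonzerodivisors[of "[]" xs] assms
  by (simp add: regular_seq_def seq_mult_Nil)

end

section \<open>Chains of primes, exchange of regular elements, and depth\<close>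

lemma prime_chain_Cons:
  assumes "prime_chain R C n" "primeideal P R" "P \<subset> C 0"
  shows "prime_chain R (case_nat P C) (Suc n)"
  using assms by (auto simp: prime_chain_def split: nat.split)

context noetherian_local_module
begin

text \<open>Let K be the elements that \<open>P\<close> carries into A. Were K inside A + xM,
  regularity of x would give K \<subseteq> A + xK, and Nakayama would put K into A. So some class of
  K survives modulo x; its annihilator contains \<open>P\<close> and x.\<close>

lemma ass_adjoin:
  assumes A: "submodule A R M" and P: "P \<in> ass A" and x: "x \<in> \<mm>" "regular_mod A x"
  shows "\<exists>P'\<in>ass (adjoin A x). P \<subset> P'"
proof -
  note xR = max_ideal_closed[OF x(1)]
  obtain u0 where u0: "u0 \<in> carrier M - A" "P = colon A u0" using P by (auto simp: ass_def)
  have PR: "p \<in> carrier R" if "p \<in> P" for p using that u0 by (simp add: colon_def)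
  define K where "K = {u \<in> carrier M. \<forall>p\<in>P. p \<odot>\<^bsub>M\<^esub> u \<in> A}"
  have K: "submodule K R M"
    using submoduleE[OF A] submodule_zero[OF A] PR
    by (intro submoduleI) (auto simp: K_def smult_r_distr smult_r_minus smult_comm)
  have "\<not> K \<subseteq> adjoin A x"
  proof
    assume K_sub: "K \<subseteq> adjoin A x"
    have "K \<subseteq> A"
    proof (rule nakayama[OF A K x(1)])
      fix k assume k: "k \<in> K"
      then obtain w where w: "w \<in> carrier M" "cong_mod A k (x \<odot>\<^bsub>M\<^esub> w)"
        using K_sub adjoin_iff by blast
      have "w \<in> K"
        unfolding K_def
      proof (intro CollectI conjI ballI w(1))
        fix p assume p: "p \<in> P"
        have "cong_mod A (p \<odot>\<^bsub>M\<^esub> k) (x \<odot>\<^bsub>M\<^esub> (p \<odot>\<^bsub>M\<^esub> w))"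
          using cong_mod_smult[OF A w(2) PR[OF p]] smult_comm[OF PR[OF p] xR w(1)] by simp
        moreover have "p \<odot>\<^bsub>M\<^esub> k \<in> A" using k p by (simp add: K_def)
        ultimately have "x \<odot>\<^bsub>M\<^esub> (p \<odot>\<^bsub>M\<^esub> w) \<in> A" using cong_mod_mem_iff[OF A] by blast
        then show "p \<odot>\<^bsub>M\<^esub> w \<in> A" using x(2) PR[OF p] w(1) by (simp add: regular_mod_def)
      qed
      then show "\<exists>k'\<in>K. cong_mod A k (x \<odot>\<^bsub>M\<^esub> k')" using w(2) by blast
    qed
    moreover have "u0 \<in> K" using u0 by (simp add: K_def colon_def)
    ultimately show False using u0(1) by blast
  qed
  then obtain u where u: "u \<in> K" "u \<notin> adjoin A x" by blast
  then have "u \<in> carrier M - adjoin A x" by (simp add: K_def)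
  then obtain P' where P': "P' \<in> ass (adjoin A x)" "colon (adjoin A x) u \<subseteq> P'"
    using ass_exists[OF submodule_adjoin[OF A xR]] by blast
  have "P \<subseteq> colon (adjoin A x) u"
    using u(1) PR adjoin_superset[OF A xR] by (auto simp: K_def colon_def)
  moreover have "x \<in> colon (adjoin A x) u"
    using u(1) xR smult_in_adjoin[OF A xR] by (simp add: K_def colon_def)
  \<comment> \<open>Source of the strict inclusion: a regular element kills no nonzero
    class.\<close>
  moreover have "x \<notin> P" using x(2) u0 by (auto simp: regular_mod_def colon_def)
  ultimately show ?thesis using P' by blast
qed

text \<open>Behind the bound of the depth by dim R/P: each element of the sequence forces a strictly
  larger associated prime of the next quotient.\<close>

lemma prime_chain_from_ass:
  assumes "submodule A R M" "P \<in> ass A" "set xs \<subseteq> \<mm>" "regular_seq_mod A xs"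
  shows "\<exists>C. prime_chain R C (length xs) \<and> C 0 = P"
  using assms
proof (induction xs arbitrary: A P)
  case Nil
  then show ?case by (intro exI[of _ "\<lambda>_. P"]) (auto simp: prime_chain_def ass_def)
next
  case (Cons x xs)
  have x: "x \<in> \<mm>" "regular_mod A x" using Cons.prems by auto
  obtain P' where P': "P' \<in> ass (adjoin A x)" "P \<subset> P'"
    using ass_adjoin[OF Cons.prems(1,2) x] by blast
  obtain C where C: "prime_chain R C (length xs)" "C 0 = P'"
    using Cons.IH[OF submodule_adjoin[OF Cons.prems(1) max_ideal_closed[OF x(1)]] P'(1)]
      Cons.prems(3,4) by auto
  have "primeideal P R" using Cons.prems(2) by (auto simp: ass_def)
  then have "prime_chain R (case_nat P C) (length (x # xs))"
    using prime_chain_Cons[OF C(1)] C(2) P'(2) by simp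
  then show ?case by (intro exI[of _ "case_nat P C"]) simp
qed

text \<open>In the base case no element of the maximal ideal is regular on \<open>M/A\<close>, so \<open>max_seq s A\<close> says
  that \<open>M/A\<close> has an unextendable regular sequence of length \<open>s\<close> in the maximal ideal.\<close>

primrec max_seq :: "nat \<Rightarrow> 'c set \<Rightarrow> bool" where
  "max_seq 0 A \<longleftrightarrow> (\<exists>u\<in>carrier M - A. \<forall>a\<in>\<mm>. a \<odot>\<^bsub>M\<^esub> u \<in> A)"
| "max_seq (Suc s) A \<longleftrightarrow> (\<exists>y\<in>\<mm>. regular_mod A y \<and> max_seq s (adjoin A y))"

lemma max_seq_0_not_regular: "max_seq 0 A \<Longrightarrow> x \<in> \<mm> \<Longrightarrow> \<not> regular_mod A x"
  by (auto simp: regular_mod_def)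

text \<open>With k the residue field, both Hom(k, M/(A + xM)) and Hom(k, M/(A + yM)) are Ext^1(k,
  M/A). Explicitly, u corresponds to v when x u and y v agree modulo A; cancelling x shows that v is
  nonzero, cancelling y that the maximal ideal kills it.\<close>

lemma max_seq_0_exchange:
  assumes A: "submodule A R M" and x: "x \<in> \<mm>" "regular_mod A x" and y: "y \<in> \<mm>" "regular_mod A y"
    and "max_seq 0 (adjoin A y)"
  shows "max_seq 0 (adjoin A x)"
proof -
  note xR = max_ideal_closed[OF x(1)] and yR = max_ideal_closed[OF y(1)]
  obtain u where u: "u \<in> carrier M" "u \<notin> adjoin A y" "\<And>a. a \<in> \<mm> \<Longrightarrow> a \<odot>\<^bsub>M\<^esub> u \<in> adjoin A y"
    using assms(6) by auto
  obtain v where v: "v \<in> carrier M" "cong_mod A (x \<odot>\<^bsub>M\<^esub> u) (y \<odot>\<^bsub>M\<^esub> v)"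
    using u(3)[OF x(1)] adjoin_iff by blast
  have "v \<notin> adjoin A x"
  proof
    assume "v \<in> adjoin A x"
    then obtain w where w: "w \<in> carrier M" "cong_mod A v (x \<odot>\<^bsub>M\<^esub> w)" using adjoin_iff by blast
    have "cong_mod A (x \<odot>\<^bsub>M\<^esub> u) (x \<odot>\<^bsub>M\<^esub> (y \<odot>\<^bsub>M\<^esub> w))"
      using cong_mod_trans[OF A v(2) cong_mod_smult[OF A w(2) yR]] smult_comm[OF yR xR w(1)] by simp
    then have "cong_mod A u (y \<odot>\<^bsub>M\<^esub> w)"
      using regular_mod_cong[OF A x(2) u(1) smult_closed[OF yR w(1)]] by blast
    then show False using u(2) w(1) adjoin_iff by blast
  qed
  moreover have "a \<odot>\<^bsub>M\<^esub> v \<in> adjoin A x" if a: "a \<in> \<mm>" for a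
  proof -
    note aR = max_ideal_closed[OF a]
    obtain w where w: "w \<in> carrier M" "cong_mod A (a \<odot>\<^bsub>M\<^esub> u) (y \<odot>\<^bsub>M\<^esub> w)"
      using u(3)[OF a] adjoin_iff by blast
    have "cong_mod A (x \<odot>\<^bsub>M\<^esub> (a \<odot>\<^bsub>M\<^esub> u)) (y \<odot>\<^bsub>M\<^esub> (a \<odot>\<^bsub>M\<^esub> v))"
      using cong_mod_smult[OF A v(2) aR]
      unfolding smult_comm[OF aR xR u(1)] smult_comm[OF aR yR v(1)] .
    moreover have "cong_mod A (x \<odot>\<^bsub>M\<^esub> (a \<odot>\<^bsub>M\<^esub> u)) (y \<odot>\<^bsub>M\<^esub> (x \<odot>\<^bsub>M\<^esub> w))"
      using cong_mod_smult[OF A w(2) xR] unfolding smult_comm[OF xR yR w(1)] .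
    ultimately have "cong_mod A (y \<odot>\<^bsub>M\<^esub> (a \<odot>\<^bsub>M\<^esub> v)) (y \<odot>\<^bsub>M\<^esub> (x \<odot>\<^bsub>M\<^esub> w))"
      by (rule cong_mod_trans[OF A cong_mod_sym[OF A]])
    then have "cong_mod A (a \<odot>\<^bsub>M\<^esub> v) (x \<odot>\<^bsub>M\<^esub> w)"
      using regular_mod_cong[OF A y(2) smult_closed[OF aR v(1)] smult_closed[OF xR w(1)]] by blast
    then show ?thesis using w(1) adjoin_iff by blast
  qed
  ultimately show ?thesis using v(1) by auto
qed

text \<open>The negation of \<open>max_seq 0\<close> keeps the maximal ideal out of every associated
  prime, so finitely many of these can be avoided for both submodules simultaneously.\<close>

lemma regular_pair_exists:
  assumes A: "submodule A R M" and B: "submodule B R M" and "\<not> max_seq 0 A" "\<not> max_seq 0 B"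
  shows "\<exists>z\<in>\<mm>. regular_mod A z \<and> regular_mod B z"
proof -
  obtain \<P> where \<P>: "finite \<P>" "\<P> \<subseteq> ass A" "\<forall>x\<in>carrier R. \<not> regular_mod A x \<longrightarrow> (\<exists>P\<in>\<P>. x \<in> P)"
    using zerodivisors_finite_ass[OF A] by blast
  obtain \<Q> where \<Q>: "finite \<Q>" "\<Q> \<subseteq> ass B" "\<forall>x\<in>carrier R. \<not> regular_mod B x \<longrightarrow> (\<exists>P\<in>\<Q>. x \<in> P)"
    using zerodivisors_finite_ass[OF B] by blast
  have no: "\<not> \<mm> \<subseteq> P" if "P \<in> ass D" "\<not> max_seq 0 D" for P D
  proof
    assume "\<mm> \<subseteq> P"
    then show False using that unfolding ass_def by (auto simp: colon_def)
  qed
  have "primeideal P R" if "P \<in> \<P> \<union> \<Q>" for P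
    using that \<P>(2) \<Q>(2) by (auto simp: ass_def)
  moreover have "\<not> \<mm> \<subseteq> P" if "P \<in> \<P> \<union> \<Q>" for P
    using that no[OF _ assms(3)] no[OF _ assms(4)] \<P>(2) \<Q>(2) by blast
  ultimately obtain z where "z \<in> \<mm>" "\<forall>P\<in>\<P> \<union> \<Q>. z \<notin> P"
    using R.prime_avoidance[of "\<P> \<union> \<Q>" \<mm>] \<P>(1) \<Q>(1) max_ideal_ideal by blast
  then show ?thesis using \<P>(3) \<Q>(3) max_ideal_closed by blast
qed

text \<open>One half of the permutability of the pair y, z: if y u agrees with z w modulo A, then w
  agrees with some y w', and y cancels.\<close>

lemma regular_mod_adjoin_swap:
  assumes A: "submodule A R M" and y: "regular_mod A y" and z: "z \<in> carrier R"
    and zy: "regular_mod (adjoin A y) z"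
  shows "regular_mod (adjoin A z) y"
  unfolding regular_mod_def
proof (intro conjI ballI impI)
  show yR: "y \<in> carrier R" using y by (simp add: regular_mod_def)
  fix u assume u: "u \<in> carrier M" "y \<odot>\<^bsub>M\<^esub> u \<in> adjoin A z"
  then obtain w where w: "w \<in> carrier M" "cong_mod A (y \<odot>\<^bsub>M\<^esub> u) (z \<odot>\<^bsub>M\<^esub> w)"
    using adjoin_iff by blast
  have "z \<odot>\<^bsub>M\<^esub> w \<in> adjoin A y" using u(1) cong_mod_sym[OF A w(2)] adjoin_iff by blast
  then have "w \<in> adjoin A y" using zy w(1) by (simp add: regular_mod_def)
  then obtain w' where w': "w' \<in> carrier M" "cong_mod A w (y \<odot>\<^bsub>M\<^esub> w')" using adjoin_iff by blast
  have "cong_mod A (y \<odot>\<^bsub>M\<^esub> u) (y \<odot>\<^bsub>M\<^esub> (z \<odot>\<^bsub>M\<^esub> w'))"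
    using cong_mod_trans[OF A w(2) cong_mod_smult[OF A w'(2) z]] smult_comm[OF yR z w'(1)] by simp
  then have "cong_mod A u (z \<odot>\<^bsub>M\<^esub> w')"
    using regular_mod_cong[OF A y u(1) smult_closed[OF z w'(1)]] by blast
  then show "u \<in> adjoin A z" using w'(1) adjoin_iff by blast
qed

text \<open>The half of permutability that rests on Nakayama: the kernel of z on M/A equals y times
  itself, hence is zero.\<close>

lemma regular_mod_descend:
  assumes A: "submodule A R M" and y: "y \<in> \<mm>" "regular_mod A y"
    and z: "regular_mod (adjoin A y) z"
  shows "regular_mod A z"
proof -
  note yR = max_ideal_closed[OF y(1)]
  have zR: "z \<in> carrier R" using z by (simp add: regular_mod_def)
  let ?K = "{u \<in> carrier M. z \<odot>\<^bsub>M\<^esub> u \<in> A}"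
  have K: "submodule ?K R M"
    using submoduleE[OF A] submodule_zero[OF A] zR
    by (intro submoduleI) (auto simp: smult_r_distr smult_r_minus smult_comm[of z])
  have "?K \<subseteq> A"
  proof (rule nakayama[OF A K y(1)])
    fix u assume u: "u \<in> ?K"
    then have "z \<odot>\<^bsub>M\<^esub> u \<in> adjoin A y" using adjoin_superset[OF A yR] by blast
    then have "u \<in> adjoin A y" using z u by (simp add: regular_mod_def)
    then obtain w where w: "w \<in> carrier M" "cong_mod A u (y \<odot>\<^bsub>M\<^esub> w)" using adjoin_iff by blast
    have "cong_mod A (z \<odot>\<^bsub>M\<^esub> u) (y \<odot>\<^bsub>M\<^esub> (z \<odot>\<^bsub>M\<^esub> w))"
      using cong_mod_smult[OF A w(2) zR] smult_comm[OF zR yR w(1)] by simp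
    then have "y \<odot>\<^bsub>M\<^esub> (z \<odot>\<^bsub>M\<^esub> w) \<in> A" using cong_mod_mem_iff[OF A] u by blast
    then have "w \<in> ?K" using y(2) w(1) zR by (simp add: regular_mod_def)
    then show "\<exists>k'\<in>?K. cong_mod A u (y \<odot>\<^bsub>M\<^esub> k')" using w(2) by blast
  qed
  then show ?thesis using zR by (auto simp: regular_mod_def)
qed

text \<open>Rees' exchange argument: a common nonzerodivisor \<open>z\<close> of the quotients by \<open>x\<close> and by \<open>y\<close> is
  moved to the front, and \<open>x\<close> and \<open>y\<close> are exchanged modulo \<open>z\<close>.\<close>

lemma max_seq_exchange:
  assumes "submodule A R M" "x \<in> \<mm>" "regular_mod A x" "y \<in> \<mm>" "regular_mod A y"
    and "max_seq s (adjoin A y)"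
  shows "max_seq s (adjoin A x)"
  using assms
proof (induction s arbitrary: A x y)
  case 0
  then show ?case by (rule max_seq_0_exchange)
next
  case (Suc s)
  note A = Suc.prems(1) and x = Suc.prems(2,3) and y = Suc.prems(4,5)
  note xR = max_ideal_closed[OF x(1)] and yR = max_ideal_closed[OF y(1)]
  note Ax = submodule_adjoin[OF A xR] and Ay = submodule_adjoin[OF A yR]
  obtain y2 where y2: "y2 \<in> \<mm>" "regular_mod (adjoin A y) y2" "max_seq s (adjoin (adjoin A y) y2)"
    using Suc.prems(6) by auto
  \<comment> \<open>The regular element \<open>y2\<close> rules out the base case over y, and the
    base exchange carries this over to x.\<close>
  have "\<not> max_seq 0 (adjoin A y)" using max_seq_0_not_regular y2 by blast
  moreover from this have "\<not> max_seq 0 (adjoin A x)" using max_seq_0_exchange[OF A y x] by blast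
  ultimately obtain z where z: "z \<in> \<mm>" "regular_mod (adjoin A y) z" "regular_mod (adjoin A x) z"
    using regular_pair_exists[OF Ay Ax] by blast
  note zR = max_ideal_closed[OF z(1)]
  have zA: "regular_mod A z" by (rule regular_mod_descend[OF A y z(2)])
  have "max_seq s (adjoin (adjoin A y) z)"
    by (rule Suc.IH[OF Ay z(1,2) y2])
  \<comment> \<open>With z in place of \<open>y2\<close>, the order is changed so that z comes
    first; then the induction hypothesis applies again, over the quotient by z.\<close>
  then have "max_seq s (adjoin (adjoin A z) y)" by (simp only: adjoin_commute[OF A zR yR])
  then have "max_seq s (adjoin (adjoin A z) x)"
    by (rule Suc.IH[OF submodule_adjoin[OF A zR] x(1) regular_mod_adjoin_swap[OF A x(2) zR z(3)]
          y(1) regular_mod_adjoin_swap[OF A y(2) zR z(2)]])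
  then have "max_seq s (adjoin (adjoin A x) z)" by (simp only: adjoin_commute[OF A zR xR])
  then show ?case using z by auto
qed

text \<open>By exchange the unextendable sequence may be taken to start with the head of
  \<open>xs\<close>; both are then shortened.\<close>

lemma regular_seq_length_le:
  assumes "submodule A R M" "max_seq s A" "set xs \<subseteq> \<mm>" "regular_seq_mod A xs"
  shows "length xs \<le> s"
  using assms
proof (induction s arbitrary: A xs)
  case 0
  then show ?case using max_seq_0_not_regular[OF 0(2)] by (cases xs) auto
next
  case (Suc s)
  show ?case
  proof (cases xs)
    case (Cons x ys)
    have x: "x \<in> \<mm>" "regular_mod A x" "set ys \<subseteq> \<mm>" "regular_seq_mod (adjoin A x) ys"
      using Suc.prems(3,4) Cons by auto
    obtain y where y: "y \<in> \<mm>" "regular_mod A y" "max_seq s (adjoin A y)"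
      using Suc.prems(2) by auto
    have "length ys \<le> s"
      using Suc.IH[OF submodule_adjoin[OF Suc.prems(1) max_ideal_closed[OF x(1)]]
          max_seq_exchange[OF Suc.prems(1) x(1,2) y] x(3,4)] .
    then show ?thesis using Cons by simp
  qed simp
qed

text \<open>Noetherian induction: a submodule without such a sequence admits a regular y in the
  maximal ideal, and adjoining y gives a proper submodule by Nakayama, again without such a
  sequence.\<close>

lemma max_seq_exists:
  assumes A: "submodule A R M" "A \<noteq> carrier M"
  shows "\<exists>s. max_seq s A"
proof (rule ccontr)
  let ?\<H> = "{A. submodule A R M \<and> A \<noteq> carrier M \<and> \<not> (\<exists>s. max_seq s A)}"
  assume "\<not> ?thesis"
  then have ne: "?\<H> \<noteq> {}" using A by blast
  have "submodule H R M" if "H \<in> ?\<H>" for H using that by simp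
  from noetherian_module_maximal[OF noetherian_M this ne]
  obtain H where H: "H \<in> ?\<H>" and max: "\<forall>L\<in>?\<H>. H \<subseteq> L \<longrightarrow> L = H" by (rule bexE)
  then have Hs: "submodule H R M" "H \<noteq> carrier M" "\<And>s. \<not> max_seq s H" by auto
  obtain y where y: "y \<in> \<mm>" "regular_mod H y"
    using regular_pair_exists[OF Hs(1) Hs(1) Hs(3) Hs(3)] by blast
  note yR = max_ideal_closed[OF y(1)]
  have "adjoin H y \<noteq> carrier M"
  proof
    assume eq: "adjoin H y = carrier M"
    have "carrier M \<subseteq> H"
      by (rule nakayama[OF Hs(1) carrier_is_submodule y(1)]) (use eq adjoin_iff in blast)
    then show False using Hs(1,2) submoduleE(1)[OF Hs(1)] by blast
  qed
  moreover have "\<not> max_seq s (adjoin H y)" for s using Hs(3)[of "Suc s"] y by auto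
  ultimately have "adjoin H y \<in> ?\<H>" using submodule_adjoin[OF Hs(1) yR] by blast
  \<comment> \<open>By maximality y kills M/H while being regular on it, so H would be all of
    M.\<close>
  then have eq: "adjoin H y = H" using max adjoin_superset[OF Hs(1) yR] by blast
  have "carrier M \<subseteq> H"
  proof
    fix u assume u: "u \<in> carrier M"
    then have "y \<odot>\<^bsub>M\<^esub> u \<in> H" using smult_in_adjoin[OF Hs(1) yR] eq by blast
    then show "u \<in> H" using y(2) u by (simp add: regular_mod_def)
  qed
  then show False using Hs(1,2) submoduleE(1)[OF Hs(1)] by blast
qed

text \<open>Regular sequences have bounded length, so a longest one attains the depth. The chain of
  primes that it yields above P receives Q as an additional bottom.\<close>

lemma depth_less_krull_dim:
  assumes nz: "\<not> zero_module M" and P: "P \<in> ass {\<zero>\<^bsub>M\<^esub>}" and Q: "primeideal Q R" "Q \<subset> P"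
  shows "depth R M < krull_dim R"
proof -
  let ?L = "\<lambda>xs. set xs \<subseteq> \<mm> \<and> regular_seq R M xs"
  have "{\<zero>\<^bsub>M\<^esub>} \<noteq> carrier M" using nz by (simp add: zero_module_def)
  then obtain s where s: "max_seq s {\<zero>\<^bsub>M\<^esub>}" using max_seq_exists[OF zero_submodule] by blast
  \<comment> \<open>A greatest length requires some regular sequence to start from; the empty one
    qualifies because M is nonzero.\<close>
  have nil: "?L []" using nz \<open>{\<zero>\<^bsub>M\<^esub>} \<noteq> carrier M\<close>
    by (simp add: regular_seq_def seq_mult_Nil zero_module_quot_mod_iff[OF zero_submodule])
  have bound: "\<forall>xs. ?L xs \<longrightarrow> length xs < Suc s"
    using regular_seq_length_le[OF zero_submodule s] regular_seq_imp_regular_seq_mod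
    by (simp add: less_Suc_eq_le)
  obtain xs where "?L xs \<and> (\<forall>ys. ?L ys \<longrightarrow> length ys \<le> length xs)"
    using ex_has_greatest_nat[of ?L, OF nil bound] by (rule exE)
  then have xs: "?L xs" "\<forall>ys. ?L ys \<longrightarrow> length ys \<le> length xs" by simp_all
  have "depth R M \<le> enat (length xs)"
    unfolding depth_def by (rule Sup_least) (use xs(2) in auto)
  also have "\<dots> < enat (Suc (length xs))" by simp
  also have "\<dots> \<le> krull_dim R"
  proof -
    obtain C where C: "prime_chain R C (length xs)" "C 0 = P"
      using prime_chain_from_ass[OF zero_submodule P] xs(1) regular_seq_imp_regular_seq_mod by blast
    have "prime_chain R (case_nat Q C) (Suc (length xs))"
      using prime_chain_Cons[OF C(1) Q(1)] Q(2) C(2) by simp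
    then show ?thesis unfolding krull_dim_def by (intro Sup_upper) blast
  qed
  finally show ?thesis .
qed

end

subsection \<open>Minimal primes\<close>

context cring
begin

text \<open>If x were a nonzerodivisor, the multiplicative set \<open>S\<close> of products of
  powers of x with elements outside \<open>P\<close> would avoid zero. An ideal maximal among those
  disjoint from \<open>S\<close> is a prime inside \<open>P\<close> that misses x.\<close>

lemma minimal_prime_zerodivisor:
  assumes noeth: "noetherian_ring R" and P: "primeideal P R"
    and min: "\<And>Q. primeideal Q R \<Longrightarrow> Q \<subseteq> P \<Longrightarrow> Q = P" and x: "x \<in> P"
  shows "\<exists>y\<in>carrier R. y \<noteq> \<zero> \<and> x \<otimes> y = \<zero>"
proof (rule ccontr)
  assume "\<not> ?thesis"
  then have reg: "y = \<zero>" if "y \<in> carrier R" "x \<otimes> y = \<zero>" for y using that by blast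
  interpret P: primeideal P R by (rule P)
  have xR: "x \<in> carrier R" using P.Icarr[OF x] .
  define S where "S = {x [^] (n::nat) \<otimes> s | n s. s \<in> carrier R - P}"
  have SI: "x [^] (n::nat) \<otimes> s \<in> S" if "s \<in> carrier R - P" for n s using that by (auto simp: S_def)
  have S_carrier: "S \<subseteq> carrier R" using xR by (auto simp: S_def)
  have one: "\<one> \<in> carrier R - P" using P.one_imp_carrier P.I_notcarr by blast
  have S_mult: "a \<otimes> b \<in> S" if ab: "a \<in> S" "b \<in> S" for a b
  proof -
    obtain n s where a: "a = x [^] (n::nat) \<otimes> s" "s \<in> carrier R - P" using ab by (auto simp: S_def)
    obtain k t where b: "b = x [^] (k::nat) \<otimes> t" "t \<in> carrier R - P" using ab by (auto simp: S_def)
    have "s \<otimes> t \<in> carrier R - P" using a b P.I_prime[of s t] by blast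
    moreover have "a \<otimes> b = x [^] (n + k) \<otimes> (s \<otimes> t)"
      using a b xR by (simp add: nat_pow_mult[symmetric] m_ac)
    ultimately show ?thesis using SI by simp
  qed
  have pow_reg: "y = \<zero>" if "y \<in> carrier R" "x [^] (n::nat) \<otimes> y = \<zero>" for y n
    using that
  proof (induction n arbitrary: y)
    case (Suc n)
    have "x [^] n \<otimes> (x \<otimes> y) = \<zero>" using Suc.prems xR by (simp add: m_assoc)
    then have "x \<otimes> y = \<zero>" using Suc.IH[of "x \<otimes> y"] xR Suc.prems by simp
    then show ?case using reg Suc.prems by blast
  qed simp
  let ?\<I> = "{I. ideal I R \<and> I \<inter> S = {}}"
  have "\<zero> \<notin> S"
  proof
    assume "\<zero> \<in> S"
    then obtain n s where "\<zero> = x [^] (n::nat) \<otimes> s" "s \<in> carrier R - P" by (auto simp: S_def)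
    then have "s = \<zero>" using pow_reg[of s n] by simp
    then show False using \<open>s \<in> carrier R - P\<close> P.zero_closed by simp
  qed
  then have "{\<zero>} \<in> ?\<I>" using zeroideal by simp
  then have ne: "?\<I> \<noteq> {}" by blast
  have "ideal I R" if "I \<in> ?\<I>" for I using that by simp
  from noetherian_maximal_ideal[OF noeth this ne]
  obtain I where I: "I \<in> ?\<I>" and max: "\<forall>J\<in>?\<I>. I \<subseteq> J \<longrightarrow> J = I" by (rule bexE)
  have I_id: "ideal I R" and I_S: "I \<inter> S = {}" using I by simp_all
  interpret I: ideal I R by (rule I_id)
  have I_P: "I \<subseteq> P"
  proof
    fix i assume i: "i \<in> I"
    show "i \<in> P"
    proof (rule ccontr)
      assume "i \<notin> P"
      then have "x [^] (0::nat) \<otimes> i \<in> S" using SI[of i 0] I.Icarr[OF i] by blast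
      then show False using i I_S I.Icarr[OF i] by auto
    qed
  qed
  \<comment> \<open>Enlarging the maximal \<open>I\<close> by a makes it meet \<open>S\<close>; the
    product of two such meetings would lie in both \<open>I\<close> and \<open>S\<close>.\<close>
  have meets: "\<exists>r\<in>carrier R. \<exists>i\<in>I. i \<oplus> r \<otimes> a \<in> S" if a: "a \<in> carrier R" "a \<notin> I" for a
  proof -
    let ?J = "set_add R I (PIdl a)"
    have J: "ideal ?J R" by (rule add_ideals[OF I_id cgenideal_ideal[OF a(1)]])
    have PI0: "\<zero> \<in> PIdl a"
      using additive_subgroup.zero_closed[OF ideal.axioms(1)[OF cgenideal_ideal[OF a(1)]]] .
    have "i \<in> ?J" if "i \<in> I" for i
      unfolding set_add_def' using that PI0 I.Icarr[OF that] by (intro UN_I[OF that] UN_I[OF PI0]) simp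
    then have "I \<subseteq> ?J" by blast
    moreover have "\<zero> \<oplus> a \<in> ?J"
      unfolding set_add_def' by (intro UN_I[OF I.zero_closed] UN_I[OF cgenideal_self[OF a(1)]]) simp
    then have "?J \<noteq> I" using a by auto
    ultimately have "?J \<notin> ?\<I>" using max by blast
    then have "?J \<inter> S \<noteq> {}" using J by blast
    then show ?thesis by (auto simp: set_add_def' cgenideal_def)
  qed
  have "primeideal I R"
  proof (rule primeidealI[OF I_id cring_axioms])
    show "carrier R \<noteq> I" using I_P one by blast
    fix a b assume ab: "a \<in> carrier R" "b \<in> carrier R" "a \<otimes> b \<in> I"
    show "a \<in> I \<or> b \<in> I"
    proof (rule ccontr)
      assume "\<not> ?thesis"
      then obtain r i t j where r: "r \<in> carrier R" "i \<in> I" "i \<oplus> r \<otimes> a \<in> S"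
        and t: "t \<in> carrier R" "j \<in> I" "j \<oplus> t \<otimes> b \<in> S" using meets ab by meson
      have iR: "i \<in> carrier R" "j \<in> carrier R" using I.Icarr r(2) t(2) by auto
      have "(i \<oplus> r \<otimes> a) \<otimes> (j \<oplus> t \<otimes> b) =
          (i \<otimes> (j \<oplus> t \<otimes> b) \<oplus> (r \<otimes> a) \<otimes> j) \<oplus> (r \<otimes> t) \<otimes> (a \<otimes> b)"
        using ab r t iR by algebra
      moreover have "\<dots> \<in> I"
        using ab r t iR I.I_r_closed[OF r(2), of "j \<oplus> t \<otimes> b"] I.I_l_closed[OF t(2), of "r \<otimes> a"]
          I.I_l_closed[OF ab(3), of "r \<otimes> t"] by simp
      ultimately show False using S_mult[OF r(3) t(3)] I_S by auto
    qed
  qed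
  then have "I = P" using min I_P by blast
  moreover have "x [^] (1::nat) \<otimes> \<one> \<in> S" using SI one by blast
  then have "x \<in> S" using xR by simp
  ultimately show False using x I_S by blast
qed

end

text \<open>The bottom of a chain of length two ending in \<open>p\<close> is minimal, since a
  smaller prime would prolong the chain to length three.\<close>

lemma minimal_prime_below:
  assumes "primeideal p R" "height R p = 2"
  obtains q where "primeideal q R" "q \<subseteq> p" "\<And>Q. primeideal Q R \<Longrightarrow> Q \<subseteq> q \<Longrightarrow> Q = q"
proof -
  have le: "n \<le> 2" if "prime_chain R C n" "C n = p" for C n
  proof -
    have "enat n \<le> height R p" unfolding height_def using that by (intro Sup_upper) blast
    then have "enat n \<le> enat 2" by (simp add: assms(2) numeral_eq_enat)
    then show ?thesis by simp
  qed
  \<comment> \<open>The supremum is attained: without a chain of length 2 all lengths would be at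
    most 1.\<close>
  have "\<exists>C. prime_chain R C 2 \<and> C 2 = p"
  proof (rule ccontr)
    assume none: "\<not> ?thesis"
    have "height R p \<le> enat 1"
      unfolding height_def
    proof (rule Sup_least)
      fix k assume "k \<in> {enat n | n. \<exists>P. prime_chain R P n \<and> P n = p}"
      then obtain n C where n: "k = enat n" "prime_chain R C n" "C n = p" by blast
      then have "n \<noteq> 2" using none by blast
      then show "k \<le> enat 1" using le[OF n(2,3)] n(1) by simp
    qed
    then have "enat 2 \<le> enat 1" by (simp only: assms(2) numeral_eq_enat)
    then show False by simp
  qed
  then obtain C where C: "prime_chain R C 2" "C 2 = p" by blast
  have sub: "C 0 \<subset> C (Suc 0)" "C (Suc 0) \<subset> C 2"
    using C(1) unfolding prime_chain_def by (auto simp: numeral_2_eq_2)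
  show ?thesis
  proof (rule that[of "C 0"])
    show "primeideal (C 0) R" using C(1) by (simp add: prime_chain_def)
    show "C 0 \<subseteq> p" using sub C(2) by blast
    fix Q assume Q: "primeideal Q R" "Q \<subseteq> C 0"
    show "Q = C 0"
    proof (rule ccontr)
      assume "Q \<noteq> C 0"
      then have "prime_chain R (case_nat Q C) (Suc 2)"
        using prime_chain_Cons[OF C(1) Q(1)] Q(2) by blast
      from le[OF this] C(2) show False by simp
    qed
  qed
qed

subsection \<open>Regular elements of Tor-rigid modules\<close>

text \<open>The choice inside \<open>Tor\<close> depends on neither the degree nor N, so one
  resolution computes all degrees and rigidity can be read off a single complex.\<close>

lemma (in module) Tor_resolution:
  assumes "noetherian_ring R" "fin_gen R M"
  shows "\<exists>b d \<epsilon>. free_resolution R M b d \<epsilon> \<and> (\<forall>n. Tor R n M N = tensor_homology R b d n N)"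
proof -
  let ?P = "\<lambda>(b, d). \<exists>\<epsilon>. free_resolution R M b d \<epsilon>"
  have "\<exists>bd. ?P bd" using free_resolution_exists[OF assms] by auto
  then have "?P (SOME bd. ?P bd)" by (rule someI_ex)
  moreover obtain b d where bd: "(SOME bd. ?P bd) = (b, d)" by (cases "SOME bd. ?P bd")
  ultimately obtain \<epsilon> where "free_resolution R M b d \<epsilon>" by auto
  then show ?thesis using bd by (auto simp: Tor_def)
qed

context noetherian_local_module
begin

text \<open>Injectivity of M \<otimes> K -> M appears elementwise: for a in K, the equation d 0 h =
  a g has a solution whose coefficients lie in K. Residue field quotients of M and of K then detect
  the contradiction.\<close>

lemma tor_rigid_regular:
  assumes fg: "fin_gen R M" and rigid: "tor_rigid R M" and nz: "\<not> zero_module M"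
    and xR: "x \<in> carrier R" and reg: "regular_mod {\<zero>\<^bsub>M\<^esub>} x"
    and a0: "a0 \<in> carrier R" "x \<otimes> a0 = \<zero>"
  shows "a0 = \<zero>"
proof (rule ccontr)
  assume "a0 \<noteq> \<zero>"
  have reg': "u = \<zero>\<^bsub>M\<^esub>" if "u \<in> carrier M" "x \<odot>\<^bsub>M\<^esub> u = \<zero>\<^bsub>M\<^esub>" for u
    using reg that by (auto simp: regular_mod_def)
  obtain N :: "('a, (nat \<Rightarrow> 'a) set) module" and n1 where N: "cyclic_quotient R N x n1" "fin_gen R N"
    using R.cyclic_quotient_exists[OF xR] by blast
  obtain b d \<epsilon> where res: "free_resolution R M b d \<epsilon>"
    and Tor1: "Tor R 1 M N = tensor_homology R b d 1 N"
    and Tor2: "Tor R 2 M N = tensor_homology R b d 2 N"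
    using Tor_resolution[OF noetherian fg] by blast
  define F where "F k = free_mod R {..<b k}" for k
  have F: "module R (F k)" for k unfolding F_def by (rule R.free_mod_module)
  have dh: "d k \<in> mod_hom R (F (Suc k)) (F k)"
    and ex: "d (Suc k) ` carrier (F (Suc (Suc k))) = a_kernel (F (Suc k)) (F k) (d k)" for k
    using res by (simp_all add: free_resolution_def Let_def F_def)
  have \<epsilon>h: "\<epsilon> \<in> mod_hom R (F 0) M" and \<epsilon>_surj: "\<epsilon> ` carrier (F 0) = carrier M"
    and ex0: "d 0 ` carrier (F 1) = a_kernel (F 0) M \<epsilon>"
    using res by (simp_all add: free_resolution_def Let_def F_def)
  interpret F0: module R "F 0" by (rule F)
  interpret F1: module R "F (Suc 0)" by (rule F)
  interpret d0: module_hom R "F (Suc 0)" "F 0" "d 0"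
    using F dh by (simp add: module_hom_def module_hom_axioms_def)
  interpret d1: module_hom R "F (Suc (Suc 0))" "F (Suc 0)" "d (Suc 0)"
    using F dh by (simp add: module_hom_def module_hom_axioms_def)
  interpret d2: module_hom R "F (Suc (Suc (Suc 0)))" "F (Suc (Suc 0))" "d (Suc (Suc 0))"
    using F dh by (simp add: module_hom_def module_hom_axioms_def)
  interpret \<epsilon>: module_hom R "F 0" M \<epsilon>
    using F \<epsilon>h module_axioms by (simp add: module_hom_def module_hom_axioms_def)
  have ker_\<epsilon>: "\<exists>h\<in>carrier (F (Suc 0)). d 0 h = g" if "g \<in> carrier (F 0)" "\<epsilon> g = \<zero>\<^bsub>M\<^esub>" for g
  proof -
    have "g \<in> d 0 ` carrier (F 1)" unfolding ex0 \<epsilon>.a_kernel_eq using that by simp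
    then show ?thesis by auto
  qed
  have \<epsilon>_d0: "\<epsilon> (d 0 h) = \<zero>\<^bsub>M\<^esub>" if "h \<in> carrier (F (Suc 0))" for h
  proof -
    have "d 0 h \<in> a_kernel (F 0) M \<epsilon>" using that ex0 by auto
    then show ?thesis by (simp add: \<epsilon>.a_kernel_eq)
  qed
  have ker_d0: "\<exists>k\<in>carrier (F (Suc (Suc 0))). d (Suc 0) k = h"
    if "h \<in> carrier (F (Suc 0))" "d 0 h = \<zero>\<^bsub>F 0\<^esub>" for h
  proof -
    have "h \<in> d (Suc 0) ` carrier (F (Suc (Suc 0)))" unfolding ex d0.a_kernel_eq using that by simp
    then show ?thesis by auto
  qed
  have d0_d1: "d 0 (d (Suc 0) k) = \<zero>\<^bsub>F 0\<^esub>" if "k \<in> carrier (F (Suc (Suc 0)))" for k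
  proof -
    have "d (Suc 0) k \<in> a_kernel (F (Suc 0)) (F 0) (d 0)" using that ex[of 0] by auto
    then show ?thesis by (simp add: d0.a_kernel_eq)
  qed
  have d1_d2: "d (Suc 0) (d (Suc (Suc 0)) k) = \<zero>\<^bsub>F (Suc 0)\<^esub>"
    if "k \<in> carrier (F (Suc (Suc (Suc 0))))" for k
  proof -
    have "d (Suc (Suc 0)) k \<in> a_kernel (F (Suc (Suc 0))) (F (Suc 0)) (d (Suc 0))"
      using that ex[of "Suc 0"] by auto
    then show ?thesis by (simp add: d1.a_kernel_eq)
  qed
  note Tor_iff = cyclic_quotient.zero_tensor_homology_iff[OF N(1) res, folded F_def]
  \<comment> \<open>Vanishing of Tor_1: if d 0 f = x g, then x kills \<epsilon> g, so g = d 0 h by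
    regularity of x, and f - x h is a cycle.\<close>
  have "\<exists>k\<in>carrier (F (Suc (Suc 0))). f \<ominus>\<^bsub>F (Suc 0)\<^esub> d (Suc 0) k \<in> multiples (F (Suc 0)) x"
    if f: "f \<in> carrier (F (Suc 0))" "d 0 f \<in> multiples (F 0) x" for f
  proof -
    obtain g where g: "g \<in> carrier (F 0)" "d 0 f = x \<odot>\<^bsub>F 0\<^esub> g" using f(2) by (auto simp: multiples_def)
    have "x \<odot>\<^bsub>M\<^esub> \<epsilon> g = \<zero>\<^bsub>M\<^esub>" using \<epsilon>_d0[OF f(1)] g xR by (simp add: \<epsilon>.hom_smult)
    then obtain h where h: "h \<in> carrier (F (Suc 0))" "d 0 h = g"
      using ker_\<epsilon>[OF g(1)] reg' g(1) by blast
    have xh: "x \<odot>\<^bsub>F (Suc 0)\<^esub> h \<in> carrier (F (Suc 0))" using xR h by simp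
    have "d 0 (f \<ominus>\<^bsub>F (Suc 0)\<^esub> x \<odot>\<^bsub>F (Suc 0)\<^esub> h) = \<zero>\<^bsub>F 0\<^esub>"
      using f h g xR F0.minus_eq_zero_iff[THEN iffD2] by (simp add: d0.hom_minus[OF f(1) xh] d0.hom_smult)
    then obtain k where k: "k \<in> carrier (F (Suc (Suc 0)))"
      "d (Suc 0) k = f \<ominus>\<^bsub>F (Suc 0)\<^esub> x \<odot>\<^bsub>F (Suc 0)\<^esub> h"
      using ker_d0[OF F1.M.minus_closed[OF f(1) xh]] by blast
    have "f \<ominus>\<^bsub>F (Suc 0)\<^esub> (f \<ominus>\<^bsub>F (Suc 0)\<^esub> x \<odot>\<^bsub>F (Suc 0)\<^esub> h) = x \<odot>\<^bsub>F (Suc 0)\<^esub> h"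
      using f(1) xh by (simp add: F1.M.minus_eq F1.M.minus_add F1.M.a_assoc[symmetric] F1.M.r_neg)
    then have "f \<ominus>\<^bsub>F (Suc 0)\<^esub> d (Suc 0) k \<in> multiples (F (Suc 0)) x"
      unfolding k(2) using F1.smult_in_multiples[OF h(1), of x] by simp
    then show ?thesis using k(1) by (rule bexI)
  qed
  then have "zero_module (Tor R 1 M N)"
    using Tor_iff[of 0] Tor1 by simp
  moreover have "module R N" using N(1) by (simp add: cyclic_quotient_def)
  ultimately have "zero_module (Tor R 2 M N)"
    using rigid N(2) unfolding tor_rigid_def by (meson one_le_numeral)
  then have H2: "\<exists>k\<in>carrier (F (Suc (Suc (Suc 0)))).
      f \<ominus>\<^bsub>F (Suc (Suc 0))\<^esub> d (Suc (Suc 0)) k \<in> multiples (F (Suc (Suc 0))) x"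
    if "f \<in> carrier (F (Suc (Suc 0)))" "d (Suc 0) f \<in> multiples (F (Suc 0)) x" for f
    using Tor_iff[of "Suc 0"] Tor2 that by (simp add: numeral_2_eq_2)

  have "\<not> carrier M \<subseteq> {\<zero>\<^bsub>M\<^esub>}" using nz M.zero_closed by (auto simp: zero_module_def)
  from residue_field_quotient[OF zero_submodule carrier_is_submodule this]
  obtain H v where H: "submodule H R M" and v: "v \<in> carrier M" "v \<notin> H"
    and H_gen: "\<forall>u\<in>carrier M. \<exists>c\<in>carrier R. cong_mod H u (c \<odot>\<^bsub>M\<^esub> v)"
    and H_iff: "\<forall>c\<in>carrier R. c \<odot>\<^bsub>M\<^esub> v \<in> H \<longleftrightarrow> c \<in> \<mm>" by blast

  \<comment> \<open>\<open>E\<close> is \<open>R\<close> as a module over itself, and \<open>\<Phi>\<close> below lifts the composite of \<open>\<epsilon>\<close> with the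
    projection of \<open>M\<close> onto the residue field \<open>M / H\<close> to a linear form on \<open>F 0\<close>.\<close>
  define E where "E = free_mod R {..<Suc 0}"
  define e where "e = basis_elem R (0::nat)"
  have E: "module R E" unfolding E_def by (rule R.free_mod_module)
  interpret E: noetherian_local_module R E
    using E noetherian_local_axioms R.noetherian_free_mod[OF noetherian]
    by (simp add: noetherian_local_module_def noetherian_local_module_axioms_def E_def)
  have e: "e \<in> carrier E" unfolding E_def e_def by (rule R.basis_elem_closed) simp
  have E_eq: "f = f 0 \<odot>\<^bsub>E\<^esub> e" "f 0 \<in> carrier R" if "f \<in> carrier E" for f
    using that by (auto simp: E_def e_def R.free_mod_carrier_iff R.free_mod_simps basis_elem_def fun_eq_iff)
  have E_coord: "(a \<odot>\<^bsub>E\<^esub> e) 0 = a" if "a \<in> carrier R" for a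
    using that by (simp add: E_def e_def R.free_mod_simps basis_elem_def)
  have E_add0: "(f \<oplus>\<^bsub>E\<^esub> g) 0 = f 0 \<oplus> g 0" and E_smult0: "(a \<odot>\<^bsub>E\<^esub> f) 0 = a \<otimes> f 0"
    and E_zero0: "\<zero>\<^bsub>E\<^esub> 0 = \<zero>"
    for f g a
    by (simp_all add: E_def R.free_mod_simps)
  have e0: "e 0 = \<one>" by (simp add: e_def basis_elem_def)

  \<comment> \<open>The coordinate of the i-th generator in the residue field M/H with basis v,
    lifted to R by choice.\<close>
  define c where "c i = (SOME r. r \<in> carrier R \<and> cong_mod H (\<epsilon> (basis_elem R i)) (r \<odot>\<^bsub>M\<^esub> v))" for i
  have basis: "basis_elem R i \<in> carrier (F k)" if "i \<in> {..<b k}" for i k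
    unfolding F_def using that by (rule R.basis_elem_closed)
  have c: "c i \<in> carrier R" "cong_mod H (\<epsilon> (basis_elem R i)) (c i \<odot>\<^bsub>M\<^esub> v)" if "i \<in> {..<b 0}" for i
    using someI_ex[of "\<lambda>r. r \<in> carrier R \<and> cong_mod H (\<epsilon> (basis_elem R i)) (r \<odot>\<^bsub>M\<^esub> v)"]
      H_gen \<epsilon>.hom_closed[OF basis[OF that]] unfolding c_def by blast+
  define \<Phi> where "\<Phi> = lin_ext R E (\<lambda>i. c i \<odot>\<^bsub>E\<^esub> e)"
  have \<Phi>h: "\<Phi> \<in> mod_hom R (F 0) E"
    unfolding \<Phi>_def F_def by (rule E.lin_ext_hom) (use c e in auto)
  interpret \<Phi>: module_hom R "F 0" E \<Phi>
    using F E \<Phi>h by (simp add: module_hom_def module_hom_axioms_def)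
  have \<Phi>_basis: "\<Phi> (basis_elem R i) = c i \<odot>\<^bsub>E\<^esub> e" if "i \<in> {..<b 0}" for i
    using E.lin_ext_basis_elem[of "\<lambda>i. c i \<odot>\<^bsub>E\<^esub> e" i] c(1)[OF that] e by (simp add: \<Phi>_def)
  have \<epsilon>_\<Phi>: "cong_mod H (\<epsilon> f) (\<Phi> f 0 \<odot>\<^bsub>M\<^esub> v)" if "f \<in> carrier (F 0)" for f
    using that unfolding F_def
  proof (induction rule: R.free_mod_induct)
    case zero
    have "(\<lambda>_. \<zero>) = \<zero>\<^bsub>F 0\<^esub>" by (simp add: F_def R.free_mod_simps)
    then show ?case
      using \<epsilon>.hom_zero \<Phi>.hom_zero E_zero0 v cong_mod_refl[OF H M.zero_closed] by simp
  next
    case (add f r i)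
    note add = add[folded F_def]
    note bi = basis[OF add(3)]
    have fR: "\<Phi> f 0 \<in> carrier R" using E_eq(2)[OF \<Phi>.hom_closed[OF add(1)]] .
    have "cong_mod H (\<epsilon> f \<oplus>\<^bsub>M\<^esub> r \<odot>\<^bsub>M\<^esub> \<epsilon> (basis_elem R i))
        (\<Phi> f 0 \<odot>\<^bsub>M\<^esub> v \<oplus>\<^bsub>M\<^esub> r \<odot>\<^bsub>M\<^esub> (c i \<odot>\<^bsub>M\<^esub> v))"
      by (rule cong_mod_add[OF H add(4) cong_mod_smult[OF H c(2)[OF add(3)] add(2)]])
    moreover have "\<epsilon> (f \<oplus>\<^bsub>F 0\<^esub> r \<odot>\<^bsub>F 0\<^esub> basis_elem R i) = \<epsilon> f \<oplus>\<^bsub>M\<^esub> r \<odot>\<^bsub>M\<^esub> \<epsilon> (basis_elem R i)"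
      using add(1,2) bi by (simp add: \<epsilon>.hom_add \<epsilon>.hom_smult)
    moreover have "\<Phi> (f \<oplus>\<^bsub>F 0\<^esub> r \<odot>\<^bsub>F 0\<^esub> basis_elem R i) 0 = \<Phi> f 0 \<oplus> r \<otimes> c i"
      using add(1,2) bi c(1)[OF add(3)]
      by (simp add: \<Phi>.hom_add \<Phi>.hom_smult E_add0 E_smult0 \<Phi>_basis[OF add(3)] e0)
    ultimately show ?case
      unfolding F_def[symmetric] using fR c(1)[OF add(3)] add(2) v(1) by (simp add: smult_l_distr smult_assoc1)
  qed
  \<comment> \<open>Boundaries vanish in M, so their coordinate kills v modulo H and lies in the
    maximal ideal.\<close>
  have \<Phi>_ker: "\<Phi> (d 0 h) 0 \<in> \<mm>" if "h \<in> carrier (F (Suc 0))" for h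
  proof -
    have "\<Phi> (d 0 h) 0 \<odot>\<^bsub>M\<^esub> v \<in> H"
      using cong_mod_mem_iff[OF H \<epsilon>_\<Phi>[OF d0.hom_closed[OF that]]] \<epsilon>_d0[OF that] submodule_zero[OF H]
      by simp
    then show ?thesis using H_iff E_eq(2)[OF \<Phi>.hom_closed[OF d0.hom_closed[OF that]]] by blast
  qed
  \<comment> \<open>A preimage of v; its coordinate t is a unit because v is not in H.\<close>
  obtain g where g: "g \<in> carrier (F 0)" "\<epsilon> g = v" using \<epsilon>_surj v(1) by (metis imageE)
  define t where "t = \<Phi> g 0"
  have tR: "t \<in> carrier R" using E_eq(2)[OF \<Phi>.hom_closed[OF g(1)]] by (simp add: t_def)
  have "t \<notin> \<mm>"
    using cong_mod_mem_iff[OF H \<epsilon>_\<Phi>[OF g(1)]] g(2) v(2) H_iff tR by (simp add: t_def)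

  \<comment> \<open>The annihilator of x, placed inside the rank one module E so that a residue
    field quotient K/L is available; \<open>a0\<close> makes it nonzero.\<close>
  define K where "K = {f \<in> carrier E. x \<odot>\<^bsub>E\<^esub> f = \<zero>\<^bsub>E\<^esub>}"
  have K: "submodule K R E"
    using xR by (intro E.submoduleI)
      (auto simp: K_def E.smult_r_distr E.smult_r_minus E.smult_comm[of x] E.M.add.inv_one)
  have Ke: "r \<odot>\<^bsub>E\<^esub> e \<in> K" if "r \<in> carrier R" "x \<otimes> r = \<zero>" for r
    using that xR e by (simp add: K_def E.smult_assoc1[symmetric])
  have "a0 \<odot>\<^bsub>E\<^esub> e \<noteq> \<zero>\<^bsub>E\<^esub>" using E_coord[OF a0(1)] E_zero0 \<open>a0 \<noteq> \<zero>\<close> by metis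
  then have "\<not> K \<subseteq> {\<zero>\<^bsub>E\<^esub>}" using Ke[OF a0] by blast
  from E.residue_field_quotient[OF E.zero_submodule K this]
  obtain L w where L: "submodule L R E" and w: "w \<in> K" "w \<notin> L"
    and L_gen: "\<forall>k\<in>K. \<exists>c\<in>carrier R. E.cong_mod L k (c \<odot>\<^bsub>E\<^esub> w)"
    and L_iff: "\<forall>c\<in>carrier R. c \<odot>\<^bsub>E\<^esub> w \<in> L \<longleftrightarrow> c \<in> \<mm>" by blast
  have wE: "w \<in> carrier E" using w(1) by (simp add: K_def)
  define a where "a = w 0"
  have aR: "a \<in> carrier R" and w_eq: "w = a \<odot>\<^bsub>E\<^esub> e" using E_eq[OF wE] by (simp_all add: a_def)
  have xa: "x \<otimes> a = \<zero>"
    using w(1) E_smult0[of x w] E_zero0 by (simp add: K_def a_def)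

  \<comment> \<open>An instance of K M = 0: since x a = 0, regularity of x gives a v = 0, and a g is
    a boundary.\<close>
  have "x \<odot>\<^bsub>M\<^esub> (a \<odot>\<^bsub>M\<^esub> v) = \<zero>\<^bsub>M\<^esub>" using xR aR v(1) xa by (simp add: smult_assoc1[symmetric])
  then have "\<epsilon> (a \<odot>\<^bsub>F 0\<^esub> g) = \<zero>\<^bsub>M\<^esub>" using reg' aR v(1) g by (simp add: \<epsilon>.hom_smult)
  then obtain h where h: "h \<in> carrier (F (Suc 0))" "d 0 h = a \<odot>\<^bsub>F 0\<^esub> g"
    using ker_\<epsilon>[of "a \<odot>\<^bsub>F 0\<^esub> g"] aR g(1) by blast
  \<comment> \<open>The cycle x h is a boundary d f, and this f is a cycle modulo x in degree 2, to
    which the vanishing of Tor_2 applies.\<close>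
  have "d 0 (x \<odot>\<^bsub>F (Suc 0)\<^esub> h) = \<zero>\<^bsub>F 0\<^esub>"
    using h g(1) xR aR xa by (simp add: d0.hom_smult F0.smult_assoc1[symmetric])
  then obtain f where f: "f \<in> carrier (F (Suc (Suc 0)))" "d (Suc 0) f = x \<odot>\<^bsub>F (Suc 0)\<^esub> h"
    using ker_d0[of "x \<odot>\<^bsub>F (Suc 0)\<^esub> h"] xR h(1) by blast
  have "d (Suc 0) f \<in> multiples (F (Suc 0)) x" using f(2) F1.smult_in_multiples[OF h(1)] by simp
  then obtain k where k: "k \<in> carrier (F (Suc (Suc (Suc 0))))"
    "f \<ominus>\<^bsub>F (Suc (Suc 0))\<^esub> d (Suc (Suc 0)) k \<in> multiples (F (Suc (Suc 0))) x"
    using H2[OF f(1)] by blast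
  then obtain f' where f': "f' \<in> carrier (F (Suc (Suc 0)))"
    "f \<ominus>\<^bsub>F (Suc (Suc 0))\<^esub> d (Suc (Suc 0)) k = x \<odot>\<^bsub>F (Suc (Suc 0))\<^esub> f'" by (auto simp: multiples_def)
  have "x \<odot>\<^bsub>F (Suc 0)\<^esub> d (Suc 0) f' = d (Suc 0) f \<ominus>\<^bsub>F (Suc 0)\<^esub> \<zero>\<^bsub>F (Suc 0)\<^esub>"
    using d1.hom_smult[OF xR f'(1)] d1.hom_minus[OF f(1) d2.hom_closed[OF k(1)]] d1_d2[OF k(1)] f'(2)
    by simp
  then have xf': "x \<odot>\<^bsub>F (Suc 0)\<^esub> d (Suc 0) f' = x \<odot>\<^bsub>F (Suc 0)\<^esub> h"
    using f F1.minus_zero_right[of "d (Suc 0) f"] d1.hom_closed[OF f(1)] by simp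
  \<comment> \<open>Since f = d k + x f', subtracting d f' from h gives an element killed by x with
    the same image under d 0.\<close>
  define h' where "h' = h \<ominus>\<^bsub>F (Suc 0)\<^esub> d (Suc 0) f'"
  have h'_closed: "h' \<in> carrier (F (Suc 0))"
    unfolding h'_def by (rule F1.M.minus_closed[OF h(1) d1.hom_closed[OF f'(1)]])
  have "x \<odot>\<^bsub>F (Suc 0)\<^esub> h' = \<zero>\<^bsub>F (Suc 0)\<^esub>"
    unfolding h'_def F1.smult_minus_distr[OF xR h(1) d1.hom_closed[OF f'(1)]] xf'
    using F1.minus_eq_zero_iff[THEN iffD2] xR h(1) by simp
  then have h'_coeffs: "x \<otimes> h' j = \<zero>" for j
    by (simp add: F_def R.free_mod_simps fun_eq_iff)
  have d0_h': "d 0 h' = a \<odot>\<^bsub>F 0\<^esub> g"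
    unfolding h'_def d0.hom_minus[OF h(1) d1.hom_closed[OF f'(1)]] d0_d1[OF f'(1)] h(2)
    using F0.minus_zero_right aR g(1) by simp

  \<comment> \<open>The coefficients of \<open>h'\<close> lie in \<open>K\<close> and \<open>\<Phi> \<circ> d 0\<close> has values in \<open>\<mm>\<close>.\<close>
  have "\<Phi> (d 0 h') \<in> L"
  proof (rule R.free_mod_induct_coeffs[where P = "\<lambda>f. \<Phi> (d 0 f) \<in> L"
        and S = "{r. x \<otimes> r = \<zero>}", OF h'_closed[unfolded F_def]], goal_cases)
    case 1
    then show ?case by (simp add: h'_coeffs)
  next
    case 2
    have "(\<lambda>_. \<zero>) = \<zero>\<^bsub>F (Suc 0)\<^esub>" by (simp add: F_def R.free_mod_simps)
    then show ?case using d0.hom_zero \<Phi>.hom_zero E.submodule_zero[OF L] by simp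
  next
    case (3 f r j)
    note f = 3(1)[folded F_def] and bj = basis[OF 3(5)]
    define z where "z = \<Phi> (d 0 (basis_elem R j))"
    have zE: "z \<in> carrier E" and z\<mm>: "z 0 \<in> \<mm>" using bj \<Phi>_ker by (auto simp: z_def)
    have zR: "z 0 \<in> carrier R" using z\<mm> by (rule max_ideal_closed)
    have "r \<odot>\<^bsub>E\<^esub> e \<in> K" using Ke 3(3,4) by simp
    then obtain q where q: "q \<in> carrier R" "E.cong_mod L (r \<odot>\<^bsub>E\<^esub> e) (q \<odot>\<^bsub>E\<^esub> w)" using L_gen by blast
    \<comment> \<open>Multiplication by an element of the maximal ideal sends K into L, as K/L is
      the residue field.\<close>
    have "z 0 \<otimes> q \<in> \<mm>" using ideal.I_r_closed[OF max_ideal_ideal z\<mm> q(1)] .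
    then have "z 0 \<odot>\<^bsub>E\<^esub> (q \<odot>\<^bsub>E\<^esub> w) \<in> L" using L_iff zR q(1) wE by (simp add: E.smult_assoc1[symmetric])
    then have "z 0 \<odot>\<^bsub>E\<^esub> (r \<odot>\<^bsub>E\<^esub> e) \<in> L"
      using E.cong_mod_mem_iff[OF L E.cong_mod_smult[OF L q(2) zR]] by simp
    moreover have "z 0 \<odot>\<^bsub>E\<^esub> (r \<odot>\<^bsub>E\<^esub> e) = r \<odot>\<^bsub>E\<^esub> z"
      using E.smult_comm[OF zR 3(3) e] E_eq(1)[OF zE] by simp
    ultimately have "r \<odot>\<^bsub>E\<^esub> z \<in> L" by simp
    moreover have "\<Phi> (d 0 (f \<oplus>\<^bsub>F (Suc 0)\<^esub> r \<odot>\<^bsub>F (Suc 0)\<^esub> basis_elem R j)) = \<Phi> (d 0 f) \<oplus>\<^bsub>E\<^esub> r \<odot>\<^bsub>E\<^esub> z"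
      using f bj 3(3) by (simp add: z_def d0.hom_add d0.hom_smult \<Phi>.hom_add \<Phi>.hom_smult)
    ultimately show ?case using E.submoduleE(5)[OF L] 3(2) by (simp add: F_def)
  qed
  \<comment> \<open>The same value computed from g is t w; as t is a unit, its membership in L
    contradicts the choice of w.\<close>
  moreover have "\<Phi> (a \<odot>\<^bsub>F 0\<^esub> g) = t \<odot>\<^bsub>E\<^esub> w"
    using aR g(1) tR e E_eq(1)[OF \<Phi>.hom_closed[OF g(1)]] E.smult_comm[OF aR tR e]
    by (simp add: \<Phi>.hom_smult w_eq t_def)
  ultimately have "t \<odot>\<^bsub>E\<^esub> w \<in> L" using d0_h' by simp
  then show False using L_iff tR \<open>t \<notin> \<mm>\<close> by blast
qed

end

text \<open>Vanishing of the localization identifies the fractions u/1 and 0/1, which unfolds to an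
  s outside \<open>p\<close> with s u = 0.\<close>

lemma (in module) annihilator_outside_Supp:
  assumes p: "primeideal p R" "p \<notin> Supp R M" and u: "u \<in> carrier M"
  obtains s where "s \<in> carrier R" "s \<notin> p" "s \<odot>\<^bsub>M\<^esub> u = \<zero>\<^bsub>M\<^esub>"
proof -
  interpret p: primeideal p R by (rule p(1))
  have one: "\<one> \<in> carrier R - p" using p.one_imp_carrier p.I_notcarr by blast
  have "zero_module (localize R M p)" using p by (simp add: Supp_def)
  then have "frac_class R M p ` (carrier M \<times> (carrier R - p)) = {frac_class R M p (\<zero>\<^bsub>M\<^esub>, \<one>)}"
    by (simp add: zero_module_def localize_def)
  then have "frac_class R M p (u, \<one>) = frac_class R M p (\<zero>\<^bsub>M\<^esub>, \<one>)" using u one by blast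
  moreover have "(u, \<one>) \<in> frac_class R M p (u, \<one>)"
    using u one by (auto simp: frac_class_def)
  ultimately have "(u, \<one>) \<in> frac_class R M p (\<zero>\<^bsub>M\<^esub>, \<one>)" by simp
  then obtain s where "s \<in> carrier R - p" "s \<odot>\<^bsub>M\<^esub> (\<one> \<odot>\<^bsub>M\<^esub> \<zero>\<^bsub>M\<^esub>) = s \<odot>\<^bsub>M\<^esub> (\<one> \<odot>\<^bsub>M\<^esub> u)"
    by (auto simp: frac_class_def)
  then show ?thesis using that[of s] u by simp
qed

theorem corollary2p10:
  fixes R :: "('a, 'r) ring_scheme" and M :: "('a, 'b, 'm) module_scheme"
  assumes "noetherian_local_ring R"
    and "krull_dim R \<ge> 2"
    and "module R M" and "fin_gen R M" and "\<not> zero_module M"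
    and "maximal_cohen_macaulay R M"
    and "tor_rigid R M"
  shows "\<forall>p. primeideal p R \<and> height R p = 2 \<longrightarrow> p \<in> Supp R M"
proof (intro allI impI, elim conjE, rule ccontr)
  fix p assume p: "primeideal p R" "height R p = 2" "p \<notin> Supp R M"
  interpret module R M by (rule assms(3))
  have noeth: "noetherian_ring R" using assms(1) by (simp add: noetherian_local_ring_def)
  interpret noetherian_local_module R M
    using assms(1,3) fin_gen_noetherian[OF noeth assms(4)]
    by (simp add: noetherian_local_module_def noetherian_local_def noetherian_local_axioms_def
        noetherian_local_module_axioms_def noetherian_local_ring_def)
  obtain q where q: "primeideal q R" "q \<subseteq> p"
    and q_min: "\<And>Q. primeideal Q R \<Longrightarrow> Q \<subseteq> q \<Longrightarrow> Q = q"
    by (rule minimal_prime_below[OF p(1,2)]) blast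
  interpret q: primeideal q R by (rule q(1))
  have no_regular: "\<not> regular_mod {\<zero>\<^bsub>M\<^esub>} x" if x: "x \<in> q" for x
  proof
    assume reg: "regular_mod {\<zero>\<^bsub>M\<^esub>} x"
    obtain y where "y \<in> carrier R" "y \<noteq> \<zero>\<^bsub>R\<^esub>" "x \<otimes>\<^bsub>R\<^esub> y = \<zero>\<^bsub>R\<^esub>"
      using R.minimal_prime_zerodivisor[OF noeth q(1) q_min x] by blast
    then show False using tor_rigid_regular[OF assms(4,7,5) q.Icarr[OF x] reg] by blast
  qed
  obtain \<P> where \<P>: "finite \<P>" "\<P> \<subseteq> ass {\<zero>\<^bsub>M\<^esub>}"
    "\<forall>x\<in>carrier R. \<not> regular_mod {\<zero>\<^bsub>M\<^esub>} x \<longrightarrow> (\<exists>P\<in>\<P>. x \<in> P)"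
    using zerodivisors_finite_ass[OF zero_submodule] by blast
  have "\<exists>P\<in>\<P>. q \<subseteq> P"
  proof (rule ccontr)
    assume "\<not> ?thesis"
    moreover have "primeideal P R" if "P \<in> \<P>" for P using that \<P>(2) by (auto simp: ass_def)
    ultimately obtain x where "x \<in> q" "\<forall>P\<in>\<P>. x \<notin> P"
      using R.prime_avoidance[OF \<P>(1) q.is_ideal] by blast
    then show False using \<P>(3) no_regular q.Icarr by blast
  qed
  then obtain P where P: "P \<in> ass {\<zero>\<^bsub>M\<^esub>}" "q \<subseteq> P" using \<P>(2) by blast
  then obtain u where u: "u \<in> carrier M" "P = colon {\<zero>\<^bsub>M\<^esub>} u" by (auto simp: ass_def)
  obtain s where "s \<in> carrier R" "s \<notin> p" "s \<odot>\<^bsub>M\<^esub> u = \<zero>\<^bsub>M\<^esub>"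
    by (rule annihilator_outside_Supp[OF p(1,3) u(1)])
  \<comment> \<open>As s kills u, it belongs to P; being outside \<open>p\<close>, it is not in
    q.\<close>
  then have "q \<subset> P" using u(2) P(2) q(2) by (auto simp: colon_def)
  then have "depth R M < krull_dim R" using depth_less_krull_dim[OF assms(5) P(1) q(1)] by blast
  then show False using assms(6) by (simp add: maximal_cohen_macaulay_def)
qed

end
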